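(* The lists of elements $w\in W$ representing minimal non-gatherable triples (minimal NGT) are as follows. (i) Let $R$ be of type $B_n$ ($n\ge3$), $C_n$ ($n\ge 3$) or $D_n$ ($n\ge 4$). For $\gamma$ in the triple one can take an arbitrary $\gamma=\epsilon_i+\epsilon_j$ with $i<j$, subject to $j<n$ for $B_n,C_n$ and $j<n-1$ for $D_n$; the corresponding simple root $\alpha$ is $\epsilon_j-\epsilon_{j+1}$. The element $w$ is the product of the reflections corresponding to the "telescoping" sequence of roots $\epsilon_i+\epsilon_j,\ \epsilon_{i+1}+\epsilon_{j-1},\ldots$ ending with $\epsilon_k+\epsilon_{k+1}$, unless the last root of this sequence is of the form $\epsilon_{k-1}+\epsilon_{k+1}$. In the latter case, the root $\epsilon_k$ (for $B_n$) or $2\epsilon_k$ (for $C_n$) must be added to this sequence, and the pair of roots $\epsilon_k+\epsilon_n,\ \epsilon_k-\epsilon_n$ must be added for $D_n$. Such $w$ is determined uniquely by $\{i,j\}$ and is a product of reflections for pairwise orthogonal roots; in particular, $w^2=\mathrm{id}$. One of these roots must be $\gamma$. (ii) Let $R$ be of type $F_4$. Such $w$ are products of pairwise commuting reflections as well, but $w$ is not uniquely determined by the triple. Omitting the two $w$ that come from $B_3$ and $C_3$ naturally embedded into $F_4$, the remaining ones are exactly the following eight: the four reflections $$s_{1231},\quad s_{1342},\quad s_{1232},\quad s_{2342},$$ and the four products of reflections for two orthogonal roots $$s_{1342}\,s_{1110},\quad s_{0122}\,s_{1231},\quad s_{1222}\,s_{1231},\quad s_{1342}\,s_{1121}.$$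 Moreover ($F_4$ being self-dual), the dual of every element of this list is also in this list. (iii) Let $R$ be of type $E_6$. Omit the $5$ elements coming from the two natural $D_5$-subsystems of $E_6$ ($3+3$ minus the one for the $D_4$ they have in common; these elements are as described in (i)). The remaining ones are exactly the following ten. Two are the reflections $s_{12321|1}$ and $s_{12321|2}$. Two more are the products of three pairwise orthogonal reflections $$s_{12321|1}\,s_{01100|1}\,s_{00110|1},\qquad s_{01221|1}\,s_{12210|1}\,s_{11211|1}.$$ The final six cannot be written as products of orthogonal reflections; written as products of simple reflections they are $$21324354632143254363243,\qquad 32143263214325436321432,$$ $$32435463214325436324354,\qquad 43215432632143254363243,$$ $$2132435463214325436324354,\qquad 4321543263214325436321432,$$ where $i$ abbreviates $s_i=s_{\alpha_i}$ for $1\le i\le 6$ (for instance, the first word is $s_2s_1\cdots s_4s_3$).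
   Context: $R$ is a (finite) reduced irreducible root system with simple roots $\alpha_1,\ldots,\alpha_n$, positive roots $R_+$, $R_-=-R_+$, and Weyl group $W$ generated by $s_i=s_{\alpha_i}$. For $w\in W$ the $\lambda$-set is $\lambda(w)=R_+\cap w^{-1}(R_-)$. A reduced decomposition $w=s_{i_l}\cdots s_{i_2}s_{i_1}$ orders it as the $\lambda$-sequence $\{\alpha^l=w^{-1}s_{i_l}(\alpha_{i_l}),\ldots,\alpha^2=s_{i_1}(\alpha_{i_2}),\alpha^1=\alpha_{i_1}\}$, where $\alpha^1$ is the beginning (first root) and $\alpha^l$ is the end (last root). A Coxeter transformation is a substitution $(\cdots s_is_js_i)\mapsto(\cdots s_js_is_j)$ in a reduced decomposition ($2,3,4$ or $6$ factors according to $0,1,2$ or $3$ laces between $\alpha_i$ and $\alpha_j$ in the Dynkin diagram); it reverses the order of the corresponding segment of consecutive roots in the $\lambda$-sequence. An element $w\in W$ represents a minimal NGT if there is a triple $\{\beta,\gamma=\alpha+\beta,\alpha\}\subset\lambda(w)$ such that $\alpha$ and $\beta$ are correspondingly the beginning and the end of the sequence $\lambda(w)$ and these roots are non-movable inside $\lambda(w)$ using the Coxeter transformations (i.e., any series of Coxeter transformations leaves $\alpha$ first and $\beta$ last). The following length condition is imposed on the triple: $\alpha,\beta,\gamma$ are all long for type $B_n$; all short for type $C_n$; either all long or all short for type $F_4$ (no condition in the simply-laced types). Notation. For $B_n,C_n,D_n$: Bourbaki coordinates, i.e. positive roots $\epsilon_i\pm\epsilon_j$ ($i<j$) together with $\epsilon_i$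 for $B_n$ and $2\epsilon_i$ for $C_n$; simple roots $\epsilon_i-\epsilon_{i+1}$ ($1\le i<n$) and $\epsilon_n$, $2\epsilon_n$, $\epsilon_{n-1}+\epsilon_n$ respectively. $s_\gamma$ denotes the reflection with respect to a root $\gamma$. For $F_4$ (Bourbaki numbering: Dynkin diagram a chain $\alpha_1,\alpha_2,\alpha_3,\alpha_4$ with $\alpha_1,\alpha_2$ long and $\alpha_3,\alpha_4$ short), $abcd$ denotes the root $a\alpha_1+b\alpha_2+c\alpha_3+d\alpha_4$. The naturally embedded $B_3$ and $C_3$ are the subsystems with simple roots $\{\alpha_1,\alpha_2,\alpha_3\}$ and $\{\alpha_2,\alpha_3,\alpha_4\}$. The dual of an element is its image under the identification of $F_4$ with its dual root system, i.e. under the automorphism of $W$ sending $s_i\mapsto s_{5-i}$. For $E_6$ the simple roots are numbered so that $\alpha_1,\alpha_2,\alpha_3,\alpha_4,\alpha_5$ form a chain in the Dynkin diagram and $\alpha_6$ is connected to $\alpha_3$ only; $abcde|f$ denotes the root $a\alpha_1+b\alpha_2+c\alpha_3+d\alpha_4+e\alpha_5+f\alpha_6$. The two natural $D_5$-subsystems are those with simple roots $\{\alpha_1,\alpha_2,\alpha_3,\alpha_4,\alpha_6\}$ and $\{\alpha_2,\alpha_3,\alpha_4,\alpha_5,\alpha_6\}$; their common $D_4$ has simple roots $\{\alpha_2,\alpha_3,\alpha_4,\alpha_6\}$. *)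

theory Defs
  imports "HOL-Analysis.Analysis"
begin

section \<open>Root systems\<close>

text \<open>
  A root system lives in an arbitrary real inner product space and need not span it; Weyl group
  elements are maps of the whole space (trivial on the orthogonal complement of the roots).  This
  way the Weyl group of a subsystem is literally contained in the Weyl group of the full system.
\<close>

definition reflection :: "'a::real_inner \<Rightarrow> 'a \<Rightarrow> 'a" where
  "reflection a x = x - (2 * (x \<bullet> a) / (a \<bullet> a)) *\<^sub>R a"

definition root_system :: "'a::real_inner set \<Rightarrow> bool" where
  "root_system R \<longleftrightarrow>
     finite R \<and> 0 \<notin> R \<and>
     (\<forall>a\<in>R. reflection a ` R = R) \<and>
     (\<forall>a\<in>R. \<forall>b\<in>R. 2 * (b \<bullet> a) / (a \<bullet> a) \<in> \<int>)"

definition reduced_system :: "'a::real_inner set \<Rightarrow> bool" where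
  "reduced_system R \<longleftrightarrow> (\<forall>a\<in>R. \<forall>c. c *\<^sub>R a \<in> R \<longrightarrow> c = 1 \<or> c = -1)"

definition irreducible_system :: "'a::real_inner set \<Rightarrow> bool" where
  "irreducible_system R \<longleftrightarrow>
     R \<noteq> {} \<and>
     \<not> (\<exists>A B. A \<noteq> {} \<and> B \<noteq> {} \<and> A \<union> B = R \<and> (\<forall>a\<in>A. \<forall>b\<in>B. orthogonal a b))"

text \<open>
  The simple roots are \<open>\<alpha> i\<close> for \<open>i\<close> in an index set \<open>I\<close>, so that the subsystem generated by some
  of them is described by a subset of \<open>I\<close>.
\<close>

definition pos_roots :: "'a::real_inner set \<Rightarrow> (nat \<Rightarrow> 'a) \<Rightarrow> nat set \<Rightarrow> 'a set" where
  "pos_roots R \<alpha> I = {r \<in> R. \<exists>c :: nat \<Rightarrow> nat. r = (\<Sum>i\<in>I. real (c i) *\<^sub>R \<alpha> i)}"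

definition neg_roots :: "'a::real_inner set \<Rightarrow> (nat \<Rightarrow> 'a) \<Rightarrow> nat set \<Rightarrow> 'a set" where
  "neg_roots R \<alpha> I = uminus ` pos_roots R \<alpha> I"

definition simple_roots :: "'a::real_inner set \<Rightarrow> (nat \<Rightarrow> 'a) \<Rightarrow> nat set \<Rightarrow> bool" where
  "simple_roots R \<alpha> I \<longleftrightarrow>
     finite I \<and> inj_on \<alpha> I \<and> \<alpha> ` I \<subseteq> R \<and> independent (\<alpha> ` I) \<and>
     R = pos_roots R \<alpha> I \<union> neg_roots R \<alpha> I"

definition subsystem :: "'a::real_inner set \<Rightarrow> (nat \<Rightarrow> 'a) \<Rightarrow> nat set \<Rightarrow> 'a set" where
  "subsystem R \<alpha> J = R \<inter> span (\<alpha> ` J)"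

definition long_root :: "'a::real_inner set \<Rightarrow> 'a \<Rightarrow> bool" where
  "long_root R a \<longleftrightarrow> a \<in> R \<and> (\<forall>b\<in>R. norm b \<le> norm a)"

definition short_root :: "'a::real_inner set \<Rightarrow> 'a \<Rightarrow> bool" where
  "short_root R a \<longleftrightarrow> a \<in> R \<and> (\<forall>b\<in>R. norm a \<le> norm b)"

text \<open>Number of laces between two nodes of the Dynkin diagram.\<close>

definition laces :: "'a::real_inner \<Rightarrow> 'a \<Rightarrow> real" where
  "laces a b = (2 * (a \<bullet> b) / (b \<bullet> b)) * (2 * (b \<bullet> a) / (a \<bullet> a))"


section \<open>The Weyl group, reduced decompositions and \<open>\<lambda>\<close>-sequences\<close>

text \<open>
  Words are written as products are: the list \<open>[i\<^sub>l, \<dots>, i\<^sub>1]\<close> stands for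
  \<open>s\<^bsub>i\<^sub>l\<^esub> \<cdots> s\<^bsub>i\<^sub>1\<^esub>\<close>, and the rightmost factor acts first.
\<close>

definition reflection_product :: "'a::real_inner list \<Rightarrow> 'a \<Rightarrow> 'a" where
  "reflection_product rs = foldr (\<lambda>r f. reflection r \<circ> f) rs id"

definition word_product :: "(nat \<Rightarrow> 'a::real_inner) \<Rightarrow> nat list \<Rightarrow> 'a \<Rightarrow> 'a" where
  "word_product \<alpha> ws = reflection_product (map \<alpha> ws)"

definition weyl_group :: "(nat \<Rightarrow> 'a::real_inner) \<Rightarrow> nat set \<Rightarrow> ('a \<Rightarrow> 'a) set" where
  "weyl_group \<alpha> I = word_product \<alpha> ` lists I"

definition lambda_set ::
  "'a::real_inner set \<Rightarrow> (nat \<Rightarrow> 'a) \<Rightarrow> nat set \<Rightarrow> ('a \<Rightarrow> 'a) \<Rightarrow> 'a set" where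
  "lambda_set R \<alpha> I w = pos_roots R \<alpha> I \<inter> w -` neg_roots R \<alpha> I"

definition reduced_decomposition ::
  "(nat \<Rightarrow> 'a::real_inner) \<Rightarrow> nat set \<Rightarrow> ('a \<Rightarrow> 'a) \<Rightarrow> nat list \<Rightarrow> bool" where
  "reduced_decomposition \<alpha> I w ws \<longleftrightarrow>
     ws \<in> lists I \<and> word_product \<alpha> ws = w \<and>
     (\<forall>vs\<in>lists I. word_product \<alpha> vs = w \<longrightarrow> length ws \<le> length vs)"

text \<open>
  The list \<open>[\<alpha>\<^sup>l, \<dots>, \<alpha>\<^sup>1]\<close> with \<open>\<alpha>\<^sup>p = s\<^bsub>i\<^sub>1\<^esub> \<cdots> s\<^bsub>i\<^sub>p\<^sub>-\<^sub>1\<^esub> (\<alpha>\<^bsub>i\<^sub>p\<^esub>)\<close>: the beginning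
  \<open>\<alpha>\<^sup>1\<close> of the \<open>\<lambda>\<close>-sequence is the last entry of the list, its end \<open>\<alpha>\<^sup>l\<close> is the head.
\<close>

fun lambda_sequence :: "(nat \<Rightarrow> 'a::real_inner) \<Rightarrow> nat list \<Rightarrow> 'a list" where
  "lambda_sequence \<alpha> [] = []"
| "lambda_sequence \<alpha> (i # is) = word_product \<alpha> (rev is) (\<alpha> i) # lambda_sequence \<alpha> is"

fun alternating :: "nat \<Rightarrow> nat \<Rightarrow> nat \<Rightarrow> nat list" where
  "alternating 0 i j = []"
| "alternating (Suc m) i j = i # alternating m j i"

definition coxeter_number :: "real \<Rightarrow> nat" where
  "coxeter_number l = (if l = 0 then 2 else if l = 1 then 3 else if l = 2 then 4 else 6)"

inductive coxeter_transformation ::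
  "(nat \<Rightarrow> 'a::real_inner) \<Rightarrow> nat set \<Rightarrow> nat list \<Rightarrow> nat list \<Rightarrow> bool"
  for \<alpha> :: "nat \<Rightarrow> 'a" and I :: "nat set" where
  "i \<in> I \<Longrightarrow> j \<in> I \<Longrightarrow> i \<noteq> j \<Longrightarrow> m = coxeter_number (laces (\<alpha> i) (\<alpha> j)) \<Longrightarrow>
     coxeter_transformation \<alpha> I (us @ alternating m i j @ vs) (us @ alternating m j i @ vs)"


section \<open>Minimal non-gatherable triples\<close>

datatype dynkin_type = Type_B | Type_C | Type_D | Type_E | Type_F

fun length_condition :: "dynkin_type \<Rightarrow> 'a::real_inner set \<Rightarrow> 'a set \<Rightarrow> bool" where
  "length_condition Type_B R T = (\<forall>a\<in>T. long_root R a)"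
| "length_condition Type_C R T = (\<forall>a\<in>T. short_root R a)"
| "length_condition Type_D R T = True"
| "length_condition Type_E R T = True"
| "length_condition Type_F R T = ((\<forall>a\<in>T. long_root R a) \<or> (\<forall>a\<in>T. short_root R a))"

definition minimal_NGT_triple ::
  "dynkin_type \<Rightarrow> 'a::real_inner set \<Rightarrow> (nat \<Rightarrow> 'a) \<Rightarrow> nat set \<Rightarrow>
    ('a \<Rightarrow> 'a) \<Rightarrow> 'a \<Rightarrow> 'a \<Rightarrow> 'a \<Rightarrow> bool" where
  "minimal_NGT_triple X R \<alpha> I w b g a \<longleftrightarrow>
     w \<in> weyl_group \<alpha> I \<and>
     {b, g, a} \<subseteq> lambda_set R \<alpha> I w \<and> g = a + b \<and>
     length_condition X R {b, g, a} \<and>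
     (\<exists>ws. reduced_decomposition \<alpha> I w ws \<and>
        (\<forall>vs. rtranclp (coxeter_transformation \<alpha> I) ws vs \<longrightarrow>
           last (lambda_sequence \<alpha> vs) = a \<and> hd (lambda_sequence \<alpha> vs) = b))"

definition minimal_NGTs ::
  "dynkin_type \<Rightarrow> 'a::real_inner set \<Rightarrow> (nat \<Rightarrow> 'a) \<Rightarrow> nat set \<Rightarrow> ('a \<Rightarrow> 'a) set" where
  "minimal_NGTs X R \<alpha> I = {w. \<exists>b g a. minimal_NGT_triple X R \<alpha> I w b g a}"

text \<open>
  Pairwise commuting reflections: reflections in two different (non-proportional) roots commute
  if and only if the roots are orthogonal.
\<close>

definition orthogonal_reflections_product :: "'a::real_inner set \<Rightarrow> ('a \<Rightarrow> 'a) \<Rightarrow> bool" where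
  "orthogonal_reflections_product R w \<longleftrightarrow>
     (\<exists>rs. set rs \<subseteq> R \<and> sorted_wrt orthogonal rs \<and> w = reflection_product rs)"


section \<open>The classical series in Bourbaki coordinates\<close>

text \<open>
  The vectors \<open>\<epsilon> 1, \<dots>, \<epsilon> n\<close> are only required to be orthogonal and of the same length, since the
  inner product of a root system of a given type is determined only up to a scalar.
\<close>

definition coordinate_frame :: "nat \<Rightarrow> (nat \<Rightarrow> 'a::real_inner) \<Rightarrow> bool" where
  "coordinate_frame n \<epsilon> \<longleftrightarrow>
     (\<exists>c>0. \<forall>i\<in>{1..n}. \<forall>j\<in>{1..n}. \<epsilon> i \<bullet> \<epsilon> j = (if i = j then c else 0))"

fun bourbaki_extra_roots :: "dynkin_type \<Rightarrow> nat \<Rightarrow> (nat \<Rightarrow> 'a::real_inner) \<Rightarrow> 'a set" where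
  "bourbaki_extra_roots Type_B n \<epsilon> = {\<epsilon> i | i. i \<in> {1..n}}"
| "bourbaki_extra_roots Type_C n \<epsilon> = {2 *\<^sub>R \<epsilon> i | i. i \<in> {1..n}}"
| "bourbaki_extra_roots Type_D n \<epsilon> = {}"

fun bourbaki_last_simple :: "dynkin_type \<Rightarrow> nat \<Rightarrow> (nat \<Rightarrow> 'a::real_inner) \<Rightarrow> 'a" where
  "bourbaki_last_simple Type_B n \<epsilon> = \<epsilon> n"
| "bourbaki_last_simple Type_C n \<epsilon> = 2 *\<^sub>R \<epsilon> n"
| "bourbaki_last_simple Type_D n \<epsilon> = \<epsilon> (n - 1) + \<epsilon> n"

definition bourbaki_coordinates ::
  "dynkin_type \<Rightarrow> nat \<Rightarrow> (nat \<Rightarrow> 'a::real_inner) \<Rightarrow> 'a set \<Rightarrow> (nat \<Rightarrow> 'a) \<Rightarrow> bool" where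
  "bourbaki_coordinates X n \<epsilon> R \<alpha> \<longleftrightarrow>
     X \<in> {Type_B, Type_C, Type_D} \<and> coordinate_frame n \<epsilon> \<and>
     pos_roots R \<alpha> {1..n} =
       {\<epsilon> i + \<epsilon> j | i j. 1 \<le> i \<and> i < j \<and> j \<le> n} \<union>
       {\<epsilon> i - \<epsilon> j | i j. 1 \<le> i \<and> i < j \<and> j \<le> n} \<union> bourbaki_extra_roots X n \<epsilon> \<and>
     (\<forall>i. 1 \<le> i \<and> i < n \<longrightarrow> \<alpha> i = \<epsilon> i - \<epsilon> (i + 1)) \<and>
     \<alpha> n = bourbaki_last_simple X n \<epsilon>"

fun middle_roots :: "dynkin_type \<Rightarrow> nat \<Rightarrow> (nat \<Rightarrow> 'a::real_inner) \<Rightarrow> nat \<Rightarrow> 'a list" where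
  "middle_roots Type_B n \<epsilon> k = [\<epsilon> k]"
| "middle_roots Type_C n \<epsilon> k = [2 *\<^sub>R \<epsilon> k]"
| "middle_roots Type_D n \<epsilon> k = [\<epsilon> k + \<epsilon> n, \<epsilon> k - \<epsilon> n]"

text \<open>
  The roots \<open>\<epsilon> i + \<epsilon> j\<close>, \<open>\<epsilon> (i + 1) + \<epsilon> (j - 1)\<close>, \<open>\<dots>\<close>; the recursion arrives at \<open>i = j = k\<close>
  precisely if the last root of this form is \<open>\<epsilon> (k - 1) + \<epsilon> (k + 1)\<close>.
\<close>

fun telescoping_roots ::
  "dynkin_type \<Rightarrow> nat \<Rightarrow> (nat \<Rightarrow> 'a::real_inner) \<Rightarrow> nat \<Rightarrow> nat \<Rightarrow> 'a list" where
  "telescoping_roots X n \<epsilon> i j =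
     (if i < j then (\<epsilon> i + \<epsilon> j) # telescoping_roots X n \<epsilon> (i + 1) (j - 1)
      else if i = j then middle_roots X n \<epsilon> i
      else [])"

declare telescoping_roots.simps [simp del]

definition telescoping_range :: "dynkin_type \<Rightarrow> nat \<Rightarrow> (nat \<times> nat) set" where
  "telescoping_range X n =
     {(i, j). 1 \<le> i \<and> i < j \<and> j < (if X = Type_D then n - 1 else n)}"


section \<open>The exceptional types\<close>

definition root_of_coeffs :: "(nat \<Rightarrow> 'a::real_inner) \<Rightarrow> nat list \<Rightarrow> 'a" where
  "root_of_coeffs \<alpha> cs = (\<Sum>k<length cs. real (cs ! k) *\<^sub>R \<alpha> (k + 1))"

definition type_F4 :: "'a::real_inner set \<Rightarrow> (nat \<Rightarrow> 'a) \<Rightarrow> bool" where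
  "type_F4 R \<alpha> \<longleftrightarrow>
     laces (\<alpha> 1) (\<alpha> 2) = 1 \<and> laces (\<alpha> 2) (\<alpha> 3) = 2 \<and> laces (\<alpha> 3) (\<alpha> 4) = 1 \<and>
     laces (\<alpha> 1) (\<alpha> 3) = 0 \<and> laces (\<alpha> 1) (\<alpha> 4) = 0 \<and> laces (\<alpha> 2) (\<alpha> 4) = 0 \<and>
     long_root R (\<alpha> 1) \<and> long_root R (\<alpha> 2) \<and> short_root R (\<alpha> 3) \<and> short_root R (\<alpha> 4)"

definition type_E6 :: "(nat \<Rightarrow> 'a::real_inner) \<Rightarrow> bool" where
  "type_E6 \<alpha> \<longleftrightarrow>
     (\<forall>i\<in>{1..6}. \<forall>j\<in>{1..6}. i < j \<longrightarrow>
        laces (\<alpha> i) (\<alpha> j) =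
          (if (i, j) \<in> {(1, 2), (2, 3), (3, 4), (4, 5), (3, 6)} then 1 else 0))"

definition F4_single_roots :: "(nat \<Rightarrow> 'a::real_inner) \<Rightarrow> 'a list list" where
  "F4_single_roots \<alpha> = map (map (root_of_coeffs \<alpha>))
     [[[1,2,3,1]], [[1,3,4,2]], [[1,2,3,2]], [[2,3,4,2]]]"

definition F4_root_pairs :: "(nat \<Rightarrow> 'a::real_inner) \<Rightarrow> 'a list list" where
  "F4_root_pairs \<alpha> = map (map (root_of_coeffs \<alpha>))
     [[[1,3,4,2], [1,1,1,0]], [[0,1,2,2], [1,2,3,1]],
      [[1,2,2,2], [1,2,3,1]], [[1,3,4,2], [1,1,2,1]]]"

definition E6_single_roots :: "(nat \<Rightarrow> 'a::real_inner) \<Rightarrow> 'a list list" where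
  "E6_single_roots \<alpha> = map (map (root_of_coeffs \<alpha>))
     [[[1,2,3,2,1,1]], [[1,2,3,2,1,2]]]"

definition E6_root_triples :: "(nat \<Rightarrow> 'a::real_inner) \<Rightarrow> 'a list list" where
  "E6_root_triples \<alpha> = map (map (root_of_coeffs \<alpha>))
     [[[1,2,3,2,1,1], [0,1,1,0,0,1], [0,0,1,1,0,1]],
      [[0,1,2,2,1,1], [1,2,2,1,0,1], [1,1,2,1,1,1]]]"

definition E6_words :: "nat list list" where
  "E6_words =
     [[2,1,3,2,4,3,5,4,6,3,2,1,4,3,2,5,4,3,6,3,2,4,3],
      [3,2,1,4,3,2,6,3,2,1,4,3,2,5,4,3,6,3,2,1,4,3,2],
      [3,2,4,3,5,4,6,3,2,1,4,3,2,5,4,3,6,3,2,4,3,5,4],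
      [4,3,2,1,5,4,3,2,6,3,2,1,4,3,2,5,4,3,6,3,2,4,3],
      [2,1,3,2,4,3,5,4,6,3,2,1,4,3,2,5,4,3,6,3,2,4,3,5,4],
      [4,3,2,1,5,4,3,2,6,3,2,1,4,3,2,5,4,3,6,3,2,1,4,3,2]]"

end

theory Submission
  imports Defs
begin

text \<open>
  By Matsumoto's theorem all reduced words of \<open>w\<close> are connected by Coxeter transformations, so the
  two ends of the \<open>\<lambda>\<close>-sequence are non-movable if and only if \<open>w\<close> has a unique right descent \<open>i\<close>
  and a unique left descent \<open>j\<close>; then \<open>\<alpha> = \<alpha>\<^sub>i\<close> and \<open>\<beta> = - w\<^sup>-\<^sup>1 \<alpha>\<^sub>j\<close>.  Since \<open>w \<beta>\<close> is negative and \<open>w\<close> sends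
  all other simple roots to positive ones, \<open>\<alpha>\<^sub>i\<close> occurs in \<open>\<beta>\<close>, hence at least twice in \<open>\<gamma>\<close>.

  In the classical types this forces \<open>\<gamma> = \<epsilon>\<^sub>x + \<epsilon>\<^sub>i\<close>.  As \<open>w\<close> is a signed permutation of the
  \<open>\<epsilon>\<^sub>k\<close> that is decreasing on \<open>{1..i}\<close> and on \<open>{i + 1..n}\<close>, and \<open>w\<^sup>-\<^sup>1\<close> has the same
  property with respect to \<open>j\<close>, it follows that \<open>i = j\<close> and that \<open>w\<close> is the telescoping product.

  In the exceptional types the elements with the unique right descent \<open>i\<close> are enumerated through the
  orbit of the \<open>i\<close>-th fundamental weight, and all comparisons of elements of the Weyl group are reduced
  to the heights of the roots \<open>w\<^sup>-\<^sup>1 \<alpha>\<^sub>m\<close>.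
\<close>

section \<open>Reflections and words\<close>

text \<open>The root system is an abstract set of vectors in a space that it need not span: nothing
  about it can be evaluated directly, and equality in the Weyl group is equality of maps on the
  whole space. The way out is that an element without inversions is the identity, so two elements
  agree once one, composed with the inverse of the other, keeps the simple roots positive. For the
  exceptional types everything is moved to integer lists that see only the Cartan matrix. The
  \<open>i\<close>-th coordinate of a root is its pairing with the \<open>i\<close>-th fundamental
  coweight, so the \<open>i\<close>-th coordinates of the roots \<open>inv w (\<alpha> m)\<close>
  describe the image of that coweight under \<open>w\<close>. Its stabilizer is generated by the
  other simple reflections, and the elements without right descents other than \<open>i\<close> are
  the shortest representatives of the cosets. The height is the pairing with the half sum of the
  positive coroots, whose stabilizer is trivial; hence heights determine \<open>w\<close>. That
  \<open>\<gamma>\<close> is a root of the right length becomes the condition that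
  \<open>\<beta>\<close> pairs to -1 with the coroot of \<open>\<alpha>\<close>.\<close>

lemma linear_reflection: "linear (reflection a)"
  by (rule linearI) (simp_all add: reflection_def inner_add_left add_divide_distrib algebra_simps)

lemma reflection_inner [simp]: "reflection a x \<bullet> reflection a y = x \<bullet> y"
  by (cases "a = 0") (simp_all add: reflection_def inner_diff_left inner_diff_right inner_commute field_simps)

lemma reflection_involution [simp]: "reflection a (reflection a x) = x"
  by (cases "a = 0") (simp_all add: reflection_def inner_diff_left)

lemma reflection_comp_self [simp]: "reflection a \<circ> reflection a = id"
  by (simp add: fun_eq_iff)

lemma reflection_self [simp]: "reflection a a = - a"
  by (cases "a = 0") (simp_all add: reflection_def scaleR_2)

lemma reflection_minus: "reflection a (- x) = - reflection a x"
  by (simp add: reflection_def)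

lemma reflection_orthogonal: "x \<bullet> a = 0 \<Longrightarrow> reflection a x = x"
  by (simp add: reflection_def)

lemma reflection_image:
  assumes "linear f" and "\<And>x y. f x \<bullet> f y = x \<bullet> y"
  shows "f (reflection a x) = reflection (f a) (f x)"
  using assms by (simp add: reflection_def linear_diff linear_cmul)

lemma reflection_product_Nil [simp]: "reflection_product [] = id"
  by (simp add: reflection_product_def)

lemma reflection_product_Cons [simp]:
  "reflection_product (r # rs) = reflection r \<circ> reflection_product rs"
  by (simp add: reflection_product_def)

lemma reflection_product_append:
  "reflection_product (rs @ ts) = reflection_product rs \<circ> reflection_product ts"
  by (induction rs) (simp_all add: o_assoc)

lemma linear_reflection_product: "linear (reflection_product rs)"
proof (induction rs)
  case Nil
  then show ?case using linear_id by (simp add: id_def)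
next
  case (Cons r rs)
  then show ?case unfolding reflection_product_Cons by (rule linear_compose[OF _ linear_reflection])
qed

lemma reflection_product_inner [simp]: "reflection_product rs x \<bullet> reflection_product rs y = x \<bullet> y"
  by (induction rs) simp_all

lemma reflection_product_rev [simp]: "reflection_product (rev rs) (reflection_product rs x) = x"
  by (induction rs arbitrary: x) (simp_all add: reflection_product_append)

lemma word_product_Nil [simp]: "word_product \<alpha> [] = id"
  by (simp add: word_product_def)

lemma word_product_Cons [simp]: "word_product \<alpha> (i # ws) = reflection (\<alpha> i) \<circ> word_product \<alpha> ws"
  by (simp add: word_product_def)

lemma word_product_append: "word_product \<alpha> (ws @ vs) = word_product \<alpha> ws \<circ> word_product \<alpha> vs"
  by (simp add: word_product_def reflection_product_append)

lemma word_product_rev [simp]: "word_product \<alpha> (rev ws) (word_product \<alpha> ws x) = x"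
  by (metis reflection_product_rev rev_map word_product_def)

lemma word_product_rev' [simp]: "word_product \<alpha> ws (word_product \<alpha> (rev ws) x) = x"
  by (metis word_product_rev rev_rev_ident)

lemma bij_word_product: "bij (word_product \<alpha> ws)"
  by (rule o_bij[of "word_product \<alpha> (rev ws)"]) (simp_all add: fun_eq_iff)

lemma inv_word_product [simp]: "inv (word_product \<alpha> ws) = word_product \<alpha> (rev ws)"
  by (rule inv_unique_comp) (simp_all add: fun_eq_iff)

lemma word_product_inner [simp]: "word_product \<alpha> ws x \<bullet> word_product \<alpha> ws y = x \<bullet> y"
  by (simp add: word_product_def)

lemma linear_word_product: "linear (word_product \<alpha> ws)"
  by (simp add: word_product_def linear_reflection_product)

lemma weyl_groupE:
  assumes "w \<in> weyl_group \<alpha> I"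
  obtains ws where "ws \<in> lists I" "w = word_product \<alpha> ws"
  using assms by (auto simp: weyl_group_def)

lemma word_product_in_weyl_group: "ws \<in> lists I \<Longrightarrow> word_product \<alpha> ws \<in> weyl_group \<alpha> I"
  by (simp add: weyl_group_def)

lemma id_in_weyl_group: "id \<in> weyl_group \<alpha> I"
  by (metis word_product_Nil word_product_in_weyl_group lists.Nil)

lemma reflection_in_weyl_group: "i \<in> I \<Longrightarrow> reflection (\<alpha> i) \<in> weyl_group \<alpha> I"
  using word_product_in_weyl_group[of "[i]" I \<alpha>] by simp

lemma weyl_group_comp:
  assumes "w \<in> weyl_group \<alpha> I" "v \<in> weyl_group \<alpha> I"
  shows "w \<circ> v \<in> weyl_group \<alpha> I"
proof -
  obtain ws vs where "ws \<in> lists I" "vs \<in> lists I" "w = word_product \<alpha> ws" "v = word_product \<alpha> vs"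
    using assms by (auto elim!: weyl_groupE)
  then show ?thesis
    by (metis append_in_lists_conv word_product_append word_product_in_weyl_group)
qed

lemma weyl_group_inv:
  assumes "w \<in> weyl_group \<alpha> I"
  shows "inv w \<in> weyl_group \<alpha> I"
  using assms by (auto elim!: weyl_groupE intro!: word_product_in_weyl_group)

lemma weyl_group_linear: "w \<in> weyl_group \<alpha> I \<Longrightarrow> linear w"
  by (auto elim!: weyl_groupE simp: linear_word_product)

lemma weyl_group_bij: "w \<in> weyl_group \<alpha> I \<Longrightarrow> bij w"
  by (auto elim!: weyl_groupE simp: bij_word_product)

lemma weyl_group_inner: "w \<in> weyl_group \<alpha> I \<Longrightarrow> w x \<bullet> w y = x \<bullet> y"
  by (auto elim!: weyl_groupE)

lemma weyl_group_inv_apply [simp]: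
  assumes "w \<in> weyl_group \<alpha> I"
  shows "inv w (w x) = x" and "w (inv w x) = x"
  using weyl_group_bij[OF assms] by (simp_all add: bij_is_inj bij_is_surj surj_f_inv_f)

section \<open>Positive roots and length\<close>

text \<open>The index set stays arbitrary so that a subsystem is again an instance, with the same
  \<open>\<alpha>\<close> and fewer indices, and its Weyl group consists of maps of the same
  space.\<close>

locale simple_system =
  fixes R :: "'a::real_inner set" and \<alpha> :: "nat \<Rightarrow> 'a" and I :: "nat set"
  assumes root_system: "root_system R"
    and reduced_system: "reduced_system R"
    and simple_roots: "simple_roots R \<alpha> I"
begin

abbreviation "Pos \<equiv> pos_roots R \<alpha> I"
abbreviation "Neg \<equiv> neg_roots R \<alpha> I"
abbreviation "W \<equiv> weyl_group \<alpha> I"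
abbreviation "s i \<equiv> reflection (\<alpha> i)"

text \<open>The pairing with the \<open>i\<close>-th fundamental coweight. Outside the span of the
  roots \<open>representation\<close> is 0, so the rules for sums below ask for membership in that
  span.\<close>

definition coord :: "nat \<Rightarrow> 'a \<Rightarrow> real" where
  "coord i x = representation (\<alpha> ` I) x (\<alpha> i)"

lemma finite_I: "finite I" and inj_simple: "inj_on \<alpha> I" and simple_root: "i \<in> I \<Longrightarrow> \<alpha> i \<in> R"
  and independent_simple: "independent (\<alpha> ` I)" and roots_eq: "R = Pos \<union> Neg"
  using simple_roots by (auto simp: simple_roots_def)

lemma finite_R: "finite R" and zero_not_root: "0 \<notin> R"
  and reflection_root: "a \<in> R \<Longrightarrow> b \<in> R \<Longrightarrow> reflection a b \<in> R"
  and cartan_integer: "a \<in> R \<Longrightarrow> b \<in> R \<Longrightarrow> 2 * (b \<bullet> a) / (a \<bullet> a) \<in> \<int>"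
  using root_system by (auto simp: root_system_def)

lemma uminus_root: "a \<in> R \<Longrightarrow> - a \<in> R"
  using reflection_root[of a a] by simp

lemma root_inner_pos: "a \<in> R \<Longrightarrow> 0 < a \<bullet> a"
  using zero_not_root by (auto simp: inner_gt_zero_iff)

lemma simple_in_span: "i \<in> I \<Longrightarrow> \<alpha> i \<in> span (\<alpha> ` I)"
  by (simp add: span_base)

lemma pos_in_span: "r \<in> Pos \<Longrightarrow> r \<in> span (\<alpha> ` I)"
  by (auto simp: pos_roots_def intro!: span_sum span_scale simple_in_span)

lemma root_in_span: "r \<in> R \<Longrightarrow> r \<in> span (\<alpha> ` I)"
proof -
  assume "r \<in> R"
  then have "r \<in> Pos \<or> - r \<in> Pos" using roots_eq by (auto simp: neg_roots_def)
  then show ?thesis using pos_in_span span_neg by force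
qed

lemma span_eq_sum_coord: "x \<in> span (\<alpha> ` I) \<Longrightarrow> x = (\<Sum>i\<in>I. coord i x *\<^sub>R \<alpha> i)"
  using real_vector.sum_representation_eq[OF independent_simple, of x "\<alpha> ` I"]
  by (simp add: finite_I sum.reindex[OF inj_simple] coord_def)

lemma coord_add: "x \<in> span (\<alpha> ` I) \<Longrightarrow> y \<in> span (\<alpha> ` I) \<Longrightarrow> coord i (x + y) = coord i x + coord i y"
  by (simp add: coord_def real_vector.representation_add[OF independent_simple])

lemma coord_scale: "x \<in> span (\<alpha> ` I) \<Longrightarrow> coord i (c *\<^sub>R x) = c * coord i x"
  by (simp add: coord_def real_vector.representation_scale[OF independent_simple])

lemma coord_minus: "x \<in> span (\<alpha> ` I) \<Longrightarrow> coord i (- x) = - coord i x"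
  using coord_scale[of x i "-1"] by simp

lemma coord_diff: "x \<in> span (\<alpha> ` I) \<Longrightarrow> y \<in> span (\<alpha> ` I) \<Longrightarrow> coord i (x - y) = coord i x - coord i y"
  by (simp add: coord_def real_vector.representation_diff[OF independent_simple])

lemma coord_sum: "(\<And>k. k \<in> A \<Longrightarrow> f k \<in> span (\<alpha> ` I)) \<Longrightarrow> coord i (\<Sum>k\<in>A. f k) = (\<Sum>k\<in>A. coord i (f k))"
  by (simp add: coord_def real_vector.representation_sum[OF independent_simple])

lemma coord_simple: "i \<in> I \<Longrightarrow> j \<in> I \<Longrightarrow> coord j (\<alpha> i) = (if i = j then 1 else 0)"
  using real_vector.representation_basis[OF independent_simple, of "\<alpha> i"] inj_simple
  by (auto simp: coord_def inj_on_def)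

lemma coord_combination:
  assumes "j \<in> I"
  shows "coord j (\<Sum>i\<in>I. c i *\<^sub>R \<alpha> i) = c j"
proof -
  have "coord j (\<Sum>i\<in>I. c i *\<^sub>R \<alpha> i) = (\<Sum>i\<in>I. coord j (c i *\<^sub>R \<alpha> i))"
    by (rule coord_sum) (simp add: simple_in_span span_scale)
  also have "\<dots> = (\<Sum>i\<in>I. if i = j then c i else 0)"
    using assms by (intro sum.cong) (auto simp: coord_scale simple_in_span coord_simple)
  finally show ?thesis using assms finite_I by simp
qed

lemma pos_coord_nat: "r \<in> Pos \<Longrightarrow> i \<in> I \<Longrightarrow> \<exists>m::nat. coord i r = real m"
  by (auto simp: pos_roots_def coord_combination)

lemma pos_coord_nonneg: "r \<in> Pos \<Longrightarrow> i \<in> I \<Longrightarrow> 0 \<le> coord i r"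
  using pos_coord_nat by fastforce

lemma neg_iff: "r \<in> Neg \<longleftrightarrow> - r \<in> Pos"
  by (force simp: neg_roots_def)

lemma neg_coord_nonpos: "r \<in> Neg \<Longrightarrow> i \<in> I \<Longrightarrow> coord i r \<le> 0"
  using pos_coord_nonneg[of "- r" i] pos_in_span[of "- r"] coord_minus[of "- r" i]
  by (simp add: neg_iff)

lemma pos_root: "r \<in> Pos \<Longrightarrow> r \<in> R"
  by (simp add: pos_roots_def)

lemma neg_root: "r \<in> Neg \<Longrightarrow> r \<in> R"
  using roots_eq by blast

lemma pos_or_neg: "r \<in> R \<Longrightarrow> r \<in> Pos \<or> r \<in> Neg"
  using roots_eq by blast

lemma pos_coord_positive:
  assumes "r \<in> Pos"
  shows "\<exists>i\<in>I. 1 \<le> coord i r"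
proof (rule ccontr)
  assume "\<not> ?thesis"
  then have "coord i r = 0" if "i \<in> I" for i
    using that pos_coord_nat[OF assms that] by fastforce
  then have "r = 0" using span_eq_sum_coord[OF pos_in_span[OF assms]] by simp
  then show False using assms zero_not_root pos_root by blast
qed

lemma pos_not_neg: "r \<in> Pos \<Longrightarrow> r \<notin> Neg"
  using pos_coord_positive neg_coord_nonpos by fastforce

lemma pos_if_coord: "r \<in> R \<Longrightarrow> i \<in> I \<Longrightarrow> 0 < coord i r \<Longrightarrow> r \<in> Pos"
  using pos_or_neg neg_coord_nonpos by fastforce

lemma pos_if_nonneg: "r \<in> R \<Longrightarrow> (\<And>i. i \<in> I \<Longrightarrow> 0 \<le> coord i r) \<Longrightarrow> r \<in> Pos"
  using pos_coord_positive[of "- r"] pos_or_neg root_in_span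
  by (fastforce simp: neg_iff coord_minus)

lemma simple_pos: "i \<in> I \<Longrightarrow> \<alpha> i \<in> Pos"
  by (rule pos_if_coord[of _ i]) (auto simp: simple_root coord_simple)

lemma coord_reflection:
  assumes "i \<in> I" "j \<in> I" "x \<in> span (\<alpha> ` I)"
  shows "coord j (s i x) = coord j x - (if i = j then 2 * (x \<bullet> \<alpha> i) / (\<alpha> i \<bullet> \<alpha> i) else 0)"
  using assms by (simp add: reflection_def coord_diff coord_scale simple_in_span span_scale coord_simple)

text \<open>\<open>s i\<close> changes only the \<open>i\<close>-th coordinate. As the system is
  reduced, a positive root other than \<open>\<alpha> i\<close> is not a multiple of it and has a
  positive coordinate at some \<open>j \<noteq> i\<close>, which survives the reflection.\<close>

lemma reflection_pos:
  assumes "i \<in> I" "r \<in> Pos" "r \<noteq> \<alpha> i"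
  shows "s i r \<in> Pos"
proof -
  have "\<exists>j\<in>I. j \<noteq> i \<and> 0 < coord j r"
  proof (rule ccontr)
    assume *: "\<not> ?thesis"
    then have z: "coord j r = 0" if "j \<in> I" "j \<noteq> i" for j
      using that pos_coord_nonneg[OF assms(2)] by fastforce
    have "r = (\<Sum>j\<in>I. coord j r *\<^sub>R \<alpha> j)"
      by (rule span_eq_sum_coord[OF pos_in_span[OF assms(2)]])
    also have "\<dots> = (\<Sum>j\<in>I. if j = i then coord i r *\<^sub>R \<alpha> i else 0)"
      by (rule sum.cong) (auto simp: z)
    also have "\<dots> = coord i r *\<^sub>R \<alpha> i" using assms(1) finite_I by simp
    finally have r: "r = coord i r *\<^sub>R \<alpha> i" .
    then have "coord i r = 1 \<or> coord i r = -1"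
      using reduced_system simple_root[OF assms(1)] pos_root[OF assms(2)]
      unfolding reduced_system_def by metis
    moreover have "0 \<le> coord i r" using assms pos_coord_nonneg by blast
    ultimately have "coord i r = 1" by linarith
    with r assms(3) show False by simp
  qed
  then obtain j where j: "j \<in> I" "j \<noteq> i" "0 < coord j r" by blast
  then have "0 < coord j (s i r)"
    using assms by (simp add: coord_reflection pos_in_span)
  then show ?thesis
    using j assms by (intro pos_if_coord) (auto intro: reflection_root simple_root pos_root)
qed

lemma weyl_root: "w \<in> W \<Longrightarrow> r \<in> R \<Longrightarrow> w r \<in> R"
proof (elim weyl_groupE)
  fix ws assume "ws \<in> lists I" "w = word_product \<alpha> ws" "r \<in> R"
  then show ?thesis
  proof (induction ws arbitrary: w)
    case (Cons i ws)
    then show ?case using reflection_root[OF simple_root, of i "word_product \<alpha> ws r"] by simp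
  qed simp
qed

lemma weyl_minus: "w \<in> W \<Longrightarrow> w (- x) = - w x"
  by (simp add: weyl_group_linear linear_neg)

lemma weyl_neg_iff: "w \<in> W \<Longrightarrow> w (- x) \<in> Neg \<longleftrightarrow> w x \<in> Pos"
  by (simp add: weyl_minus neg_iff)

lemma weyl_not_pos: "w \<in> W \<Longrightarrow> r \<in> R \<Longrightarrow> w r \<notin> Pos \<longleftrightarrow> w r \<in> Neg"
  using weyl_root[of w r] pos_or_neg pos_not_neg by blast

lemma weyl_eq_sum_coord:
  assumes "w \<in> W" "x \<in> span (\<alpha> ` I)"
  shows "w x = (\<Sum>i\<in>I. coord i x *\<^sub>R w (\<alpha> i))"
proof -
  have "w x = w (\<Sum>i\<in>I. coord i x *\<^sub>R \<alpha> i)"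
    by (rule arg_cong[OF span_eq_sum_coord[OF assms(2)]])
  also have "\<dots> = (\<Sum>i\<in>I. coord i x *\<^sub>R w (\<alpha> i))"
    using weyl_group_linear[OF assms(1)] by (simp add: linear_sum linear_cmul)
  finally show ?thesis .
qed

lemma weyl_span:
  assumes "w \<in> W" "x \<in> span (\<alpha> ` I)"
  shows "w x \<in> span (\<alpha> ` I)"
  unfolding weyl_eq_sum_coord[OF assms]
  by (intro span_sum span_scale root_in_span weyl_root[OF assms(1)] simple_root)

lemma coord_weyl:
  assumes "w \<in> W" "x \<in> span (\<alpha> ` I)"
  shows "coord k (w x) = (\<Sum>i\<in>I. coord i x * coord k (w (\<alpha> i)))"
proof -
  have "coord k (w x) = (\<Sum>i\<in>I. coord k (coord i x *\<^sub>R w (\<alpha> i)))"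
    unfolding weyl_eq_sum_coord[OF assms]
    by (intro coord_sum span_scale weyl_span[OF assms(1)] simple_in_span)
  then show ?thesis by (simp add: coord_scale weyl_span[OF assms(1)] simple_in_span)
qed

lemma weyl_pos:
  assumes "w \<in> W" "r \<in> Pos" "\<And>i. i \<in> I \<Longrightarrow> coord i r \<noteq> 0 \<Longrightarrow> w (\<alpha> i) \<in> Pos"
  shows "w r \<in> Pos"
proof (rule pos_if_nonneg)
  show "w r \<in> R" using assms weyl_root[of w r] pos_root by blast
  fix k assume "k \<in> I"
  then have "0 \<le> coord i r * coord k (w (\<alpha> i))" if "i \<in> I" for i
    using that assms by (cases "coord i r = 0") (auto intro!: mult_nonneg_nonneg pos_coord_nonneg)
  then show "0 \<le> coord k (w r)"
    using assms by (simp add: coord_weyl pos_in_span sum_nonneg)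
qed

section \<open>Inversion sets, length and the exchange condition\<close>

abbreviation "Lambda \<equiv> lambda_set R \<alpha> I"

definition ell :: "('a \<Rightarrow> 'a) \<Rightarrow> nat" where
  "ell w = card (Lambda w)"

lemma finite_lambda_set: "finite (Lambda w)"
  using finite_R by (auto simp: lambda_set_def pos_roots_def)

text \<open>Apart from \<open>\<alpha> i\<close> itself, \<open>s i\<close> permutes the positive
  roots, so the inversions of \<open>w\<close> are carried along and \<open>\<alpha> i\<close> is
  added.\<close>

lemma lambda_set_comp_reflection:
  assumes "w \<in> W" "i \<in> I" "w (\<alpha> i) \<in> Pos"
  shows "Lambda (w \<circ> s i) = insert (\<alpha> i) (s i ` Lambda w)"
proof (intro equalityI subsetI)
  fix r assume r: "r \<in> Lambda (w \<circ> s i)"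
  show "r \<in> insert (\<alpha> i) (s i ` Lambda w)"
  proof (cases "r = \<alpha> i")
    case False
    then have "s i r \<in> Lambda w" using r assms reflection_pos by (simp add: lambda_set_def)
    then show ?thesis by (metis image_eqI insertI2 reflection_involution)
  qed simp
next
  fix r assume "r \<in> insert (\<alpha> i) (s i ` Lambda w)"
  then consider "r = \<alpha> i" | q where "r = s i q" "q \<in> Pos" "w q \<in> Neg"
    by (auto simp: lambda_set_def)
  then show "r \<in> Lambda (w \<circ> s i)"
  proof cases
    case 1
    then show ?thesis using assms weyl_neg_iff simple_pos by (simp add: lambda_set_def)
  next
    case 2
    then have "q \<noteq> \<alpha> i" using assms pos_not_neg by blast
    then show ?thesis using 2 assms reflection_pos by (simp add: lambda_set_def)
  qed
qed

lemma ell_comp_reflection: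
  assumes "w \<in> W" "i \<in> I" "w (\<alpha> i) \<in> Pos"
  shows "ell (w \<circ> s i) = Suc (ell w)"
proof -
  have inj: "inj_on (s i) A" for A by (metis inj_on_inverseI reflection_involution)
  have "\<alpha> i \<notin> s i ` Lambda w"
  proof
    assume "\<alpha> i \<in> s i ` Lambda w"
    then obtain r where "r \<in> Pos" "\<alpha> i = s i r" by (auto simp: lambda_set_def)
    then have "- \<alpha> i \<in> Pos" by (metis reflection_involution reflection_self)
    then show False using simple_pos[OF assms(2)] by (simp add: neg_iff[symmetric] pos_not_neg)
  qed
  then show ?thesis
    using inj unfolding ell_def lambda_set_comp_reflection[OF assms]
    by (simp add: finite_lambda_set card_image)
qed

lemma ell_comp_reflection_neg:
  assumes "w \<in> W" "i \<in> I" "w (\<alpha> i) \<in> Neg"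
  shows "Suc (ell (w \<circ> s i)) = ell w"
proof -
  have "(w \<circ> s i) (\<alpha> i) \<in> Pos" using assms by (simp add: weyl_minus neg_iff)
  then have "ell (w \<circ> s i \<circ> s i) = Suc (ell (w \<circ> s i))"
    using assms by (intro ell_comp_reflection weyl_group_comp reflection_in_weyl_group)
  then show ?thesis by (simp add: o_assoc[symmetric])
qed

lemma ell_word_le: "ws \<in> lists I \<Longrightarrow> ell (word_product \<alpha> ws) \<le> length ws"
proof (induction ws rule: rev_induct)
  case Nil
  have "Lambda id = {}" using pos_not_neg by (auto simp: lambda_set_def)
  then have "ell (word_product \<alpha> []) \<le> length ([] :: nat list)" by (simp add: ell_def)
  then show ?case .
next
  case (snoc i ws)
  then have "word_product \<alpha> ws \<in> W" "i \<in> I" by (auto intro: word_product_in_weyl_group)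
  then have "ell (word_product \<alpha> (ws @ [i])) \<le> length (ws @ [i])"
    using snoc ell_comp_reflection[of "word_product \<alpha> ws" i] ell_comp_reflection_neg[of "word_product \<alpha> ws" i]
      weyl_not_pos[OF _ simple_root, of "word_product \<alpha> ws" i]
    by (auto simp: word_product_append)
  then show ?case .
qed

text \<open>Applied letter by letter from the right, the word takes \<open>\<alpha> i\<close> from
  positive to negative. The letter \<open>j\<close> that turns it negative must meet it as
  \<open>\<alpha> j\<close>; conjugating \<open>s i\<close> by the letters to the right of
  \<open>j\<close> then gives \<open>s j\<close>, so multiplication by \<open>s i\<close> deletes
  that letter.\<close>

lemma exchange:
  assumes "ws \<in> lists I" "i \<in> I" "word_product \<alpha> ws (\<alpha> i) \<in> Neg"
  shows "\<exists>vs\<in>lists I. Suc (length vs) = length ws \<and> word_product \<alpha> ws \<circ> s i = word_product \<alpha> vs"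
  using assms
proof (induction ws rule: list.induct)
  case Nil
  then show ?case using pos_not_neg simple_pos by auto
next
  case (Cons j ws)
  let ?w = "word_product \<alpha> ws"
  have w: "?w \<in> W" using Cons.prems(1) by (simp add: word_product_in_weyl_group)
  show ?case
  proof (cases "?w (\<alpha> i) \<in> Neg")
    case True
    moreover have "ws \<in> lists I" using Cons.prems(1) by simp
    ultimately obtain vs where vs: "vs \<in> lists I" "Suc (length vs) = length ws"
      "?w \<circ> s i = word_product \<alpha> vs"
      using Cons.IH Cons.prems(2) by blast
    have "word_product \<alpha> (j # ws) \<circ> s i = word_product \<alpha> (j # vs)"
      unfolding word_product_Cons o_assoc[symmetric] vs(3) ..
    moreover have "j # vs \<in> lists I" "Suc (length (j # vs)) = length (j # ws)"
      using vs Cons.prems by simp_all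
    ultimately show ?thesis by blast
  next
    case False
    then have "?w (\<alpha> i) \<in> Pos" using Cons.prems weyl_not_pos[OF w simple_root] by blast
    then have eq: "?w (\<alpha> i) = \<alpha> j"
      using reflection_pos[of j "?w (\<alpha> i)"] Cons.prems pos_not_neg by auto
    have "word_product \<alpha> (j # ws) \<circ> s i = ?w"
    proof
      fix x
      have "?w (s i x) = s j (?w x)"
        using reflection_image[of ?w "\<alpha> i" x] eq by (simp add: linear_word_product)
      then show "(word_product \<alpha> (j # ws) \<circ> s i) x = ?w x" by simp
    qed
    moreover have "ws \<in> lists I" "Suc (length ws) = length (j # ws)"
      using Cons.prems by simp_all
    ultimately show ?thesis by blast
  qed
qed

text \<open>Induction on the number of inversions, removing a simple root that \<open>w\<close>
  makes negative. Without inversions a shortest word must be empty: if it ended in \<open>i\<close>,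
  the exchange condition would produce a word that is two letters shorter.\<close>

lemma minimal_word_length:
  assumes "w \<in> W"
  shows "\<exists>ws\<in>lists I. word_product \<alpha> ws = w \<and> length ws = ell w"
  using assms
proof (induction "ell w" arbitrary: w)
  case 0
  define ws where "ws = (ARG_MIN length ws. ws \<in> lists I \<and> word_product \<alpha> ws = w)"
  have ex: "\<exists>ws. ws \<in> lists I \<and> word_product \<alpha> ws = w" using 0 by (auto elim!: weyl_groupE)
  have ws: "ws \<in> lists I" "word_product \<alpha> ws = w"
    using arg_min_natI[of "\<lambda>ws. ws \<in> lists I \<and> word_product \<alpha> ws = w" _ length] ex
    unfolding ws_def by blast+
  have min: "length ws \<le> length vs" if "vs \<in> lists I" "word_product \<alpha> vs = w" for vs
    using that arg_min_nat_le[of "\<lambda>ws. ws \<in> lists I \<and> word_product \<alpha> ws = w" vs length]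
    unfolding ws_def by blast
  have "ws = []"
  proof (rule ccontr)
    assume "ws \<noteq> []"
    then obtain us i where us: "ws = us @ [i]" by (metis rev_exhaust)
    then have i: "i \<in> I" "us \<in> lists I" using ws by auto
    have "\<alpha> i \<notin> Lambda w" using 0 finite_lambda_set by (auto simp: ell_def)
    then have "w (\<alpha> i) \<in> Pos"
      using i weyl_not_pos[OF 0(2) simple_root] simple_pos by (auto simp: lambda_set_def)
    moreover have "w (\<alpha> i) = - word_product \<alpha> us (\<alpha> i)"
      unfolding ws(2)[symmetric] us by (simp add: word_product_append linear_word_product linear_neg)
    ultimately have "word_product \<alpha> us (\<alpha> i) \<in> Neg"
      by (simp add: neg_iff)
    from exchange[OF i(2,1) this] show False
      using min ws us by (force simp: word_product_append)
  qed
  then show ?case using ws 0 by auto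
next
  case (Suc n)
  have "\<exists>i\<in>I. w (\<alpha> i) \<in> Neg"
  proof (rule ccontr)
    assume "\<not> ?thesis"
    then have "w (\<alpha> i) \<in> Pos" if "i \<in> I" for i
      using that weyl_not_pos[OF Suc.prems simple_root] by blast
    then have "Lambda w = {}" using weyl_pos[OF Suc.prems] pos_not_neg by (auto simp: lambda_set_def)
    then show False using Suc.hyps(2) by (simp add: ell_def)
  qed
  then obtain i where i: "i \<in> I" "w (\<alpha> i) \<in> Neg" by blast
  have v: "w \<circ> s i \<in> W" using i Suc.prems by (simp add: weyl_group_comp reflection_in_weyl_group)
  have "ell (w \<circ> s i) = n" using ell_comp_reflection_neg[OF Suc.prems i] Suc.hyps(2) by simp
  then obtain vs where "vs \<in> lists I" "word_product \<alpha> vs = w \<circ> s i" "length vs = n"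
    using Suc.hyps(1)[of "w \<circ> s i"] v by auto
  then show ?case
    using i Suc.hyps(2)
    by (intro bexI[of _ "vs @ [i]"]) (auto simp: word_product_append o_assoc[symmetric])
qed

lemma reduced_decomposition_iff:
  "reduced_decomposition \<alpha> I w ws \<longleftrightarrow> ws \<in> lists I \<and> word_product \<alpha> ws = w \<and> length ws = ell w"
proof
  assume red: "reduced_decomposition \<alpha> I w ws"
  then have ws: "ws \<in> lists I" "word_product \<alpha> ws = w" by (auto simp: reduced_decomposition_def)
  then obtain vs where "vs \<in> lists I" "word_product \<alpha> vs = w" "length vs = ell w"
    using minimal_word_length[of w] word_product_in_weyl_group by blast
  then have "length ws \<le> ell w" using red by (auto simp: reduced_decomposition_def)
  then show "ws \<in> lists I \<and> word_product \<alpha> ws = w \<and> length ws = ell w"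
    using ws ell_word_le[of ws] by simp
next
  assume ws: "ws \<in> lists I \<and> word_product \<alpha> ws = w \<and> length ws = ell w"
  have "length ws \<le> length vs" if "vs \<in> lists I" "word_product \<alpha> vs = w" for vs
    using ell_word_le[OF that(1)] that(2) ws by simp
  then show "reduced_decomposition \<alpha> I w ws"
    using ws by (simp add: reduced_decomposition_def)
qed

text \<open>No inversions means that the empty word represents \<open>w\<close>, so the equality
  holds on the whole space and not only on the span of the roots. Elements of the Weyl group are
  identified through this criterion.\<close>

lemma weyl_eq_id:
  assumes "w \<in> W" "\<And>i. i \<in> I \<Longrightarrow> w (\<alpha> i) \<in> Pos"
  shows "w = id"
proof -
  have "Lambda w = {}" using weyl_pos[OF assms(1)] assms(2) pos_not_neg by (auto simp: lambda_set_def)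
  then have "ell w = 0" by (simp add: ell_def)
  with minimal_word_length[OF assms(1)] show ?thesis by auto
qed

lemma ell_inv:
  assumes "w \<in> W"
  shows "ell (inv w) = ell w"
proof -
  have "ell (inv v) \<le> ell v" if v: "v \<in> W" for v
  proof -
    obtain vs where "vs \<in> lists I" "word_product \<alpha> vs = v" "length vs = ell v"
      using minimal_word_length[OF v] by blast
    then show ?thesis
      using ell_word_le[of "rev vs"] inv_word_product[of \<alpha> vs] by (simp add: in_lists_conv_set)
  qed
  from this[OF assms] this[OF weyl_group_inv[OF assms]] show ?thesis
    using weyl_group_bij[OF assms] by (simp add: inv_inv_eq)
qed

end

context simple_system begin

section \<open>Coxeter transformations connect the reduced decompositions\<close>

lemma inner_simple_nonpos:
  assumes "i \<in> I" "j \<in> I" "i \<noteq> j"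
  shows "\<alpha> i \<bullet> \<alpha> j \<le> 0"
proof -
  have "\<alpha> j \<noteq> \<alpha> i" using inj_simple assms by (auto simp: inj_on_def)
  then have "0 \<le> coord i (s i (\<alpha> j))"
    using assms by (intro pos_coord_nonneg reflection_pos simple_pos)
  then show ?thesis
    using assms root_inner_pos[OF simple_root[of i]]
    by (simp add: coord_reflection simple_in_span coord_simple divide_le_0_iff inner_commute
        flip: inner_gt_zero_iff)
qed

text \<open>The first index is that of the coroot: row \<open>i\<close> of the matrix records how
  \<open>s i\<close> acts on the simple roots.\<close>

definition cartan :: "nat \<Rightarrow> nat \<Rightarrow> real" where
  "cartan i j = 2 * (\<alpha> j \<bullet> \<alpha> i) / (\<alpha> i \<bullet> \<alpha> i)"

lemma reflection_simple: "s i (\<alpha> j) = \<alpha> j - cartan i j *\<^sub>R \<alpha> i"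
  by (simp add: reflection_def cartan_def)

lemma laces_eq_cartan: "laces (\<alpha> i) (\<alpha> j) = cartan i j * cartan j i"
  by (simp add: laces_def cartan_def inner_commute mult_ac)

lemma cartan_self: "i \<in> I \<Longrightarrow> cartan i i = 2"
  using root_inner_pos[OF simple_root] by (fastforce simp: cartan_def)

lemma cartan_eq_inner: "i \<in> I \<Longrightarrow> cartan i j * (\<alpha> i \<bullet> \<alpha> i) = 2 * (\<alpha> i \<bullet> \<alpha> j)"
  using root_inner_pos[OF simple_root, of i] by (auto simp: cartan_def inner_commute)

lemma cartan_nonpos_int:
  assumes "i \<in> I" "j \<in> I" "i \<noteq> j"
  shows "\<exists>k::nat. cartan i j = - real k"
proof -
  have "cartan i j \<le> 0"
    using inner_simple_nonpos[OF assms] root_inner_pos[OF simple_root[OF assms(1)]]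
    by (simp add: cartan_def divide_le_0_iff inner_commute)
  moreover obtain z where z: "cartan i j = of_int z"
    using cartan_integer[OF simple_root simple_root] assms by (auto simp: cartan_def elim!: Ints_cases)
  ultimately have "cartan i j = - real (nat (- z))" by simp
  then show ?thesis by blast
qed

text \<open>Strict Cauchy-Schwarz for two independent vectors, read off from the squared length of
  \<open>v\<close>, a multiple of the component of \<open>\<alpha> i\<close> orthogonal to
  \<open>\<alpha> j\<close>.\<close>

lemma cartan_product_less:
  assumes "i \<in> I" "j \<in> I" "i \<noteq> j"
  shows "cartan i j * cartan j i < 4"
proof -
  let ?a = "\<alpha> i" and ?b = "\<alpha> j"
  have a: "0 < ?a \<bullet> ?a" and b: "0 < ?b \<bullet> ?b" using assms root_inner_pos simple_root by blast+
  define v where "v = (?b \<bullet> ?b) *\<^sub>R ?a - (?a \<bullet> ?b) *\<^sub>R ?b"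
  have "coord i v = ?b \<bullet> ?b"
    using assms by (simp add: v_def coord_diff coord_scale span_scale simple_in_span coord_simple)
  then have "v \<noteq> 0"
    using b coord_scale[of "\<alpha> i" i 0] assms by (auto simp: simple_in_span)
  then have "0 < v \<bullet> v" by simp
  also have "v \<bullet> v = (?b \<bullet> ?b) * ((?a \<bullet> ?a) * (?b \<bullet> ?b) - (?a \<bullet> ?b) * (?a \<bullet> ?b))"
    by (simp add: v_def inner_diff_left inner_diff_right inner_commute algebra_simps)
  finally have "(?a \<bullet> ?b) * (?a \<bullet> ?b) < (?a \<bullet> ?a) * (?b \<bullet> ?b)"
    using b by (simp add: zero_less_mult_iff)
  then show ?thesis
    using a b by (simp add: cartan_def field_simps inner_commute)
qed

text \<open>The two Cartan integers are nonpositive, vanish together and have a product below 4.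
  Once they are known, each statement about the rank two group is a finite computation.\<close>

lemma cartan_cases:
  assumes "i \<in> I" "j \<in> I" "i \<noteq> j"
  obtains "cartan i j = 0" "cartan j i = 0" "coxeter_number (laces (\<alpha> i) (\<alpha> j)) = 2"
  | "cartan i j = -1" "cartan j i = -1" "coxeter_number (laces (\<alpha> i) (\<alpha> j)) = 3"
  | "cartan i j = -1" "cartan j i = -2" "coxeter_number (laces (\<alpha> i) (\<alpha> j)) = 4"
  | "cartan i j = -2" "cartan j i = -1" "coxeter_number (laces (\<alpha> i) (\<alpha> j)) = 4"
  | "cartan i j = -1" "cartan j i = -3" "coxeter_number (laces (\<alpha> i) (\<alpha> j)) = 6"
  | "cartan i j = -3" "cartan j i = -1" "coxeter_number (laces (\<alpha> i) (\<alpha> j)) = 6"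
proof -
  obtain k l where k: "cartan i j = - real k" and l: "cartan j i = - real l"
    using cartan_nonpos_int assms by metis
  have "real (k * l) < real 4" using cartan_product_less[OF assms] k l by simp
  then have kl: "k * l < 4" by (simp only: of_nat_less_iff)
  have zero: "k = 0 \<longleftrightarrow> l = 0"
  proof -
    have "cartan i j = 0 \<longleftrightarrow> cartan j i = 0"
      using root_inner_pos[OF simple_root] assms by (auto simp: cartan_def inner_commute)
    then show ?thesis using k l by simp
  qed
  have "k < 4 \<and> l < 4"
  proof (cases "k = 0")
    case False
    then have "k \<le> k * l" "l \<le> k * l" using zero by auto
    then show ?thesis using kl by linarith
  qed (use zero in simp)
  then have "k \<in> {0, 1, 2, 3} \<and> l \<in> {0, 1, 2, 3}" by auto
  then consider "k = 0" "l = 0" | "k = 1" "l = 1" | "k = 1" "l = 2" | "k = 2" "l = 1"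
    | "k = 1" "l = 3" | "k = 3" "l = 1"
    using zero kl by auto
  then show thesis
    by cases (use that k l in \<open>simp_all add: laces_eq_cartan coxeter_number_def\<close>)
qed

lemma coxeter_number_commute:
  "coxeter_number (laces (\<alpha> i) (\<alpha> j)) = coxeter_number (laces (\<alpha> j) (\<alpha> i))"
  by (simp add: laces_def mult.commute)

text \<open>The two reflections move \<open>x\<close> only within \<open>x\<close> plus the span of
  \<open>\<alpha> i\<close> and \<open>\<alpha> j\<close>; they act there on the pair
  \<open>(P, Q)\<close>, so that words in them are evaluated by scalar arithmetic.\<close>

lemma reflection_combination:
  assumes "i \<in> I"
  shows "s i (x - P *\<^sub>R \<alpha> i - Q *\<^sub>R \<alpha> j) =
      x - (2 * (x \<bullet> \<alpha> i) / (\<alpha> i \<bullet> \<alpha> i) - P - cartan i j * Q) *\<^sub>R \<alpha> i - Q *\<^sub>R \<alpha> j"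
proof -
  have "2 * ((x - P *\<^sub>R \<alpha> i - Q *\<^sub>R \<alpha> j) \<bullet> \<alpha> i) / (\<alpha> i \<bullet> \<alpha> i)
      = (2 * (x \<bullet> \<alpha> i) - 2 * P * (\<alpha> i \<bullet> \<alpha> i) - 2 * Q * (\<alpha> j \<bullet> \<alpha> i)) / (\<alpha> i \<bullet> \<alpha> i)"
    by (simp add: inner_diff_left right_diff_distrib mult.assoc)
  also have "\<dots> = 2 * (x \<bullet> \<alpha> i) / (\<alpha> i \<bullet> \<alpha> i) - 2 * P - cartan i j * Q"
    using root_inner_pos[OF simple_root[OF assms]]
    by (simp add: cartan_def diff_divide_distrib)
  finally have "2 * ((x - P *\<^sub>R \<alpha> i - Q *\<^sub>R \<alpha> j) \<bullet> \<alpha> i) / (\<alpha> i \<bullet> \<alpha> i)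
      = 2 * (x \<bullet> \<alpha> i) / (\<alpha> i \<bullet> \<alpha> i) - 2 * P - cartan i j * Q" .
  then have "s i (x - P *\<^sub>R \<alpha> i - Q *\<^sub>R \<alpha> j) = x - P *\<^sub>R \<alpha> i - Q *\<^sub>R \<alpha> j -
      (2 * (x \<bullet> \<alpha> i) / (\<alpha> i \<bullet> \<alpha> i) - 2 * P - cartan i j * Q) *\<^sub>R \<alpha> i"
    unfolding reflection_def by (simp only:)
  moreover have "(2 * P) *\<^sub>R \<alpha> i = P *\<^sub>R \<alpha> i + P *\<^sub>R \<alpha> i"
    by (metis mult_2 scaleR_add_left)
  ultimately show ?thesis unfolding scaleR_diff_left by (simp only:) simp
qed

lemma reflection_combination':
  assumes "j \<in> I"
  shows "s j (x - P *\<^sub>R \<alpha> i - Q *\<^sub>R \<alpha> j) =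
      x - P *\<^sub>R \<alpha> i - (2 * (x \<bullet> \<alpha> j) / (\<alpha> j \<bullet> \<alpha> j) - Q - cartan j i * P) *\<^sub>R \<alpha> j"
  using reflection_combination[OF assms, of x Q P i] by (simp add: algebra_simps)

lemma braid_relation:
  assumes "i \<in> I" "j \<in> I" "i \<noteq> j" "m = coxeter_number (laces (\<alpha> i) (\<alpha> j))"
  shows "word_product \<alpha> (alternating m i j) = word_product \<alpha> (alternating m j i)"
proof
  fix x
  \<comment> \<open>The zero multiples bring both vectors into the shape to which the rules for
    combinations apply; this is why \<open>scaleR_zero_left\<close> is switched off below.\<close>
  have s: "s i x = x - (2 * (x \<bullet> \<alpha> i) / (\<alpha> i \<bullet> \<alpha> i)) *\<^sub>R \<alpha> i - 0 *\<^sub>R \<alpha> j"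
    "s j x = x - 0 *\<^sub>R \<alpha> i - (2 * (x \<bullet> \<alpha> j) / (\<alpha> j \<bullet> \<alpha> j)) *\<^sub>R \<alpha> j"
    by (simp_all add: reflection_def)
  note r = s reflection_combination[OF assms(1), of x _ _ j] reflection_combination'[OF assms(2), of x _ i]
  show "word_product \<alpha> (alternating m i j) x = word_product \<alpha> (alternating m j i) x"
    by (rule cartan_cases[OF assms(1-3)])
      (simp_all add: assms(4) numeral_eq_Suc r add_ac del: scaleR_zero_left)
qed

lemma alternating_snoc: "alternating (Suc k) i j = alternating k i j @ [if even k then i else j]"
proof (induction k arbitrary: i j)
  case (Suc k)
  have "alternating (Suc (Suc k)) i j = i # alternating (Suc k) j i" by simp
  also have "\<dots> = alternating (Suc k) i j @ [if even (Suc k) then i else j]" using Suc[of j i] by simp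
  finally show ?case .
qed simp

lemma rev_alternating: "rev (alternating m i j) = (if odd m then alternating m i j else alternating m j i)"
proof (induction m arbitrary: i j)
  case (Suc m)
  then show ?case using alternating_snoc[of m] by auto
qed simp

lemma length_alternating [simp]: "length (alternating m i j) = m"
  by (induction m arbitrary: i j) auto

lemma alternating_lists: "i \<in> I \<Longrightarrow> j \<in> I \<Longrightarrow> alternating m i j \<in> lists I"
  by (induction m arbitrary: i j) auto

text \<open>For \<open>k\<close> below the Coxeter number these vectors are the positive roots of
  the rank two system, in the order given by its longest element. Their coefficients are computed
  separately for each pair of Cartan integers.\<close>

lemma alternating_root_nonneg:
  assumes "i \<in> I" "j \<in> I" "i \<noteq> j" "k < coxeter_number (laces (\<alpha> i) (\<alpha> j))"
  shows "\<exists>P Q. 0 \<le> P \<and> 0 \<le> Q \<and>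
    word_product \<alpha> (alternating k i j) (\<alpha> (if even k then i else j)) = P *\<^sub>R \<alpha> i + Q *\<^sub>R \<alpha> j"
proof -
  define c where "c P Q = P *\<^sub>R \<alpha> i + Q *\<^sub>R \<alpha> j" for P Q
  define C where "C = {c P Q | P Q. 0 \<le> P \<and> 0 \<le> Q}"
  have C: "c P Q \<in> C" if "0 \<le> P" "0 \<le> Q" for P Q using that by (auto simp: C_def)
  have simple: "\<alpha> (if even k then i else j) = (if even k then c 1 0 else c 0 1)" by (simp add: c_def)
  have si: "s i (c P Q) = c (- P - cartan i j * Q) Q" for P Q
    using reflection_combination[OF assms(1), of 0 "- P" "- Q" j]
    by (simp add: c_def algebra_simps)
  have sj: "s j (c P Q) = c P (- Q - cartan j i * P)" for P Q
    using reflection_combination'[OF assms(2), of 0 "- P" i "- Q"]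
    by (simp add: c_def algebra_simps)
  have "word_product \<alpha> (alternating k i j) (if even k then c 1 0 else c 0 1) \<in> C"
  proof (rule cartan_cases[OF assms(1-3)], goal_cases)
    case 1
    then have "k \<in> {0, Suc 0}"
      using assms(4) by (auto simp: numeral_eq_Suc less_Suc_eq)
    then show ?case using 1 by (auto simp: si sj C)
  next
    case 2
    then have "k \<in> {0, Suc 0, Suc (Suc 0)}"
      using assms(4) by (auto simp: numeral_eq_Suc less_Suc_eq)
    then show ?case using 2 by (auto simp: si sj C)
  next
    case 3
    then have "k \<in> {0, Suc 0, Suc (Suc 0), Suc (Suc (Suc 0))}"
      using assms(4) by (auto simp: numeral_eq_Suc less_Suc_eq)
    then show ?case using 3 by (auto simp: si sj C)
  next
    case 4
    then have "k \<in> {0, Suc 0, Suc (Suc 0), Suc (Suc (Suc 0))}"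
      using assms(4) by (auto simp: numeral_eq_Suc less_Suc_eq)
    then show ?case using 4 by (auto simp: si sj C)
  next
    case 5
    then have "k \<in> {0, Suc 0, Suc (Suc 0), Suc (Suc (Suc 0)), Suc (Suc (Suc (Suc 0))), Suc (Suc (Suc (Suc (Suc 0))))}"
      using assms(4) by (auto simp: numeral_eq_Suc less_Suc_eq)
    then show ?case using 5 by (auto simp: si sj C)
  next
    case 6
    then have "k \<in> {0, Suc 0, Suc (Suc 0), Suc (Suc (Suc 0)), Suc (Suc (Suc (Suc 0))), Suc (Suc (Suc (Suc (Suc 0))))}"
      using assms(4) by (auto simp: numeral_eq_Suc less_Suc_eq)
    then show ?case using 6 by (auto simp: si sj C)
  qed
  then show ?thesis unfolding simple by (force simp: C_def c_def)
qed

text \<open>As \<open>w\<close> makes \<open>\<alpha> i\<close> and \<open>\<alpha> j\<close>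
  negative, it makes every root that is a nonnegative combination of them negative, so each further
  letter of the alternating word lowers the length by one.\<close>

lemma ell_reduce_alternating:
  assumes "w \<in> W" "i \<in> I" "j \<in> I" "i \<noteq> j" "w (\<alpha> i) \<in> Neg" "w (\<alpha> j) \<in> Neg"
    and "k \<le> coxeter_number (laces (\<alpha> i) (\<alpha> j))"
  shows "ell (w \<circ> word_product \<alpha> (alternating k i j)) + k = ell w"
  using assms(7)
proof (induction k)
  case (Suc k)
  define h where "h = (if even k then i else j)"
  define u where "u = word_product \<alpha> (alternating k i j)"
  have h: "h \<in> I" using assms by (simp add: h_def)
  have u: "u \<in> W" using assms by (simp add: u_def word_product_in_weyl_group alternating_lists)
  have wu: "w \<circ> u \<in> W" by (rule weyl_group_comp[OF assms(1) u])
  have uh: "u (\<alpha> h) \<in> R" by (rule weyl_root[OF u simple_root[OF h]])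
  obtain P Q where "0 \<le> P" "0 \<le> Q" and PQ: "u (\<alpha> h) = P *\<^sub>R \<alpha> i + Q *\<^sub>R \<alpha> j"
    using alternating_root_nonneg[OF assms(2-4), of k] Suc.prems by (auto simp: u_def h_def)
  have "coord l (w (u (\<alpha> h))) \<le> 0" if l: "l \<in> I" for l
  proof -
    have "w (u (\<alpha> h)) = P *\<^sub>R w (\<alpha> i) + Q *\<^sub>R w (\<alpha> j)"
      unfolding PQ using weyl_group_linear[OF assms(1)] by (simp add: linear_add linear_cmul)
    then have "coord l (w (u (\<alpha> h))) = P * coord l (w (\<alpha> i)) + Q * coord l (w (\<alpha> j))"
      using weyl_span[OF assms(1) simple_in_span] assms(2,3)
      by (simp add: coord_add coord_scale span_scale)
    then show ?thesis
      using neg_coord_nonpos[OF assms(5) l] neg_coord_nonpos[OF assms(6) l] \<open>0 \<le> P\<close> \<open>0 \<le> Q\<close>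
      by (simp add: add_nonpos_nonpos mult_nonneg_nonpos)
  qed
  then have "(w \<circ> u) (\<alpha> h) \<in> Neg"
    using weyl_root[OF assms(1) uh] pos_coord_positive[of "w (u (\<alpha> h))"] pos_or_neg by force
  from ell_comp_reflection_neg[OF wu h this]
  have "Suc (ell (w \<circ> (u \<circ> s h))) = ell (w \<circ> u)" unfolding o_assoc .
  moreover have "ell (w \<circ> u) + k = ell w"
    unfolding u_def using Suc.prems by (intro Suc.IH) simp
  ultimately have "ell (w \<circ> (u \<circ> s h)) + Suc k = ell w" by linarith
  moreover have "word_product \<alpha> (alternating (Suc k) i j) = u \<circ> s h"
    unfolding alternating_snoc by (simp add: word_product_append u_def h_def)
  ultimately show ?case by (simp only:)
qed simp

section \<open>Descents and the ends of reduced words; left descents are the right descents of the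
  inverse\<close>

definition right_descents :: "('a \<Rightarrow> 'a) \<Rightarrow> nat set" where
  "right_descents w = {i \<in> I. w (\<alpha> i) \<in> Neg}"

abbreviation "braid \<equiv> coxeter_transformation \<alpha> I"

lemma reduced_in_weyl_group: "reduced_decomposition \<alpha> I w us \<Longrightarrow> w \<in> W"
  using word_product_in_weyl_group unfolding reduced_decomposition_iff by blast

lemma reduced_snocD:
  assumes "reduced_decomposition \<alpha> I w (us @ [i])"
  shows "i \<in> right_descents w" and "reduced_decomposition \<alpha> I (w \<circ> s i) us"
proof -
  have us: "us \<in> lists I" "i \<in> I" "word_product \<alpha> us \<circ> s i = w" "Suc (length us) = ell w"
    using assms by (auto simp: reduced_decomposition_iff word_product_append)
  have u: "word_product \<alpha> us = w \<circ> s i"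
    unfolding us(3)[symmetric] by (simp add: o_assoc[symmetric])
  have w: "w \<in> W" by (rule reduced_in_weyl_group[OF assms])
  have "w (\<alpha> i) \<notin> Pos"
    using ell_comp_reflection[OF w us(2)] ell_word_le[OF us(1)] us(4) u by auto
  then have i: "w (\<alpha> i) \<in> Neg" using weyl_not_pos[OF w simple_root[OF us(2)]] by simp
  then show "i \<in> right_descents w" using us by (simp add: right_descents_def)
  show "reduced_decomposition \<alpha> I (w \<circ> s i) us"
    using ell_comp_reflection_neg[OF w us(2) i] us u by (simp add: reduced_decomposition_iff)
qed

text \<open>\<open>u\<close> is the longest element of the subgroup generated by \<open>s i\<close>
  and \<open>s j\<close>, and both alternating words represent it. A shortest word of
  \<open>w \<circ> u\<close>, followed by the reversal of either of them, has exactly the length of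
  \<open>w\<close>.\<close>

lemma reduced_append_alternating:
  assumes "w \<in> W" "i \<in> right_descents w" "j \<in> right_descents w" "i \<noteq> j"
    and m: "m = coxeter_number (laces (\<alpha> i) (\<alpha> j))"
  shows "\<exists>xs. reduced_decomposition \<alpha> I w (xs @ rev (alternating m i j)) \<and>
    reduced_decomposition \<alpha> I w (xs @ rev (alternating m j i))"
proof -
  have ij: "i \<in> I" "j \<in> I" "w (\<alpha> i) \<in> Neg" "w (\<alpha> j) \<in> Neg"
    using assms by (auto simp: right_descents_def)
  define u where "u = word_product \<alpha> (alternating m i j)"
  have u: "u \<in> W" "u = word_product \<alpha> (alternating m j i)"
    using braid_relation[OF ij(1,2) assms(4) m] ij
    by (simp_all add: u_def word_product_in_weyl_group alternating_lists)
  obtain xs where xs: "xs \<in> lists I" "word_product \<alpha> xs = w \<circ> u" "length xs = ell (w \<circ> u)"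
    using minimal_word_length[OF weyl_group_comp[OF assms(1) u(1)]] by blast
  have len: "length xs + m = ell w"
    using ell_reduce_alternating[OF assms(1) ij(1,2) assms(4) ij(3,4), of m] xs m by (simp add: u_def)
  have "reduced_decomposition \<alpha> I w (xs @ rev vs)"
    if vs: "u = word_product \<alpha> vs" "vs \<in> lists I" "length vs = m" for vs
  proof -
    have "word_product \<alpha> (xs @ rev vs) = w"
      using vs(1) xs(2) by (simp add: fun_eq_iff word_product_append)
    then show ?thesis using vs xs len by (auto simp: reduced_decomposition_iff in_lists_conv_set)
  qed
  then show ?thesis
    using u ij by (intro exI[of _ xs] conjI) (simp_all add: u_def alternating_lists)
qed

lemma braid_snoc: "braid us vs \<Longrightarrow> braid (us @ [x]) (vs @ [x])"
proof (induction rule: coxeter_transformation.induct)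
  case (1 i j m us vs)
  then show ?case using coxeter_transformation.intros[of i I j m \<alpha> us "vs @ [x]"] by simp
qed

lemma braids_snoc: "braid\<^sup>*\<^sup>* us vs \<Longrightarrow> braid\<^sup>*\<^sup>* (us @ [x]) (vs @ [x])"
  by (induction rule: rtranclp.induct) (auto intro: rtranclp.rtrancl_into_rtrancl braid_snoc)

lemma last_rev_alternating: "0 < m \<Longrightarrow> \<exists>us. rev (alternating m i j) = us @ [i]"
  by (cases m) auto

text \<open>Matsumoto's theorem.  If two reduced words of \<open>w\<close> end in different letters \<open>i\<close> and \<open>j\<close>, then
  \<open>w\<close> makes the positive roots of the rank two system of \<open>i\<close> and \<open>j\<close> negative, so \<open>w\<close> also has
  reduced words ending in the two alternating words of \<open>i\<close> and \<open>j\<close>.\<close>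

theorem reduced_decompositions_connected:
  assumes "reduced_decomposition \<alpha> I w us" "reduced_decomposition \<alpha> I w vs"
  shows "braid\<^sup>*\<^sup>* us vs"
  using assms
proof (induction "length us" arbitrary: w us vs)
  case 0
  then have "length us = 0" "length vs = length us" unfolding reduced_decomposition_iff by linarith+
  then show ?case by simp
next
  case (Suc n)
  have len: "length vs = Suc n" using Suc by (simp add: reduced_decomposition_iff)
  obtain us' i where us: "us = us' @ [i]" using Suc.hyps(2) by (metis length_0_conv nat.simps(3) rev_exhaust)
  obtain vs' j where vs: "vs = vs' @ [j]" using len by (metis length_0_conv nat.simps(3) rev_exhaust)
  \<comment> \<open>Words with a common last letter: the induction hypothesis applies to what
    remains when it is removed.\<close>
  have step: "braid\<^sup>*\<^sup>* (xs @ [k]) (ys @ [k])"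
    if "reduced_decomposition \<alpha> I w (xs @ [k])" "reduced_decomposition \<alpha> I w (ys @ [k])" for xs ys k
  proof -
    have "length (xs @ [k]) = Suc n" using that(1) Suc.prems(1) Suc.hyps(2) by (simp add: reduced_decomposition_iff)
    then show ?thesis using Suc.hyps(1)[of xs] reduced_snocD(2)[OF that(1)] reduced_snocD(2)[OF that(2)]
      by (simp add: braids_snoc)
  qed
  show ?case
  proof (cases "i = j")
    case True
    then show ?thesis using step Suc.prems us vs by blast
  next
    case False
    have w: "w \<in> W" by (rule reduced_in_weyl_group[OF Suc.prems(1)])
    define m where "m = coxeter_number (laces (\<alpha> i) (\<alpha> j))"
    have ij: "i \<in> right_descents w" "j \<in> right_descents w"
      using reduced_snocD(1) Suc.prems us vs by blast+
    obtain xs where xs: "reduced_decomposition \<alpha> I w (xs @ rev (alternating m i j))"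
      "reduced_decomposition \<alpha> I w (xs @ rev (alternating m j i))"
      using reduced_append_alternating[OF w ij False m_def] by blast
    have "0 < m" by (simp add: m_def coxeter_number_def)
    then obtain ai aj where ai: "rev (alternating m i j) = ai @ [i]" "rev (alternating m j i) = aj @ [j]"
      using last_rev_alternating by metis
    have "braid\<^sup>*\<^sup>* us (xs @ rev (alternating m i j))"
      using step[of us' i "xs @ ai"] Suc.prems xs us ai by simp
    also have "braid (xs @ rev (alternating m i j)) (xs @ rev (alternating m j i))"
    \<comment> \<open>The parity of \<open>m\<close> decides with which of the two letters the
      reversed word begins, and hence in which direction the transformation is read.\<close>
    proof (cases "odd m")
      case True
      then show ?thesis
        using coxeter_transformation.intros[of i I j m \<alpha> xs "[]"] ij False
        by (simp add: rev_alternating m_def right_descents_def)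
    next
      case 2: False
      then show ?thesis
        using coxeter_transformation.intros[of j I i m \<alpha> xs "[]"] ij False coxeter_number_commute
        by (simp add: rev_alternating m_def right_descents_def)
    qed
    also have "braid\<^sup>*\<^sup>* (xs @ rev (alternating m j i)) vs"
      using step[of "xs @ aj" j vs'] Suc.prems xs vs ai by simp
    finally show ?thesis .
  qed
qed

lemma braid_reduced:
  assumes "braid us vs" "reduced_decomposition \<alpha> I w us"
  shows "reduced_decomposition \<alpha> I w vs"
  using assms
proof cases
  case (1 i j m xs ys)
  then have "word_product \<alpha> vs = word_product \<alpha> us"
    using braid_relation[of i j m] by (simp add: word_product_append)
  then show ?thesis using 1 assms(2) by (simp add: reduced_decomposition_iff alternating_lists)
qed

lemma braids_reduced:
  assumes "braid\<^sup>*\<^sup>* us vs" "reduced_decomposition \<alpha> I w us"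
  shows "reduced_decomposition \<alpha> I w vs"
  using assms by (induction rule: rtranclp.induct) (auto intro: braid_reduced)

lemma right_descent_reduced:
  assumes "w \<in> W" "i \<in> right_descents w"
  shows "\<exists>us. reduced_decomposition \<alpha> I w (us @ [i])"
proof -
  have i: "i \<in> I" "w (\<alpha> i) \<in> Neg" using assms by (auto simp: right_descents_def)
  have "w \<circ> s i \<in> W" using assms i by (simp add: weyl_group_comp reflection_in_weyl_group)
  then obtain us where "us \<in> lists I" "word_product \<alpha> us = w \<circ> s i" "length us = ell (w \<circ> s i)"
    using minimal_word_length by blast
  then have "reduced_decomposition \<alpha> I w (us @ [i])"
    using ell_comp_reflection_neg[OF assms(1) i] i
    by (simp add: reduced_decomposition_iff word_product_append o_assoc[symmetric])
  then show ?thesis by blast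
qed

lemma reduced_rev:
  assumes "reduced_decomposition \<alpha> I w us"
  shows "reduced_decomposition \<alpha> I (inv w) (rev us)"
proof -
  have us: "us \<in> lists I" "word_product \<alpha> us = w" "length us = ell w"
    using assms by (auto simp: reduced_decomposition_iff)
  moreover have "w \<in> W" using us word_product_in_weyl_group by blast
  ultimately show ?thesis
    using inv_word_product[of \<alpha> us] ell_inv[of w] by (simp add: reduced_decomposition_iff in_lists_conv_set)
qed

lemma inv_inv_weyl: "w \<in> W \<Longrightarrow> inv (inv w) = w"
  by (simp add: inv_inv_eq weyl_group_bij)

lemma reduced_ConsD:
  assumes "reduced_decomposition \<alpha> I w (j # us)"
  shows "j \<in> right_descents (inv w)"
  using reduced_snocD(1)[of "inv w" "rev us" j] reduced_rev[OF assms] by simp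

lemma left_descent_reduced:
  assumes "w \<in> W" "j \<in> right_descents (inv w)"
  shows "\<exists>us. reduced_decomposition \<alpha> I w (j # us)"
proof -
  obtain us where "reduced_decomposition \<alpha> I (inv w) (us @ [j])"
    using right_descent_reduced[OF weyl_group_inv assms(2)] assms(1) by blast
  from reduced_rev[OF this] show ?thesis using inv_inv_weyl[OF assms(1)] by auto
qed

lemma last_lambda_sequence: "last (lambda_sequence \<alpha> (us @ [i])) = \<alpha> i"
proof (induction us)
  case (Cons k us)
  have "lambda_sequence \<alpha> (us @ [i]) \<noteq> []" by (cases us) auto
  then show ?case using Cons by simp
qed simp

text \<open>The end of the sequence thus depends only on the element and on the leftmost letter,
  whatever the rest of the word is.\<close>

lemma hd_lambda_sequence:
  "word_product \<alpha> (j # us) (hd (lambda_sequence \<alpha> (j # us))) = - \<alpha> j"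
  by (simp del: rev.simps)

section \<open>Minimal non-gatherable triples through descents\<close>

text \<open>\<open>\<alpha>\<close> and \<open>\<beta>\<close> are non-movable if and only if \<open>w\<close> has a unique right and a unique left descent.\<close>

lemma minimal_NGT_triple_iff:
  "minimal_NGT_triple X R \<alpha> I w b g a \<longleftrightarrow>
     w \<in> W \<and> g = a + b \<and> g \<in> R \<and> length_condition X R {b, g, a} \<and>
     (\<exists>i\<in>I. \<exists>j\<in>I. right_descents w = {i} \<and> right_descents (inv w) = {j} \<and> a = \<alpha> i \<and> w b = - \<alpha> j)"
  (is "?l \<longleftrightarrow> ?r")
proof
  assume ?l
  then obtain ws where w: "w \<in> W" and sub: "{b, g, a} \<subseteq> Lambda w" and g: "g = a + b"
    and lc: "length_condition X R {b, g, a}" and ws: "reduced_decomposition \<alpha> I w ws"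
    and ends: "\<And>vs. braid\<^sup>*\<^sup>* ws vs \<Longrightarrow> last (lambda_sequence \<alpha> vs) = a \<and> hd (lambda_sequence \<alpha> vs) = b"
    by (auto simp: minimal_NGT_triple_def)
  have right: "\<alpha> i = a" if i: "i \<in> right_descents w" for i
  proof -
    obtain us where "reduced_decomposition \<alpha> I w (us @ [i])"
      using right_descent_reduced[OF w i] by blast
    from ends[OF reduced_decompositions_connected[OF ws this]] show ?thesis
      by (simp add: last_lambda_sequence)
  qed
  have left: "w b = - \<alpha> j" if j: "j \<in> right_descents (inv w)" for j
  proof -
    obtain us where us: "reduced_decomposition \<alpha> I w (j # us)"
      using left_descent_reduced[OF w j] by blast
    then have "w = word_product \<alpha> (j # us)" by (simp add: reduced_decomposition_iff)
    moreover have "hd (lambda_sequence \<alpha> (j # us)) = b"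
      using ends[OF reduced_decompositions_connected[OF ws us]] by simp
    ultimately show ?thesis using hd_lambda_sequence by metis
  qed
  have "w \<noteq> id" using sub pos_not_neg by (auto simp: lambda_set_def)
  then have "ws \<noteq> []" using ws by (auto simp: reduced_decomposition_iff)
  then obtain us i where i: "i \<in> right_descents w"
    using ws reduced_snocD(1) by (metis rev_exhaust)
  obtain j where j: "j \<in> right_descents (inv w)"
    using ws \<open>ws \<noteq> []\<close> reduced_ConsD by (metis neq_Nil_conv)
  have uniq: "k = l" if "k \<in> right_descents v" "l \<in> right_descents v" "\<alpha> k = \<alpha> l" for k l v
    using that inj_simple by (simp add: right_descents_def inj_onD)
  have "k = i" if "k \<in> right_descents w" for k
    using uniq[OF that i] right[OF that] right[OF i] by simp
  then have "right_descents w = {i}" using i by blast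
  moreover have "k = j" if "k \<in> right_descents (inv w)" for k
    using uniq[OF that j] left[OF that] left[OF j] by simp
  then have "right_descents (inv w) = {j}" using j by blast
  moreover have "i \<in> I" "j \<in> I" using i j by (auto simp: right_descents_def)
  moreover have "a = \<alpha> i" "w b = - \<alpha> j" using right left i j by auto
  moreover have "g \<in> R" using sub by (auto simp: lambda_set_def pos_root)
  ultimately show ?r using w g lc by blast
next
  assume ?r
  then obtain i j where w: "w \<in> W" and g: "g = a + b" "g \<in> R"
    and lc: "length_condition X R {b, g, a}" and ij: "i \<in> I" "j \<in> I"
    and i: "right_descents w = {i}" and j: "right_descents (inv w) = {j}"
    and a: "a = \<alpha> i" and b: "w b = - \<alpha> j"
    by blast
  have aP: "a \<in> Pos" "w a \<in> Neg" using i ij a simple_pos by (auto simp: right_descents_def)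
  have "b = inv w (- \<alpha> j)" using weyl_group_inv_apply(1)[OF w, of b] b by simp
  then have "b = - inv w (\<alpha> j)" by (simp add: weyl_minus weyl_group_inv[OF w])
  then have bP: "b \<in> Pos" "w b \<in> Neg"
    using j ij b simple_pos by (auto simp: right_descents_def neg_iff)
  \<comment> \<open>That \<open>g\<close> lies in the inversion set is automatic: it is a root and
    the sum of two positive roots with negative images.\<close>
  have "g \<in> Pos"
    using g aP(1) bP(1) by (intro pos_if_nonneg) (auto simp: coord_add pos_in_span pos_coord_nonneg)
  moreover have "w g \<in> Neg"
  proof -
    have "coord k (w g) \<le> 0" if "k \<in> I" for k
    proof -
      have "w g = w a + w b" using g weyl_group_linear[OF w] by (simp add: linear_add)
      then show ?thesis
        using neg_coord_nonpos[OF aP(2) that] neg_coord_nonpos[OF bP(2) that]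
        by (simp add: coord_add root_in_span neg_root aP bP)
    qed
    then show ?thesis using weyl_root[OF w g(2)] pos_coord_positive[of "w g"] pos_or_neg by force
  qed
  ultimately have sub: "{b, g, a} \<subseteq> Lambda w" using aP bP by (simp add: lambda_set_def)
  obtain ws where ws: "reduced_decomposition \<alpha> I w ws"
    using right_descent_reduced[OF w] i by blast
  have "last (lambda_sequence \<alpha> vs) = a \<and> hd (lambda_sequence \<alpha> vs) = b"
    if "braid\<^sup>*\<^sup>* ws vs" for vs
  proof -
    have vs: "reduced_decomposition \<alpha> I w vs" by (rule braids_reduced[OF that ws])
    have "w \<noteq> id" using aP pos_not_neg by auto
    then have ne: "vs \<noteq> []" using vs by (auto simp: reduced_decomposition_iff)
    then obtain us k where us: "vs = us @ [k]" by (metis rev_exhaust)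
    then have "k = i" using reduced_snocD(1) vs i by blast
    moreover obtain l us' where us': "vs = l # us'" using ne by (metis neq_Nil_conv)
    then have l: "l = j" using reduced_ConsD vs j by blast
    have "w = word_product \<alpha> (l # us')" using vs us' by (simp add: reduced_decomposition_iff)
    then have "w (hd (lambda_sequence \<alpha> vs)) = w b"
      using hd_lambda_sequence[of l us'] us' l b by metis
    then have "hd (lambda_sequence \<alpha> vs) = b" using weyl_group_inv_apply(1)[OF w] by metis
    ultimately show ?thesis using us a last_lambda_sequence by simp
  qed
  then show ?l using w sub g lc ws unfolding minimal_NGT_triple_def by blast
qed

text \<open>Used twice: for \<open>\<beta>\<close> itself, and for the roots
  \<open>- inv w (\<alpha> m)\<close>, where it shows that the sign of the \<open>i\<close>-th
  coordinate alone reveals the left descents. The enumeration rests on the second use.\<close>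

lemma coord_ge_1_if_unique_descent:
  assumes "w \<in> W" "i \<in> I" "right_descents w \<subseteq> {i}" "b \<in> Pos" "w b \<in> Neg"
  shows "1 \<le> coord i b"
proof (rule ccontr)
  assume "\<not> ?thesis"
  then have z: "coord i b = 0" using pos_coord_nat[OF assms(4,2)] by fastforce
  have "w (\<alpha> k) \<in> Pos" if "k \<in> I" "coord k b \<noteq> 0" for k
  proof -
    have "k \<notin> right_descents w" using that z assms(3) by auto
    then show ?thesis using that weyl_not_pos[OF assms(1) simple_root[OF that(1)]]
      by (auto simp: right_descents_def)
  qed
  then have "w b \<in> Pos" by (rule weyl_pos[OF assms(1,4)])
  then show False using assms(5) pos_not_neg by blast
qed

text \<open>Descent on the height of a positive root: \<open>r \<bullet> r > 0\<close> forces
  \<open>r \<bullet> \<alpha> i > 0\<close> for some \<open>i\<close>, and reflecting in that simple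
  root lowers the height while the root stays positive unless it is simple. The height is real by
  its type, so its floor serves as the measure.\<close>

lemma root_conjugate_simple:
  assumes "r \<in> R"
  shows "\<exists>w\<in>W. \<exists>i\<in>I. r = w (\<alpha> i)"
proof -
  have pos: "\<exists>w\<in>W. \<exists>i\<in>I. r = w (\<alpha> i)" if "r \<in> Pos" for r
    using that
  proof (induction "nat \<lfloor>\<Sum>i\<in>I. coord i r\<rfloor>" arbitrary: r rule: less_induct)
    case less
    show ?case
    proof (cases "\<exists>i\<in>I. r = \<alpha> i")
      case True
      then have "\<exists>i\<in>I. r = id (\<alpha> i)" by simp
      then show ?thesis using id_in_weyl_group by blast
    next
      case False
      have "\<exists>i\<in>I. 0 < r \<bullet> \<alpha> i"
      proof (rule ccontr)
        assume "\<not> ?thesis"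
        then have "(\<Sum>i\<in>I. coord i r * (r \<bullet> \<alpha> i)) \<le> 0"
          using less.prems by (intro sum_nonpos mult_nonneg_nonpos pos_coord_nonneg) auto
        moreover have "r \<bullet> r = r \<bullet> (\<Sum>i\<in>I. coord i r *\<^sub>R \<alpha> i)"
          by (rule arg_cong[OF span_eq_sum_coord[OF pos_in_span[OF less.prems]]])
        ultimately have "r \<bullet> r \<le> 0" by (simp add: inner_sum_right)
        then show False using root_inner_pos[OF pos_root[OF less.prems]] by simp
      qed
      then obtain i where i: "i \<in> I" "0 < r \<bullet> \<alpha> i" by blast
      let ?c = "2 * (r \<bullet> \<alpha> i) / (\<alpha> i \<bullet> \<alpha> i)"
      have c: "0 < ?c" using i root_inner_pos[OF simple_root[OF i(1)]] by simp
      have p: "s i r \<in> Pos" using False less.prems i by (intro reflection_pos) auto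
      have diff: "(\<Sum>k\<in>I. coord k (s i r)) = (\<Sum>k\<in>I. coord k r) - ?c"
        using i finite_I pos_in_span[OF less.prems]
        by (simp add: coord_reflection sum_subtractf)
      have "\<exists>m::nat. (\<Sum>k\<in>I. coord k q) = real m" if q: "q \<in> Pos" for q
      proof -
        obtain f :: "nat \<Rightarrow> nat" where "\<forall>k\<in>I. coord k q = real (f k)"
          using pos_coord_nat[OF q] by metis
        then have "(\<Sum>k\<in>I. coord k q) = real (\<Sum>k\<in>I. f k)" by simp
        then show ?thesis by blast
      qed
      then obtain m m' where m: "(\<Sum>k\<in>I. coord k r) = real m" "(\<Sum>k\<in>I. coord k (s i r)) = real m'"
        using p less.prems by meson
      then have "real m' < real m" using diff c by linarith
      then have "nat \<lfloor>\<Sum>k\<in>I. coord k (s i r)\<rfloor> < nat \<lfloor>\<Sum>k\<in>I. coord k r\<rfloor>"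
        unfolding m by simp
      from less.hyps[OF this p] obtain w j where w: "w \<in> W" "j \<in> I" "s i r = w (\<alpha> j)" by blast
      then have "r = (s i \<circ> w) (\<alpha> j)" by (metis comp_apply reflection_involution)
      then show ?thesis using w i weyl_group_comp[OF reflection_in_weyl_group] by blast
    qed
  qed
  show ?thesis
  proof (cases "r \<in> Pos")
    case False
    then have "- r \<in> Pos" using assms pos_or_neg neg_iff by blast
    from pos[OF this] obtain w i where w: "w \<in> W" "i \<in> I" "- r = w (\<alpha> i)" by blast
    then have "w (s i (\<alpha> i)) = r" by (simp add: weyl_minus flip: w(3))
    then have "r = (w \<circ> s i) (\<alpha> i)" by simp
    then show ?thesis using w weyl_group_comp reflection_in_weyl_group by metis
  qed (rule pos)
qed

lemma reflection_conjugate: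
  assumes "w \<in> W"
  shows "reflection (w x) = w \<circ> reflection x \<circ> inv w"
proof
  fix y
  show "reflection (w x) y = (w \<circ> reflection x \<circ> inv w) y"
    using reflection_image[of w x "inv w y"] assms
    by (simp add: weyl_group_linear weyl_group_inner)
qed

lemma reflection_root_in_weyl_group:
  assumes "r \<in> R"
  shows "reflection r \<in> W"
proof -
  obtain w i where "w \<in> W" "i \<in> I" "r = w (\<alpha> i)" using root_conjugate_simple[OF assms] by blast
  then show ?thesis
    by (simp add: reflection_conjugate weyl_group_comp weyl_group_inv reflection_in_weyl_group)
qed

lemma reflection_product_in_weyl_group: "set rs \<subseteq> R \<Longrightarrow> reflection_product rs \<in> W"
  by (induction rs) (auto intro: id_in_weyl_group weyl_group_comp reflection_root_in_weyl_group
      simp del: comp_apply)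

end

section \<open>The classical types\<close>

declare One_nat_def [simp del]

lemma reflection_scale: "d \<noteq> 0 \<Longrightarrow> reflection (d *\<^sub>R a) = reflection a"
  by (simp add: reflection_def fun_eq_iff)

lemma reflection_product_orthogonal:
  assumes "\<And>r. r \<in> set rs \<Longrightarrow> r \<bullet> x = 0"
  shows "reflection_product rs x = x"
  using assms by (induction rs) (simp_all add: reflection_orthogonal inner_commute)

text \<open>The remaining product fixes \<open>r\<close>, hence commutes with the reflection in
  \<open>r\<close>, and the two involutions can be squared separately.\<close>

lemma orthogonal_reflection_product_involution:
  assumes "sorted_wrt orthogonal rs"
  shows "reflection_product rs \<circ> reflection_product rs = id"
  using assms
proof (induction rs)
  case (Cons r rs)
  have fix_r: "reflection_product rs r = r"
    using Cons.prems by (intro reflection_product_orthogonal) (auto simp: orthogonal_def inner_commute)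
  have inv: "reflection_product rs (reflection_product rs x) = x" for x
    using Cons by (simp add: fun_eq_iff)
  have "reflection r (reflection_product rs (reflection r (reflection_product rs x))) = x" for x
    using reflection_image[OF linear_reflection_product reflection_product_inner, of rs r "reflection_product rs x"]
    by (simp add: fix_r inv)
  then show ?case by (simp add: fun_eq_iff)
qed simp

section \<open>Orthogonal frames and their signed permutations\<close>

locale orthogonal_frame =
  fixes n :: nat and \<epsilon> :: "nat \<Rightarrow> 'a::real_inner"
  assumes frame_axiom: "coordinate_frame n \<epsilon>" and n_pos: "1 \<le> n"
begin

definition c :: real where "c = \<epsilon> 1 \<bullet> \<epsilon> 1"

lemma frame: "i \<in> {1..n} \<Longrightarrow> j \<in> {1..n} \<Longrightarrow> \<epsilon> i \<bullet> \<epsilon> j = (if i = j then c else 0)"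
  and c_pos: "0 < c"
proof -
  obtain d where d: "0 < d" "\<forall>i\<in>{1..n}. \<forall>j\<in>{1..n}. \<epsilon> i \<bullet> \<epsilon> j = (if i = j then d else 0)"
    using frame_axiom by (auto simp: coordinate_frame_def)
  moreover have "1 \<in> {1..n}" using n_pos by simp
  ultimately have "c = d" unfolding c_def by metis
  then show "0 < c" "i \<in> {1..n} \<Longrightarrow> j \<in> {1..n} \<Longrightarrow> \<epsilon> i \<bullet> \<epsilon> j = (if i = j then c else 0)"
    using d by auto
qed

lemma reflection_minus_frame:
  assumes "a \<in> {1..n}" "b \<in> {1..n}" "k \<in> {1..n}" "a \<noteq> b"
  shows "reflection (\<epsilon> a - \<epsilon> b) (\<epsilon> k) = (if k = a then \<epsilon> b else if k = b then \<epsilon> a else \<epsilon> k)"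
  using assms c_pos by (simp add: reflection_def inner_diff_left inner_diff_right frame)

lemma reflection_plus_frame:
  assumes "a \<in> {1..n}" "b \<in> {1..n}" "k \<in> {1..n}" "a \<noteq> b"
  shows "reflection (\<epsilon> a + \<epsilon> b) (\<epsilon> k) = (if k = a then - \<epsilon> b else if k = b then - \<epsilon> a else \<epsilon> k)"
  using assms c_pos by (simp add: reflection_def inner_add_left inner_add_right frame)

lemma reflection_frame:
  assumes "a \<in> {1..n}" "k \<in> {1..n}"
  shows "reflection (\<epsilon> a) (\<epsilon> k) = (if k = a then - \<epsilon> k else \<epsilon> k)"
  using assms c_pos by (simp add: reflection_def frame scaleR_2)

lemma reflection_double_frame:
  assumes "a \<in> {1..n}" "k \<in> {1..n}"
  shows "reflection (2 *\<^sub>R \<epsilon> a) (\<epsilon> k) = (if k = a then - \<epsilon> k else \<epsilon> k)"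
  using reflection_frame[OF assms] by (simp add: reflection_scale)

text \<open>The signed frame vectors; the Weyl groups of the classical types permute them.\<close>

definition E :: "'a set" where "E = \<epsilon> ` {1..n} \<union> uminus ` \<epsilon> ` {1..n}"

lemma frame_in_E: "k \<in> {1..n} \<Longrightarrow> \<epsilon> k \<in> E" by (simp add: E_def)

lemma uminus_E: "x \<in> E \<Longrightarrow> - x \<in> E" by (auto simp: E_def)

text \<open>The linear functional with value \<open>\<theta> k\<close> at
  \<open>\<epsilon> k\<close> that vanishes on the orthogonal complement of the frame.\<close>

definition F :: "(nat \<Rightarrow> real) \<Rightarrow> 'a \<Rightarrow> real" where
  "F \<theta> x = (\<Sum>k\<in>{1..n}. \<theta> k * (x \<bullet> \<epsilon> k)) / c"

lemma F_frame: "k \<in> {1..n} \<Longrightarrow> F \<theta> (\<epsilon> k) = \<theta> k"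
proof -
  assume k: "k \<in> {1..n}"
  have "(\<Sum>l\<in>{1..n}. \<theta> l * (\<epsilon> k \<bullet> \<epsilon> l)) = (\<Sum>l\<in>{1..n}. if k = l then \<theta> l * c else 0)"
    using k by (intro sum.cong) (auto simp: frame)
  also have "\<dots> = \<theta> k * c" using k by simp
  finally show ?thesis using c_pos by (simp add: F_def)
qed

lemma F_add: "F \<theta> (x + y) = F \<theta> x + F \<theta> y"
  by (simp add: F_def inner_add_left distrib_left sum.distrib add_divide_distrib)

lemma F_scale: "F \<theta> (d *\<^sub>R x) = d * F \<theta> x"
  by (simp add: F_def sum_distrib_left mult_ac)

lemma F_minus: "F \<theta> (- x) = - F \<theta> x"
  using F_scale[of \<theta> "-1" x] by simp

lemma F_diff: "F \<theta> (x - y) = F \<theta> x - F \<theta> y"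
  using F_add[of \<theta> x "- y"] by (simp add: F_minus)

lemma F_sum: "finite A \<Longrightarrow> F \<theta> (\<Sum>k\<in>A. f k) = (\<Sum>k\<in>A. F \<theta> (f k))"
  by (induction rule: finite_induct) (simp_all add: F_add, simp add: F_def)

text \<open>The vector \<open>\<epsilon> k\<close> has \<open>ht = n + 1 - k\<close>, so the values of
  \<open>ht\<close> on \<open>E\<close> are the nonzero integers of absolute value at most \<open>n\<close>.\<close>

abbreviation "ht \<equiv> F (\<lambda>k. real n + 1 - real k)"

lemma ht_E:
  assumes "x \<in> E"
  obtains m :: int where "ht x = of_int m" "1 \<le> \<bar>m\<bar>" "\<bar>m\<bar> \<le> int n"
    "x = (if 0 < m then \<epsilon> (nat (int n + 1 - m)) else - \<epsilon> (nat (int n + 1 + m)))"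
proof -
  from assms consider k where "k \<in> {1..n}" "x = \<epsilon> k" | k where "k \<in> {1..n}" "x = - \<epsilon> k"
    by (auto simp: E_def)
  then show thesis
  proof cases
    case (1 k)
    then show ?thesis by (intro that[of "int n + 1 - int k"]) (auto simp: F_frame)
  next
    case (2 k)
    then show ?thesis by (intro that[of "- (int n + 1 - int k)"]) (auto simp: F_frame F_minus)
  qed
qed

lemma E_inner_frame:
  assumes "x \<in> E" "k \<in> {1..n}"
  shows "x = \<epsilon> k \<and> x \<bullet> \<epsilon> k = c \<or> x = - \<epsilon> k \<and> x \<bullet> \<epsilon> k = - c \<or> x \<bullet> \<epsilon> k = 0"
  using assms by (auto simp: E_def frame split: if_splits)

lemma E_norm: "x \<in> E \<Longrightarrow> x \<bullet> x = c"
  by (auto simp: E_def frame)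

lemma ht_frame_eq:
  assumes "ht x = of_int m"
  shows "k \<in> {1..n} \<Longrightarrow> x = \<epsilon> k \<Longrightarrow> m = int n + 1 - int k"
    and "k \<in> {1..n} \<Longrightarrow> x = - \<epsilon> k \<Longrightarrow> m = int k - int n - 1"
proof -
  assume k: "k \<in> {1..n}"
  { assume "x = \<epsilon> k"
    then have "real_of_int m = of_int (int n + 1 - int k)" using assms k by (simp add: F_frame)
    then show "m = int n + 1 - int k" by linarith }
  { assume "x = - \<epsilon> k"
    then have "real_of_int m = of_int (int k - int n - 1)" using assms k by (simp add: F_frame F_minus)
    then show "m = int k - int n - 1" by linarith }
qed

end

section \<open>The types B, C and D treated together\<close>

locale classical_system = simple_system R \<alpha> "{1..n}"
  for R :: "'a::real_inner set" and \<alpha> :: "nat \<Rightarrow> 'a" and n :: nat +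
  fixes X :: dynkin_type and \<epsilon> :: "nat \<Rightarrow> 'a"
  assumes coordinates: "bourbaki_coordinates X n \<epsilon> R \<alpha>"
    and rank: "n \<ge> (if X = Type_D then 4 else 3)"
begin

text \<open>The strict upper bound for the larger index of \<open>\<gamma>\<close>. In type D a Weyl
  group element may map \<open>\<epsilon> n\<close> to a vector of negative height without
  \<open>\<alpha> n\<close> being a descent, so control of the order stops at
  \<open>n - 1\<close>.\<close>

definition "last_index = (if X = Type_D then n - 1 else n)"

sublocale orthogonal_frame n \<epsilon>
  by unfold_locales (use coordinates rank in \<open>auto simp: bourbaki_coordinates_def split: if_splits\<close>)

lemma n_ge_3: "3 \<le> n" and X_cases: "X = Type_B \<or> X = Type_C \<or> X = Type_D"
  using rank coordinates by (auto simp: bourbaki_coordinates_def split: if_splits)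

lemma last_index_le: "last_index \<le> n"
  and last_index_D: "X = Type_D \<Longrightarrow> last_index = n - 1"
  and last_index_not_D: "X \<noteq> Type_D \<Longrightarrow> last_index = n"
  and n_le_last_index: "n \<le> last_index + 1"
  unfolding last_index_def by auto

lemma Pos_eq: "Pos = {\<epsilon> i + \<epsilon> j | i j. 1 \<le> i \<and> i < j \<and> j \<le> n} \<union>
       {\<epsilon> i - \<epsilon> j | i j. 1 \<le> i \<and> i < j \<and> j \<le> n} \<union> bourbaki_extra_roots X n \<epsilon>"
  and simple_eq: "1 \<le> i \<Longrightarrow> i < n \<Longrightarrow> \<alpha> i = \<epsilon> i - \<epsilon> (i + 1)"
  and simple_last: "\<alpha> n = bourbaki_last_simple X n \<epsilon>"
  using coordinates by (auto simp: bourbaki_coordinates_def)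

lemma pos_plus: "1 \<le> p \<Longrightarrow> p < q \<Longrightarrow> q \<le> n \<Longrightarrow> \<epsilon> p + \<epsilon> q \<in> Pos"
  and pos_minus: "1 \<le> p \<Longrightarrow> p < q \<Longrightarrow> q \<le> n \<Longrightarrow> \<epsilon> p - \<epsilon> q \<in> Pos"
  unfolding Pos_eq by blast+

lemma pos_extra: "r \<in> bourbaki_extra_roots X n \<epsilon> \<Longrightarrow> r \<in> Pos"
  unfolding Pos_eq by blast

lemma pos_cases:
  assumes "r \<in> Pos"
  obtains (plus) p q where "r = \<epsilon> p + \<epsilon> q" "1 \<le> p" "p < q" "q \<le> n"
  | (minus) p q where "r = \<epsilon> p - \<epsilon> q" "1 \<le> p" "p < q" "q \<le> n"
  | (B) p where "X = Type_B" "r = \<epsilon> p" "p \<in> {1..n}"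
  | (C) p where "X = Type_C" "r = 2 *\<^sub>R \<epsilon> p" "p \<in> {1..n}"
  using assms X_cases unfolding Pos_eq by fastforce

lemma simple_reflection_E:
  assumes "i \<in> {1..n}" "x \<in> E"
  shows "s i x \<in> E"
proof -
  have *: "s i (\<epsilon> k) \<in> E" if "k \<in> {1..n}" for k
  proof (cases "i < n")
    case True
    then show ?thesis
      using assms that by (simp add: simple_eq reflection_minus_frame frame_in_E)
  next
    case False
    then have "i = n" using assms by simp
    then show ?thesis
      using X_cases that n_ge_3
      by (auto simp: simple_last reflection_frame reflection_double_frame reflection_plus_frame
          frame_in_E uminus_E)
  qed
  from assms(2) consider k where "k \<in> {1..n}" "x = \<epsilon> k" | k where "k \<in> {1..n}" "x = - \<epsilon> k"
    unfolding E_def by blast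
  then show ?thesis by cases (simp_all only: reflection_minus * uminus_E)
qed

lemma weyl_E:
  assumes "w \<in> W" "x \<in> E"
  shows "w x \<in> E"
proof -
  obtain ws where ws: "ws \<in> lists {1..n}" "w = word_product \<alpha> ws" using assms by (auto elim: weyl_groupE)
  from ws(1) have "word_product \<alpha> ws x \<in> E"
    by (induction ws rule: list.induct) (simp_all add: assms(2) simple_reflection_E)
  then show ?thesis using ws by simp
qed

text \<open>A functional that kills all simple roots except \<open>\<alpha> i\<close> is, on the
  span of the roots, a multiple of the \<open>i\<close>-th fundamental coweight.\<close>

lemma F_coord:
  assumes "x \<in> span (\<alpha> ` {1..n})" "i \<in> {1..n}" "\<And>k. k \<in> {1..n} \<Longrightarrow> k \<noteq> i \<Longrightarrow> F \<theta> (\<alpha> k) = 0"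
  shows "F \<theta> x = coord i x * F \<theta> (\<alpha> i)"
proof -
  have "F \<theta> x = F \<theta> (\<Sum>k\<in>{1..n}. coord k x *\<^sub>R \<alpha> k)"
    by (rule arg_cong[OF span_eq_sum_coord[OF assms(1)]])
  also have "\<dots> = (\<Sum>k\<in>{1..n}. coord k x * F \<theta> (\<alpha> k))" by (simp add: F_sum F_scale)
  also have "\<dots> = (\<Sum>k\<in>{1..n}. if k = i then coord i x * F \<theta> (\<alpha> i) else 0)"
    using assms(3) by (intro sum.cong) auto
  finally show ?thesis using assms(2) by simp
qed

lemma ht_pos: "r \<in> Pos \<Longrightarrow> 0 < ht r"
  by (erule pos_cases) (auto simp: F_add F_diff F_frame F_scale)

lemma pos_norm_medium:
  assumes "r \<in> Pos" "r \<bullet> r = 2 * c"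
  obtains (plus) p q where "r = \<epsilon> p + \<epsilon> q" "1 \<le> p" "p < q" "q \<le> n"
  | (minus) p q where "r = \<epsilon> p - \<epsilon> q" "1 \<le> p" "p < q" "q \<le> n"
  using assms(1)
proof (cases rule: pos_cases)
  case (B p)
  then show ?thesis using assms(2) c_pos by (simp add: frame)
next
  case (C p)
  then show ?thesis using assms(2) c_pos by (simp add: frame)
qed (use that in auto)

lemma root_norm:
  assumes "r \<in> R"
  shows "r \<bullet> r = 2 * c \<or> X = Type_B \<and> r \<bullet> r = c \<or> X = Type_C \<and> r \<bullet> r = 4 * c"
proof -
  have *: "r \<bullet> r = 2 * c \<or> X = Type_B \<and> r \<bullet> r = c \<or> X = Type_C \<and> r \<bullet> r = 4 * c" if "r \<in> Pos" for r
    using that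
  proof (cases rule: pos_cases)
    case (plus p q)
    then show ?thesis by (simp add: inner_add_left inner_add_right frame)
  next
    case (minus p q)
    then show ?thesis by (simp add: inner_diff_left inner_diff_right frame)
  qed (simp_all add: frame)
  then show ?thesis using assms pos_or_neg neg_iff *[of "- r"] by fastforce
qed

text \<open>The roots formed from two different frame vectors are the long ones in type B, the short
  ones in type C and all of them in type D, so that one squared length serves the three types;
  \<open>\<epsilon> 1 + \<epsilon> 2\<close> witnesses that it occurs.\<close>

lemma length_condition_iff:
  assumes "r \<in> R" "q \<in> R" "t \<in> R"
  shows "length_condition X R {r, q, t} \<longleftrightarrow> r \<bullet> r = 2 * c \<and> q \<bullet> q = 2 * c \<and> t \<bullet> t = 2 * c"
proof -
  have "1 \<le> n" "2 \<le> n" using n_ge_3 by auto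
  then have m: "\<epsilon> 1 + \<epsilon> 2 \<in> R" "(\<epsilon> 1 + \<epsilon> 2) \<bullet> (\<epsilon> 1 + \<epsilon> 2) = 2 * c"
    by (auto intro: pos_root[OF pos_plus] simp: inner_add_left inner_add_right frame)
  have long: "long_root R r \<longleftrightarrow> r \<bullet> r = 2 * c" if "r \<in> R" "X = Type_B" for r
    using that c_pos m root_norm unfolding long_root_def norm_le by (fastforce simp: not_le)
  have short: "short_root R r \<longleftrightarrow> r \<bullet> r = 2 * c" if "r \<in> R" "X = Type_C" for r
    using that c_pos m root_norm unfolding short_root_def norm_le by (fastforce simp: not_le)
  from X_cases show ?thesis
  proof (elim disjE)
    assume "X = Type_D"
    then show ?thesis using root_norm assms by auto
  qed (use long short assms in auto)
qed

text \<open>The squared length of the roots \<open>\<epsilon> p + \<epsilon> q\<close> is \<open>2 * c\<close>.\<close>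

definition medium_NGT :: "('a \<Rightarrow> 'a) \<Rightarrow> nat \<Rightarrow> nat \<Rightarrow> 'a \<Rightarrow> bool" where
  "medium_NGT w i j b \<longleftrightarrow> w \<in> W \<and> i \<in> {1..n} \<and> j \<in> {1..n} \<and>
     right_descents w = {i} \<and> right_descents (inv w) = {j} \<and> w b = - \<alpha> j \<and>
     \<alpha> i + b \<in> R \<and> b \<bullet> b = 2 * c \<and> (\<alpha> i + b) \<bullet> (\<alpha> i + b) = 2 * c \<and> \<alpha> i \<bullet> \<alpha> i = 2 * c"

lemma minimal_NGT_triple_iff_medium:
  "minimal_NGT_triple X R \<alpha> {1..n} w b g a \<longleftrightarrow>
     (\<exists>i j. medium_NGT w i j b \<and> a = \<alpha> i \<and> g = \<alpha> i + b)"
proof -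
  have b: "b \<in> R" if "w \<in> W" "w b = - \<alpha> j" "j \<in> {1..n}" for j
  proof -
    have "inv w (- \<alpha> j) \<in> R"
      by (rule weyl_root[OF weyl_group_inv[OF that(1)] uminus_root[OF simple_root[OF that(3)]]])
    then show ?thesis using that weyl_group_inv_apply(1)[OF that(1), of b] by simp
  qed
  show ?thesis
    unfolding minimal_NGT_triple_iff medium_NGT_def
    using length_condition_iff b simple_root by fastforce
qed

text \<open>Inversion exchanges the two ends: \<open>- w\<close> maps the triple of \<open>w\<close>
  to the triple of \<open>inv w\<close>. Whatever is shown for \<open>i\<close> therefore holds for
  \<open>j\<close> as well.\<close>

lemma medium_NGT_inverse:
  assumes "medium_NGT w i j b"
  shows "medium_NGT (inv w) j i (- w (\<alpha> i))"
proof -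
  note m = assms[unfolded medium_NGT_def]
  have w: "w \<in> W" using m by simp
  note lin = linear_add[OF weyl_group_linear[OF w]]
  have g: "\<alpha> j + - w (\<alpha> i) = - w (\<alpha> i + b)" using m by (simp add: lin)
  have "w (\<alpha> i + b) \<in> R" by (rule weyl_root[OF w]) (use m in simp)
  then have "- w (\<alpha> i + b) \<in> R" by (rule uminus_root)
  moreover have "\<alpha> j \<bullet> \<alpha> j = b \<bullet> b" using m weyl_group_inner[OF w, of b b] by simp
  ultimately show ?thesis
    unfolding medium_NGT_def g
    using m weyl_group_inner[OF w] inv_inv_weyl[OF w] weyl_group_inv[OF w]
    by (simp add: weyl_minus weyl_group_inv_apply[OF w])
qed

text \<open>\<open>\<alpha> i\<close> occurs in \<open>\<beta>\<close>, hence at least twice in \<open>\<gamma>\<close>.\<close>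

lemma medium_NGT_root:
  assumes "medium_NGT w i j b"
  obtains x where "1 \<le> x" "x < i" "i < last_index" "b = \<epsilon> x + \<epsilon> (i + 1)"
proof -
  note m = assms[unfolded medium_NGT_def]
  have w: "w \<in> W" and i: "i \<in> {1..n}" and j: "j \<in> {1..n}" using m by auto
  have bP: "b \<in> Pos" "w b \<in> Neg"
  proof -
    have "b = - inv w (\<alpha> j)"
      using m weyl_group_inv_apply(1)[OF w, of b] by (simp add: weyl_minus[OF weyl_group_inv[OF w]])
    moreover have "inv w (\<alpha> j) \<in> Neg" using m by (auto simp: right_descents_def)
    ultimately show "b \<in> Pos" by (simp add: neg_iff)
    show "w b \<in> Neg" using m simple_pos[of j] by (simp add: neg_iff)
  qed
  define g where "g = \<alpha> i + b"
  have gR: "g \<in> R" "g \<bullet> g = 2 * c" using m by (auto simp: g_def)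
  have "1 \<le> coord i b"
    using m bP by (intro coord_ge_1_if_unique_descent[of w]) auto
  then have gi: "2 \<le> coord i g"
    using i bP by (simp add: g_def coord_add simple_in_span pos_in_span coord_simple)
  then have gP: "g \<in> Pos" using gR i by (intro pos_if_coord) auto
  have F: "F \<theta> g \<ge> 2 * d" if "\<And>k. k \<in> {1..n} \<Longrightarrow> k \<noteq> i \<Longrightarrow> F \<theta> (\<alpha> k) = 0" "F \<theta> (\<alpha> i) = d" "0 \<le> d" for \<theta> d
    using F_coord[OF pos_in_span[OF gP] i that(1)] that gi by (simp add: mult_right_mono)
  have simple_F: "F \<theta> (\<alpha> k) = \<theta> k - \<theta> (k + 1)" if "k \<in> {1..n}" "k < n" for \<theta> k
    using that by (simp add: simple_eq F_diff F_frame)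
  have last_F: "F \<theta> (\<alpha> n) = (if X = Type_B then \<theta> n else if X = Type_C then 2 * \<theta> n else \<theta> (n - 1) + \<theta> n)" for \<theta>
    using X_cases n_ge_3 by (auto simp: simple_last F_frame F_scale F_add)
  \<comment> \<open>Twice the coweights of the two end nodes of the fork in type D take the values 1
    and -1 on the frame. They are at most 2 on \<open>g\<close>, whereas an \<open>i\<close>-th
    coordinate of at least 2 would give at least 4.\<close>
  have bound: "F \<theta> g \<le> 2" if "\<And>k. k \<in> {1..n} \<Longrightarrow> \<theta> k \<in> {-1, 1}" for \<theta>
  proof -
    have le: "\<theta> k \<le> 1" "- 1 \<le> \<theta> k" if "k \<in> {1..n}" for k
      using \<open>\<And>k. k \<in> {1..n} \<Longrightarrow> \<theta> k \<in> {-1, 1}\<close>[OF that] by auto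
    from gP gR(2) show ?thesis
    proof (cases rule: pos_norm_medium)
      case (plus p q)
      then show ?thesis using le(1)[of p] le(1)[of q] by (simp add: F_add F_frame)
    next
      case (minus p q)
      then show ?thesis using le(1)[of p] le(2)[of q] by (simp add: F_diff F_frame)
    qed
  qed
  have i_less: "i < last_index"
  proof (rule ccontr)
    assume ge: "\<not> i < last_index"
    show False
    proof (cases "X = Type_D")
      case False
      then have "i = n" using ge i by (simp add: last_index_def)
      then have "\<alpha> i \<bullet> \<alpha> i \<noteq> 2 * c"
        using False X_cases c_pos n_ge_3 by (auto simp: simple_last frame)
      then show False using m by simp
    next
      case True
      then have "n - 1 \<le> i" using ge last_index_D by linarith
      then consider "i = n" | "i = n - 1" using i by fastforce
      then show False
      proof cases
        case 1
        have "F (\<lambda>k. 1) (\<alpha> k) = 0" if "k \<in> {1..n}" "k \<noteq> i" for k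
          using that 1 simple_F[of k] by simp
        from F[OF this, of 2] show False
          using True 1 last_F[of "\<lambda>k. 1"] bound[of "\<lambda>k. 1"] by simp
      next
        case 2
        let ?\<theta> = "\<lambda>k. if k = n then -1 else 1"
        have n: "n - 1 \<in> {1..n}" "n - 1 < n" "n - 1 + 1 = n" using n_ge_3 by auto
        have "F ?\<theta> (\<alpha> k) = 0" if k: "k \<in> {1..n}" "k \<noteq> i" for k
        proof (cases "k = n")
          case False
          then have "k + 1 \<noteq> n" using k 2 by auto
          then show ?thesis using False k simple_F[of k ?\<theta>] by simp
        qed (use last_F[of ?\<theta>] True n in simp)
        moreover have "F ?\<theta> (\<alpha> i) = 2" using simple_F[OF n(1,2), of ?\<theta>] n 2 by simp
        ultimately have "4 \<le> F ?\<theta> g" using F[of ?\<theta> 2] by simp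
        moreover have "F ?\<theta> g \<le> 2" by (rule bound) simp
        ultimately show False by simp
      qed
    qed
  qed
  then have i_n: "i < n" using last_index_le by simp
  \<comment> \<open>The \<open>i\<close>-th coweight for \<open>i < last_index\<close>: a value of
    at least 2 forces \<open>g\<close> to be the sum of two frame vectors with indices up to
    \<open>i\<close>.\<close>
  let ?\<theta> = "\<lambda>k. if k \<le> i then 1 else (0::real)"
  have "F ?\<theta> (\<alpha> k) = 0" if k: "k \<in> {1..n}" "k \<noteq> i" for k
  proof (cases "k = n")
    case True
    have "\<not> n - 1 \<le> i" if "X = Type_D" using i_less last_index_D[OF that] by linarith
    then show ?thesis using last_F[of ?\<theta>] X_cases i_n True by auto
  qed (use simple_F[of k ?\<theta>] k in auto)
  moreover have "F ?\<theta> (\<alpha> i) = 1" using simple_F[OF i i_n, of ?\<theta>] by simp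
  ultimately have g2: "2 \<le> F ?\<theta> g" using F[of ?\<theta> 1] by simp
  from gP gR(2) show thesis
  proof (cases rule: pos_norm_medium)
    case (minus p q)
    then show ?thesis using g2 by (simp add: F_diff F_frame split: if_splits)
  next
    case (plus p q)
    then have pq: "p \<le> i" "q \<le> i" using g2 by (simp_all add: F_add F_frame split: if_splits)
    have b: "b = \<epsilon> p + \<epsilon> q - (\<epsilon> i - \<epsilon> (i + 1))"
      using plus i i_n by (simp add: g_def simple_eq algebra_simps)
    \<comment> \<open>Otherwise \<open>b\<close> would involve the four different frame vectors with
      indices \<open>p\<close>, \<open>q\<close>, \<open>i\<close> and \<open>i + 1\<close> and be
      too long.\<close>
    have "q = i"
    proof (rule ccontr)
      assume "q \<noteq> i"
      then have "b \<bullet> b = 4 * c"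
        unfolding b using plus pq i_n by (simp add: inner_simps frame)
      then show False using m c_pos by simp
    qed
    then have "b = \<epsilon> p + \<epsilon> (i + 1)" unfolding b by simp
    then show ?thesis using that plus \<open>q = i\<close> i_less by auto
  qed
qed

text \<open>\<open>A\<close>, \<open>B\<close> and \<open>C\<close> are signed frame vectors of
  which \<open>A + B\<close> and \<open>B - C\<close> are known. The first equation determines
  \<open>A\<close> and \<open>B\<close> up to exchange, and the wrong choice would give
  \<open>C\<close> the squared length \<open>3 * c\<close>.\<close>

lemma medium_NGT_frame:
  assumes "medium_NGT w i j b" "b = \<epsilon> x + \<epsilon> (i + 1)" "1 \<le> x" "x < i" "i < last_index"
    and "- w (\<alpha> i) = \<epsilon> y + \<epsilon> (j + 1)" "1 \<le> y" "y < j" "j < last_index"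
  shows "w (\<epsilon> x) = - \<epsilon> j" "w (\<epsilon> (i + 1)) = \<epsilon> (j + 1)" "w (\<epsilon> i) = - \<epsilon> y"
proof -
  note m = assms(1)[unfolded medium_NGT_def]
  have w: "w \<in> W" using m by simp
  have ran: "x \<in> {1..n}" "i \<in> {1..n}" "i + 1 \<in> {1..n}" "y \<in> {1..n}" "j \<in> {1..n}" "j + 1 \<in> {1..n}"
    "i < n" "j < n"
    using assms last_index_le by auto
  define A B C where "A = w (\<epsilon> x)" and "B = w (\<epsilon> (i + 1))" and "C = w (\<epsilon> i)"
  have E: "A \<in> E" "B \<in> E" "C \<in> E"
    unfolding A_def B_def C_def using ran by (auto intro!: weyl_E[OF w] frame_in_E)
  have AB: "A + B = \<epsilon> (j + 1) - \<epsilon> j"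
  proof -
    have "A + B = w b" unfolding A_def B_def assms(2) using weyl_group_linear[OF w] by (simp add: linear_add)
    then show ?thesis using m ran by (simp add: simple_eq)
  qed
  have BC: "B - C = \<epsilon> y + \<epsilon> (j + 1)"
  proof -
    have "B - C = - w (\<alpha> i)"
      unfolding B_def C_def using ran weyl_group_linear[OF w] by (simp add: simple_eq linear_diff)
    then show ?thesis using assms(6) by simp
  qed
  have "A \<bullet> \<epsilon> (j + 1) + B \<bullet> \<epsilon> (j + 1) = c"
    using arg_cong[OF AB, of "\<lambda>v. v \<bullet> \<epsilon> (j + 1)"] ran by (simp add: inner_simps frame)
  then have "A = \<epsilon> (j + 1) \<or> B = \<epsilon> (j + 1)"
    using E_inner_frame[OF E(1) ran(6)] E_inner_frame[OF E(2) ran(6)] c_pos by force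
  moreover have "A \<noteq> \<epsilon> (j + 1)"
  proof
    assume "A = \<epsilon> (j + 1)"
    then have "B = - \<epsilon> j" using AB by simp
    then have C: "C = - \<epsilon> j - \<epsilon> y - \<epsilon> (j + 1)"
      using arg_cong[OF BC, of "\<lambda>v. B - v"] by (simp add: algebra_simps)
    have "C \<bullet> C = 3 * c" unfolding C using ran assms(8) by (simp add: inner_simps frame)
    then show False using E_norm[OF E(3)] c_pos by simp
  qed
  ultimately have B: "B = \<epsilon> (j + 1)" by simp
  then have "A = - \<epsilon> j" using AB by (metis add_diff_cancel_right' diff_add_cancel diff_minus_eq_add minus_diff_eq uminus_add_conv_diff)
  moreover have "C = - \<epsilon> y" using BC B by (simp add: algebra_simps eq_neg_iff_add_eq_0)
  ultimately show "w (\<epsilon> x) = - \<epsilon> j" "w (\<epsilon> (i + 1)) = \<epsilon> (j + 1)" "w (\<epsilon> i) = - \<epsilon> y"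
    using B by (simp_all add: A_def B_def C_def)
qed

text \<open>The values \<open>g k\<close> of \<open>ht\<close> at \<open>w (\<epsilon> k)\<close> decrease on \<open>{1..i}\<close> and on \<open>{i + 1..n}\<close>, and their
  absolute values form a permutation of \<open>{1..n}\<close>.\<close>

lemma unique_descent_heights:
  assumes "w \<in> W" "right_descents w = {i}" "i < last_index"
  obtains g :: "nat \<Rightarrow> int" where
    "\<And>k. k \<in> {1..n} \<Longrightarrow> ht (w (\<epsilon> k)) = of_int (g k)"
    "\<And>k. k \<in> {1..n} \<Longrightarrow> 1 \<le> \<bar>g k\<bar> \<and> \<bar>g k\<bar> \<le> int n"
    "\<And>k. k \<in> {1..n} \<Longrightarrow> w (\<epsilon> k) = (if 0 < g k then \<epsilon> (nat (int n + 1 - g k)) else - \<epsilon> (nat (int n + 1 + g k)))"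
    "\<And>k l. k \<in> {1..n} \<Longrightarrow> l \<in> {1..n} \<Longrightarrow> k \<noteq> l \<Longrightarrow> \<bar>g k\<bar> \<noteq> \<bar>g l\<bar>"
    "\<And>k. 1 \<le> k \<Longrightarrow> k < n \<Longrightarrow> k \<noteq> i \<Longrightarrow> g (k + 1) < g k"
    "X \<noteq> Type_D \<Longrightarrow> 0 < g n" "X = Type_D \<Longrightarrow> \<bar>g n\<bar> < g (n - 1)"
proof -
  note w = assms(1)
  note lin = weyl_group_linear[OF w]
  have "\<exists>m::int. ht (w (\<epsilon> k)) = of_int m \<and> 1 \<le> \<bar>m\<bar> \<and> \<bar>m\<bar> \<le> int n \<and>
     w (\<epsilon> k) = (if 0 < m then \<epsilon> (nat (int n + 1 - m)) else - \<epsilon> (nat (int n + 1 + m)))"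
    if "k \<in> {1..n}" for k
    using ht_E[OF weyl_E[OF w frame_in_E[OF that]]] by metis
  then obtain g where g: "\<And>k. k \<in> {1..n} \<Longrightarrow> ht (w (\<epsilon> k)) = of_int (g k) \<and> 1 \<le> \<bar>g k\<bar> \<and> \<bar>g k\<bar> \<le> int n \<and>
     w (\<epsilon> k) = (if 0 < g k then \<epsilon> (nat (int n + 1 - g k)) else - \<epsilon> (nat (int n + 1 + g k)))"
    by metis
  have gh: "ht (w (\<epsilon> k)) = of_int (g k)" if "k \<in> {1..n}" for k using g[OF that] by blast
  have i_n: "i < n" using assms(3) last_index_le by simp
  have n: "n \<in> {1..n}" "n - 1 \<in> {1..n}" "1 \<le> n - 1" "n - 1 < n" "n - 1 + 1 = n" using n_ge_3 by auto
  have pos: "w (\<alpha> k) \<in> Pos" if "k \<in> {1..n}" "k \<noteq> i" for k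
  proof -
    have "k \<notin> right_descents w" using that assms(2) by simp
    then show ?thesis using that weyl_not_pos[OF w simple_root[OF that(1)]] by (auto simp: right_descents_def)
  qed
  have inj: "\<bar>g k\<bar> \<noteq> \<bar>g l\<bar>" if kl: "k \<in> {1..n}" "l \<in> {1..n}" "k \<noteq> l" for k l
  proof
    assume eq: "\<bar>g k\<bar> = \<bar>g l\<bar>"
    then consider "g k = g l" | "g k = - g l" by linarith
    then have "w (\<epsilon> k) = w (\<epsilon> l) \<or> w (\<epsilon> k) = - w (\<epsilon> l)"
      using g[OF kl(1)] g[OF kl(2)] by cases auto
    then have "\<bar>w (\<epsilon> k) \<bullet> w (\<epsilon> l)\<bar> = c"
      using E_norm[OF weyl_E[OF w frame_in_E[OF kl(2)]]] c_pos by auto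
    then show False using weyl_group_inner[OF w] kl c_pos by (simp add: frame)
  qed
  have dec: "g (k + 1) < g k" if k: "1 \<le> k" "k < n" "k \<noteq> i" for k
  proof -
    have "0 < ht (w (\<alpha> k))" using k by (intro ht_pos pos) auto
    then have "real_of_int (g (k + 1)) < of_int (g k)"
      using k gh[of k] gh[of "k + 1"] by (simp add: simple_eq linear_diff[OF lin] F_diff)
    then show ?thesis by simp
  qed
  have "0 < ht (w (\<alpha> n))" using n i_n by (intro ht_pos pos) auto
  then have last: "0 < g n" if "X \<noteq> Type_D"
    using that X_cases gh[OF n(1)] by (auto simp: simple_last linear_cmul[OF lin] F_scale)
  have last': "\<bar>g n\<bar> < g (n - 1)" if D: "X = Type_D"
  proof -
    have "real_of_int 0 < of_int (g (n - 1) + g n)"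
      using \<open>0 < ht (w (\<alpha> n))\<close> D gh[OF n(1)] gh[OF n(2)] by (simp add: simple_last linear_add[OF lin] F_add)
    then have "0 < g (n - 1) + g n" by linarith
    moreover have "n - 1 \<noteq> i" using assms(3) last_index_D[OF D] by linarith
    then have "g n < g (n - 1)" using dec[OF n(3,4)] n(5) by simp
    ultimately show ?thesis by simp
  qed
  have ran: "1 \<le> \<bar>g k\<bar> \<and> \<bar>g k\<bar> \<le> int n" if "k \<in> {1..n}" for k using g[OF that] by blast
  have val: "w (\<epsilon> k) = (if 0 < g k then \<epsilon> (nat (int n + 1 - g k)) else - \<epsilon> (nat (int n + 1 + g k)))"
    if "k \<in> {1..n}" for k using g[OF that] by blast
  show thesis by (rule that[OF gh ran val inj dec last last'])
qed

lemma decreasing_chain: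
  fixes g :: "nat \<Rightarrow> int"
  assumes "a \<le> b" "\<And>k. a \<le> k \<Longrightarrow> k < b \<Longrightarrow> g (k + 1) < g k"
  shows "g b + int (b - a) \<le> g a"
  using assms
proof (induction b rule: dec_induct)
  case (step b)
  have "g b + int (b - a) \<le> g a" using step by simp
  moreover have "g (b + 1) < g b" using step by simp
  ultimately show ?case using step.hyps by (simp add: Suc_diff_le flip: Suc_eq_plus1)
qed simp

text \<open>The heights are integers and drop by at least one per step. From \<open>n - j\<close> at
  \<open>i + 1\<close> down to the last positive values there must be room for all indices in
  between, which gives \<open>j \<le> i\<close>; the chain from \<open>x\<close> to \<open>i\<close>
  gives the other bound. Applied to \<open>w\<close> and to its inverse, the inequalities become
  equalities.\<close>

lemma unique_descent_indices:
  assumes "w \<in> W" "right_descents w = {i}" "1 \<le> x" "x < i" "i < last_index" "1 \<le> y" "y < j" "j < last_index"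
    and "w (\<epsilon> x) = - \<epsilon> j" "w (\<epsilon> (i + 1)) = \<epsilon> (j + 1)" "w (\<epsilon> i) = - \<epsilon> y"
  shows "j \<le> i" "y + i \<le> x + j"
proof -
  obtain g :: "nat \<Rightarrow> int" where
    ht: "\<And>k. k \<in> {1..n} \<Longrightarrow> ht (w (\<epsilon> k)) = of_int (g k)"
    and ran: "\<And>k. k \<in> {1..n} \<Longrightarrow> 1 \<le> \<bar>g k\<bar> \<and> \<bar>g k\<bar> \<le> int n"
    and dec: "\<And>k. 1 \<le> k \<Longrightarrow> k < n \<Longrightarrow> k \<noteq> i \<Longrightarrow> g (k + 1) < g k"
    and last: "X \<noteq> Type_D \<Longrightarrow> 0 < g n" "X = Type_D \<Longrightarrow> \<bar>g n\<bar> < g (n - 1)"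
    by (rule unique_descent_heights[OF assms(1,2,5)]) blast
  have n: "i < n" "j < n" using assms(5,8) last_index_le by auto
  have gx: "g x = int j - int n - 1" using assms n by (intro ht_frame_eq(2)[OF ht]) auto
  have gi: "g i = int y - int n - 1" using assms n by (intro ht_frame_eq(2)[OF ht]) auto
  have gi1: "g (i + 1) = int n - int j" using assms n ht_frame_eq(1)[OF ht, of "i + 1" "j + 1"] by simp
  have "g i + int (i - x) \<le> g x" using assms n by (intro decreasing_chain dec) auto
  then show "y + i \<le> x + j" using gx gi assms(4) by linarith
  have "g last_index + int (last_index - (i + 1)) \<le> g (i + 1)"
    using assms n last_index_le by (intro decreasing_chain dec) auto
  \<comment> \<open>In types B and C this is \<open>0 < g n\<close>; in type D it says that
    \<open>g (n - 1)\<close> exceeds \<open>\<bar>g n\<bar> \<ge> 1\<close>.\<close>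
  moreover have "1 + int (n - last_index) \<le> g last_index"
    using last ran[of n] n_ge_3 last_index_D last_index_not_D by (cases "X = Type_D") (simp_all only:, auto)
  ultimately show "j \<le> i" using gi1 n assms(5) last_index_le by linarith
qed

text \<open>With \<open>i = j\<close> and \<open>x = y\<close> the chains on \<open>{x..i}\<close>
  and \<open>{i + 1..last_index}\<close> have no slack, so their values are consecutive. The indices
  below \<open>x\<close> receive the remaining absolute values, in decreasing order and with
  positive sign. Only the sign at \<open>\<epsilon> n\<close> in type D stays open.\<close>

lemma unique_descent_frame:
  assumes "w \<in> W" "right_descents w = {i}" "1 \<le> x" "x < i" "i < last_index"
    and "w (\<epsilon> x) = - \<epsilon> i" "w (\<epsilon> (i + 1)) = \<epsilon> (i + 1)" "w (\<epsilon> i) = - \<epsilon> x"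
  shows "\<And>k. 1 \<le> k \<Longrightarrow> k \<le> last_index \<Longrightarrow> w (\<epsilon> k) = (if x \<le> k \<and> k \<le> i then - \<epsilon> (x + i - k) else \<epsilon> k)"
    and "w (\<epsilon> n) = \<epsilon> n \<or> X = Type_D \<and> w (\<epsilon> n) = - \<epsilon> n"
proof -
  obtain g :: "nat \<Rightarrow> int" where
    ht: "\<And>k. k \<in> {1..n} \<Longrightarrow> ht (w (\<epsilon> k)) = of_int (g k)"
    and ran: "\<And>k. k \<in> {1..n} \<Longrightarrow> 1 \<le> \<bar>g k\<bar> \<and> \<bar>g k\<bar> \<le> int n"
    and val: "\<And>k. k \<in> {1..n} \<Longrightarrow> w (\<epsilon> k) = (if 0 < g k then \<epsilon> (nat (int n + 1 - g k)) else - \<epsilon> (nat (int n + 1 + g k)))"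
    and inj: "\<And>k l. k \<in> {1..n} \<Longrightarrow> l \<in> {1..n} \<Longrightarrow> k \<noteq> l \<Longrightarrow> \<bar>g k\<bar> \<noteq> \<bar>g l\<bar>"
    and dec: "\<And>k. 1 \<le> k \<Longrightarrow> k < n \<Longrightarrow> k \<noteq> i \<Longrightarrow> g (k + 1) < g k"
    and last: "X \<noteq> Type_D \<Longrightarrow> 0 < g n" "X = Type_D \<Longrightarrow> \<bar>g n\<bar> < g (n - 1)"
    by (rule unique_descent_heights[OF assms(1,2,5)]) blast
  have n: "i < n" "x < n" "last_index \<le> n" "1 \<le> last_index" using assms(4,5) last_index_le by auto
  have gx: "g x = int i - int n - 1" using assms n by (intro ht_frame_eq(2)[OF ht]) auto
  have gi: "g i = int x - int n - 1" using assms n by (intro ht_frame_eq(2)[OF ht]) auto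
  have gi1: "g (i + 1) = int n - int i" using assms n ht_frame_eq(1)[OF ht, of "i + 1" "i + 1"] by simp
  have glast: "1 + int (n - last_index) \<le> g last_index"
    using last ran[of n] n_ge_3 last_index_D last_index_not_D by (cases "X = Type_D") (simp_all only:, auto)
  have chain: "g b + int (b - a) \<le> g a" if "1 \<le> a" "a \<le> b" "b \<le> n" "b \<le> i \<or> i < a" for a b
    using that by (intro decreasing_chain dec) auto
  have tail: "g k = int n + 1 - int k" if k: "i < k" "k \<le> last_index" for k
    using chain[of "i + 1" k] chain[of k last_index] k n glast gi1 by linarith
  have middle: "g k = int x + int i - int k - int n - 1" if k: "x \<le> k" "k \<le> i" for k
    using chain[of x k] chain[of k i] k n gx gi assms(3) by linarith
  have gn: "\<bar>g n\<bar> = 1"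
  proof (cases "X = Type_D")
    case True
    then have "i < n - 1" "last_index = n - 1" using assms(5) last_index_D by simp_all
    then show ?thesis using tail[of "n - 1"] last(2)[OF True] ran[of n] n by fastforce
  next
    case False
    then show ?thesis using tail[of n] n by (simp add: last_index_def)
  qed
  \<comment> \<open>The absolute values on \<open>{x..n}\<close> already exhaust
    \<open>{1..n + 1 - x}\<close>: the middle part covers those above \<open>n - i\<close>, the tail
    together with \<open>n\<close> the others.\<close>
  have avoid: "int n + 2 - int x \<le> \<bar>g k\<bar>" if k: "1 \<le> k" "k < x" for k
  proof (rule ccontr)
    assume "\<not> ?thesis"
    then have le: "\<bar>g k\<bar> \<le> int n + 1 - int x" by simp
    have r: "1 \<le> \<bar>g k\<bar>" using ran[of k] k n by simp
    have "\<exists>l\<in>{1..n}. x \<le> l \<and> \<bar>g l\<bar> = \<bar>g k\<bar>"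
    proof (cases "\<bar>g k\<bar> \<le> int n - int i")
      case False
      define l where "l = nat (int x + int i + \<bar>g k\<bar> - int n - 1)"
      have "x \<le> l" "l \<le> i" using False le by (auto simp: l_def)
      moreover have "\<bar>g l\<bar> = \<bar>g k\<bar>" using middle[OF \<open>x \<le> l\<close> \<open>l \<le> i\<close>] False n by (simp add: l_def)
      ultimately show ?thesis using n assms(3) by (intro bexI[of _ l]) auto
    next
      case True
      show ?thesis
      proof (cases "\<bar>g k\<bar> = 1")
        case True
        then show ?thesis using gn n by (intro bexI[of _ n]) auto
      next
        case False
        define l where "l = nat (int n + 1 - \<bar>g k\<bar>)"
        have l: "i < l" "l \<le> last_index" using True False r n by (auto simp: l_def last_index_def)
        then have "\<bar>g l\<bar> = \<bar>g k\<bar>" using tail[OF l] r n True by (simp add: l_def)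
        then show ?thesis using n l assms(4) by (intro bexI[of _ l]) auto
      qed
    qed
    then show False using inj[of k] k n by fastforce
  qed
  have head: "g k = int n + 1 - int k" if k: "1 \<le> k" "k < x" for k
  proof -
    have x1: "1 \<le> x - 1" "x - 1 < x" "x - 1 + 1 = x" using k by auto
    have "g x < g (x - 1)" using dec[of "x - 1"] x1 n assms(4) by simp
    \<comment> \<open>A negative value of this size would lie below \<open>g x\<close>.\<close>
    then have "int n + 2 - int x \<le> g (x - 1)"
      using avoid[OF x1(1,2)] gx assms(4) by linarith
    moreover have "g (x - 1) + int (x - 1 - k) \<le> g k" "g k + int (k - 1) \<le> g 1"
      using k n assms(4) by (intro chain; simp)+
    moreover have "g 1 \<le> int n" using ran[of 1] n by (simp add: abs_le_iff)
    ultimately show ?thesis using k by linarith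
  qed
  show "w (\<epsilon> k) = (if x \<le> k \<and> k \<le> i then - \<epsilon> (x + i - k) else \<epsilon> k)" if k: "1 \<le> k" "k \<le> last_index" for k
  proof -
    have kn: "k \<in> {1..n}" using k n by simp
    consider "k < x" | "x \<le> k" "k \<le> i" | "i < k" by linarith
    then show ?thesis
    proof cases
      case 1
      then show ?thesis using val[OF kn] head[OF k(1) 1] k n by simp
    next
      case 2
      have "nat (int n + 1 + g k) = x + i - k" using middle[OF 2] 2 by simp
      then show ?thesis using val[OF kn] middle[OF 2] 2 n by simp
    next
      case 3
      then show ?thesis using val[OF kn] tail[OF 3 k(2)] k n by simp
    qed
  qed
  have "g n = 1 \<or> X = Type_D \<and> g n = -1" using gn last(1) by (cases "X = Type_D") auto
  then show "w (\<epsilon> n) = \<epsilon> n \<or> X = Type_D \<and> w (\<epsilon> n) = - \<epsilon> n"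
    using val[of n] n by auto
qed

section \<open>The telescoping products as signed permutations\<close>

lemma middle_roots_apply:
  assumes "1 \<le> x" "x < last_index" "k \<in> {1..n}"
  shows "reflection_product (middle_roots X n \<epsilon> x) (\<epsilon> k) =
    (if k = x \<or> X = Type_D \<and> k = n then - \<epsilon> k else \<epsilon> k)"
proof -
  have "x \<in> {1..n}" "n \<in> {1..n}" "x \<noteq> n" using assms last_index_le n_ge_3 by auto
  then show ?thesis
    using X_cases assms
    by (auto simp: reflection_frame reflection_double_frame reflection_minus_frame reflection_plus_frame
        reflection_minus)
qed

text \<open>The reflection in \<open>\<epsilon> x + \<epsilon> i\<close> exchanges
  \<open>\<epsilon> x\<close> and \<open>- \<epsilon> i\<close>, and the recursion continues inside
  the interval, so the product reverses the interval and changes signs. A middle index exists if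
  \<open>i - x\<close> is even; in type D its pair of roots also changes the sign of
  \<open>\<epsilon> n\<close>.\<close>

lemma telescoping_apply:
  assumes "1 \<le> x" "x \<le> i + 1" "i < last_index" "k \<in> {1..n}"
  shows "reflection_product (telescoping_roots X n \<epsilon> x i) (\<epsilon> k) =
    (if x \<le> k \<and> k \<le> i then - \<epsilon> (x + i - k)
     else if X = Type_D \<and> k = n \<and> x \<le> i \<and> even (i - x) then - \<epsilon> n else \<epsilon> k)"
  using assms
proof (induction "i + 1 - x" arbitrary: x i k rule: less_induct)
  case less
  have in_n: "i < n" using less.prems last_index_le by simp
  consider "i < x" | "x = i" | "x < i" by linarith
  then show ?case
  proof cases
    case 1
    then have "\<not> (x \<le> k \<and> k \<le> i)" by linarith
    moreover have "\<not> x \<le> i" "telescoping_roots X n \<epsilon> x i = []" using 1 by (simp_all add: telescoping_roots.simps)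
    ultimately show ?thesis by (simp only: reflection_product_Nil) simp
  next
    case 2
    have eq: "(if i \<le> k \<and> k \<le> i then - \<epsilon> (i + i - k) else if X = Type_D \<and> k = n \<and> i \<le> i \<and> even (i - i) then - \<epsilon> n else \<epsilon> k)
      = (if k = i \<or> X = Type_D \<and> k = n then - \<epsilon> k else \<epsilon> k)"
      using in_n by (cases "k = i") auto
    show ?thesis
      unfolding 2 eq using less.prems middle_roots_apply[of i k] 2 by (simp add: telescoping_roots.simps)
  next
    case 3
    let ?T = "reflection_product (telescoping_roots X n \<epsilon> (x + 1) (i - 1))"
    have IH: "?T (\<epsilon> k) = (if x + 1 \<le> k \<and> k \<le> i - 1 then - \<epsilon> (x + 1 + (i - 1) - k)
       else if X = Type_D \<and> k = n \<and> x + 1 \<le> i - 1 \<and> even (i - 1 - (x + 1)) then - \<epsilon> n else \<epsilon> k)"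
      using 3 less.prems by (intro less.hyps) auto
    have T: "reflection_product (telescoping_roots X n \<epsilon> x i) (\<epsilon> k) = reflection (\<epsilon> x + \<epsilon> i) (?T (\<epsilon> k))"
      using 3 by (simp add: telescoping_roots.simps[of X n \<epsilon> x i])
    have xi: "x \<in> {1..n}" "i \<in> {1..n}" "x \<noteq> i" "n \<in> {1..n}" using 3 in_n less.prems by auto
    note r = reflection_plus_frame[OF xi(1,2) _ xi(3)]
    \<comment> \<open>Shrinking the interval at both ends preserves the parity of
      \<open>i - x\<close>; for \<open>i = x + 1\<close> the inner interval is empty and both sides
      are false.\<close>
    have parity: "x + 1 \<le> i - 1 \<and> even (i - 1 - (x + 1)) \<longleftrightarrow> x \<le> i \<and> even (i - x)"
    proof (cases "i = x + 1")
      case False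
      then have "x + 1 \<le> i - 1" "\<not> i < 1 + (x + 1)" using 3 by linarith+
      then show ?thesis using 3 by simp
    qed (use 3 in simp)
    consider "k = x" | "k = i" | "x < k" "k < i" | "k < x \<or> i < k" by linarith
    then show ?thesis
    proof cases
      case 1
      then show ?thesis unfolding T IH using 3 xi in_n r by simp
    next
      case 2
      then have "\<not> k \<le> i - 1" using 3 by linarith
      then show ?thesis unfolding T IH using 2 3 xi in_n r by simp
    next
      case k: 3
      then have "x + i - k \<in> {1..n}" "x + i - k \<noteq> x" "x + i - k \<noteq> i" "x + 1 + (i - 1) - k = x + i - k"
        "x + 1 \<le> k" "k \<le> i - 1" "x \<le> k" "k \<le> i"
        using less.prems in_n by auto
      then show ?thesis unfolding T IH using k r by (simp add: reflection_minus)
    next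
      case 4
      then have "\<not> (x + 1 \<le> k \<and> k \<le> i - 1)" "\<not> (x \<le> k \<and> k \<le> i)" "k \<noteq> x" "k \<noteq> i" using 3 by auto
      then show ?thesis unfolding T IH using parity less.prems in_n xi r
        by (auto simp: reflection_minus)
    qed
  qed
qed

text \<open>The bound on \<open>k\<close> keeps away from \<open>n\<close>, because the middle roots
  of type D are not orthogonal to \<open>\<epsilon> n\<close>.\<close>

lemma telescoping_set:
  assumes "1 \<le> x" "x \<le> i + 1" "i < last_index" "r \<in> set (telescoping_roots X n \<epsilon> x i)"
  shows "r \<in> R" and "\<And>k. 1 \<le> k \<Longrightarrow> k < last_index \<Longrightarrow> k < x \<or> i < k \<Longrightarrow> r \<bullet> \<epsilon> k = 0"
proof -
  have "r \<in> R \<and> (\<forall>k. 1 \<le> k \<and> k < last_index \<and> (k < x \<or> i < k) \<longrightarrow> r \<bullet> \<epsilon> k = 0)"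
    using assms
  proof (induction "i + 1 - x" arbitrary: x i rule: less_induct)
    case less
    have in_n: "i < n" "last_index \<le> n" using less.prems(3) last_index_le by auto
    consider "i < x" | "x = i" | "x < i" by linarith
    then show ?case
    proof cases
      case 1
      then show ?thesis using less.prems by (simp add: telescoping_roots.simps)
    next
      case 2
      then have "r \<in> set (middle_roots X n \<epsilon> i)" using less.prems by (simp add: telescoping_roots.simps)
      then consider (b) "X = Type_B" "r = \<epsilon> i" | (c) "X = Type_C" "r = 2 *\<^sub>R \<epsilon> i"
        | (p) "X = Type_D" "r = \<epsilon> i + \<epsilon> n" | (m) "X = Type_D" "r = \<epsilon> i - \<epsilon> n"
        using X_cases by auto
      then show ?thesis
      proof cases
        case b
        then have "r \<in> R" using less.prems in_n 2 by (intro pos_root pos_extra) auto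
        then show ?thesis using b less.prems in_n 2 by (auto simp: frame)
      next
        case c
        then have "r \<in> R" using less.prems in_n 2 by (intro pos_root pos_extra) auto
        then show ?thesis using c less.prems in_n 2 by (auto simp: frame)
      next
        case p
        then have "r \<in> R" using less.prems in_n 2 by (auto intro: pos_root[OF pos_plus])
        then show ?thesis using p(2) less.prems in_n 2 by (auto simp: frame inner_simps)
      next
        case m
        then have "r \<in> R" using less.prems in_n 2 by (auto intro: pos_root[OF pos_minus])
        then show ?thesis using m(2) less.prems in_n 2 by (auto simp: frame inner_simps)
      qed
    next
      case 3
      then consider "r = \<epsilon> x + \<epsilon> i" | "r \<in> set (telescoping_roots X n \<epsilon> (x + 1) (i - 1))"
        using less.prems(4) by (auto simp: telescoping_roots.simps[of X n \<epsilon> x i])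
      then show ?thesis
      proof cases
        case 1
        then show ?thesis using 3 less.prems in_n
          by (auto intro: pos_root[OF pos_plus] simp: frame inner_simps)
      next
        case 2
        then show ?thesis using 3 less.prems less.hyps[of "i - 1" "x + 1"] by auto
      qed
    qed
  qed
  then show "r \<in> R" "\<And>k. 1 \<le> k \<Longrightarrow> k < last_index \<Longrightarrow> k < x \<or> i < k \<Longrightarrow> r \<bullet> \<epsilon> k = 0" by auto
qed

lemma telescoping_orthogonal:
  assumes "1 \<le> x" "x \<le> i + 1" "i < last_index"
  shows "sorted_wrt orthogonal (telescoping_roots X n \<epsilon> x i)"
  using assms
proof (induction "i + 1 - x" arbitrary: x i rule: less_induct)
  case less
  have in_n: "i < n" "last_index \<le> n" using less.prems(3) last_index_le by auto
  consider "i < x" | "x = i" | "x < i" by linarith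
  then show ?case
  proof cases
    case 2
    then show ?thesis using X_cases less.prems in_n
      by (auto simp: telescoping_roots.simps orthogonal_def inner_simps frame)
  next
    case 3
    have "orthogonal (\<epsilon> x + \<epsilon> i) r" if "r \<in> set (telescoping_roots X n \<epsilon> (x + 1) (i - 1))" for r
      using telescoping_set(2)[OF _ _ _ that, of x] telescoping_set(2)[OF _ _ _ that, of i] 3 less.prems
      by (simp add: orthogonal_def inner_simps inner_commute)
    moreover have "sorted_wrt orthogonal (telescoping_roots X n \<epsilon> (x + 1) (i - 1))"
      using 3 less.prems by (intro less.hyps) auto
    ultimately show ?thesis using 3 by (simp add: telescoping_roots.simps[of X n \<epsilon> x i])
  qed (simp add: telescoping_roots.simps)
qed

abbreviation "telescope x i \<equiv> reflection_product (telescoping_roots X n \<epsilon> x i)"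

lemma telescope:
  assumes "1 \<le> x" "x < i" "i < last_index"
  shows "telescope x i \<in> W" and "telescope x i \<circ> telescope x i = id" and "inv (telescope x i) = telescope x i"
proof -
  have "set (telescoping_roots X n \<epsilon> x i) \<subseteq> R"
    using telescoping_set(1)[of x i] assms by auto
  then show "telescope x i \<in> W" by (rule reflection_product_in_weyl_group)
  show "telescope x i \<circ> telescope x i = id"
    using assms by (intro orthogonal_reflection_product_involution telescoping_orthogonal) auto
  then show "inv (telescope x i) = telescope x i" by (rule inv_unique_comp) fact
qed

text \<open>After \<open>j = i\<close> and \<open>y = x\<close>, the product \<open>u\<close> of the
  telescoping element and \<open>w\<close> fixes the frame up to the sign of
  \<open>\<epsilon> n\<close> in type D. Under either sign every simple root stays positive, so
  \<open>u\<close> is the identity; this also settles the sign.\<close>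

lemma medium_NGT_telescope:
  assumes "medium_NGT w i j b"
  obtains x where "1 \<le> x" "x < i" "i < last_index" "b = \<epsilon> x + \<epsilon> (i + 1)" "w = telescope x i"
proof -
  note m = assms[unfolded medium_NGT_def]
  have w: "w \<in> W" using m by simp
  note w' = weyl_group_inv_apply(1)[OF w] weyl_minus[OF weyl_group_inv[OF w]]
  obtain x where x: "1 \<le> x" "x < i" "i < last_index" "b = \<epsilon> x + \<epsilon> (i + 1)"
    using medium_NGT_root[OF assms] .
  obtain y where y: "1 \<le> y" "y < j" "j < last_index" "- w (\<alpha> i) = \<epsilon> y + \<epsilon> (j + 1)"
    using medium_NGT_root[OF medium_NGT_inverse[OF assms]] .
  note fr = medium_NGT_frame[OF assms x(4,1-3) y(4,1-3)]
  have fr': "inv w (\<epsilon> y) = - \<epsilon> i" "inv w (\<epsilon> (j + 1)) = \<epsilon> (i + 1)" "inv w (\<epsilon> j) = - \<epsilon> x"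
    using arg_cong[OF fr(1), of "inv w"] arg_cong[OF fr(2), of "inv w"] arg_cong[OF fr(3), of "inv w"]
    by (simp_all add: w')
  have "right_descents w = {i}" "right_descents (inv w) = {j}" using m by auto
  note idx = unique_descent_indices[OF w this(1) x(1-3) y(1-3) fr]
    unique_descent_indices[OF weyl_group_inv[OF w] this(2) y(1-3) x(1-3) fr']
  then have ji: "j = i" "y = x" by linarith+
  note fr = fr[unfolded ji]
  note vals = unique_descent_frame[OF w \<open>right_descents w = {i}\<close> x(1-3) fr]
  define t where "t = telescope x i"
  have t: "t \<in> W" "t \<circ> t = id" using telescope[OF x(1-3)] by (simp_all add: t_def)
  note lin = weyl_group_linear[OF t(1)]
  have n: "i < n" "last_index \<le> n" "n \<in> {1..n}" using x(3) last_index_le by auto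
  have tk: "t (\<epsilon> k) = (if x \<le> k \<and> k \<le> i then - \<epsilon> (x + i - k)
     else if X = Type_D \<and> k = n \<and> x \<le> i \<and> even (i - x) then - \<epsilon> n else \<epsilon> k)" if "k \<in> {1..n}" for k
    unfolding t_def using x that by (intro telescoping_apply) auto
  define u where "u = t \<circ> w"
  have uW: "u \<in> W" unfolding u_def by (rule weyl_group_comp[OF t(1) w])
  note ulin = weyl_group_linear[OF uW]
  have u_fix: "u (\<epsilon> k) = \<epsilon> k" if k: "1 \<le> k" "k \<le> last_index" "k < n \<or> X \<noteq> Type_D" for k
  proof -
    have kn: "k \<in> {1..n}" using k n by simp
    show ?thesis
    proof (cases "x \<le> k \<and> k \<le> i")
      case True
      then have "x + i - k \<in> {1..n}" "x \<le> x + i - k" "x + i - k \<le> i" "x + i - (x + i - k) = k"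
        using x n by auto
      then show ?thesis using vals(1)[OF k(1,2)] True tk[of "x + i - k"] by (simp add: u_def linear_neg[OF lin])
    next
      case False
      then show ?thesis using vals(1)[OF k(1,2)] tk[OF kn] k by (auto simp: u_def)
    qed
  qed
  have u_n: "u (\<epsilon> n) = \<epsilon> n \<or> X = Type_D \<and> u (\<epsilon> n) = - \<epsilon> n"
  proof -
    have "t (\<epsilon> n) = \<epsilon> n \<or> X = Type_D \<and> t (\<epsilon> n) = - \<epsilon> n" using tk[OF n(3)] n(1) by (metis leD)
    then show ?thesis using vals(2) by (auto simp: u_def linear_neg[OF lin])
  qed
  have "u (\<alpha> k) \<in> Pos" if k: "k \<in> {1..n}" for k
  proof (cases "k < n")
    case True
    have uk: "u (\<epsilon> k) = \<epsilon> k"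
      using True k n_le_last_index by (intro u_fix) auto
    have "u (\<epsilon> (k + 1)) = \<epsilon> (k + 1) \<or> u (\<epsilon> (k + 1)) = - \<epsilon> (k + 1)"
    proof (cases "k + 1 = n")
      case False
      then show ?thesis using True k n_le_last_index by (intro disjI1 u_fix) auto
    qed (use u_n in auto)
    then show ?thesis
      using uk True k pos_plus[of k "k + 1"] pos_minus[of k "k + 1"]
      by (auto simp: simple_eq linear_diff[OF ulin])
  next
    case False
    then have kn: "k = n" using k by simp
    show ?thesis
    proof (cases "X = Type_D")
      case False
      then have "u (\<epsilon> n) = \<epsilon> n" using u_n by simp
      then have "u (\<alpha> n) = \<alpha> n"
        using False X_cases by (auto simp: simple_last linear_cmul[OF ulin])
      then show ?thesis using simple_pos[OF k] kn by simp
    next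
      case True
      have "u (\<epsilon> (n - 1)) = \<epsilon> (n - 1)" using last_index_D[OF True] n_ge_3 by (intro u_fix) auto
      then show ?thesis
        using True kn u_n n_ge_3 pos_plus[of "n - 1" n] pos_minus[of "n - 1" n]
        by (auto simp: simple_last linear_add[OF ulin])
    qed
  qed
  then have "u = id" by (rule weyl_eq_id[OF uW])
  then have "t (w z) = z" for z unfolding u_def by (metis comp_apply id_apply)
  moreover have "t (t z) = z" for z using t(2) by (metis comp_apply id_apply)
  ultimately have "w z = t z" for z by metis
  then have "w = t" by (rule ext)
  then show thesis using that x by (simp add: t_def)
qed

text \<open>The converse is read off from the signed permutation. At the left border of the interval
  a difference of frame vectors becomes a sum; inside, the reversal of the order and the change of
  sign compensate each other; only \<open>\<alpha> i\<close>, at the right border, becomes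
  negative.\<close>

lemma telescope_medium_NGT:
  assumes "1 \<le> x" "x < i" "i < last_index"
  shows "medium_NGT (telescope x i) i i (\<epsilon> x + \<epsilon> (i + 1))"
proof -
  define t where "t = telescope x i"
  have t: "t \<in> W" "inv t = t" using telescope[OF assms] by (simp_all add: t_def)
  note lin = weyl_group_linear[OF t(1)]
  have n: "i < n" "last_index \<le> n" "x < n" using assms last_index_le by auto
  have i1: "i + 1 < n \<or> X \<noteq> Type_D" using assms last_index_D by fastforce
  have tk: "t (\<epsilon> k) = (if x \<le> k \<and> k \<le> i then - \<epsilon> (x + i - k)
     else if X = Type_D \<and> k = n \<and> x \<le> i \<and> even (i - x) then - \<epsilon> n else \<epsilon> k)" if "k \<in> {1..n}" for k
    unfolding t_def using assms that by (intro telescoping_apply) auto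
  have vals: "t (\<epsilon> i) = - \<epsilon> x" "t (\<epsilon> x) = - \<epsilon> i" "t (\<epsilon> (i + 1)) = \<epsilon> (i + 1)"
    using tk[of i] tk[of x] tk[of "i + 1"] assms n i1 by auto
  have pos: "t (\<alpha> k) \<in> Pos" if k: "k \<in> {1..n}" "k \<noteq> i" for k
  proof (cases "k < n")
    case True
    have tkk: "t (\<alpha> k) = t (\<epsilon> k) - t (\<epsilon> (k + 1))" using k True by (simp add: simple_eq linear_diff[OF lin])
    have k1: "k + 1 \<in> {1..n}" using True by simp
    consider "k + 1 < x" | "k + 1 = x" | "x \<le> k" "k < i" | "i < k" using k by linarith
    then show ?thesis
    proof cases
      case 1
      then have "t (\<alpha> k) = \<epsilon> k - \<epsilon> (k + 1)" unfolding tkk using tk[OF k(1)] tk[OF k1] assms n by simp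
      then show ?thesis using pos_minus[of k "k + 1"] k True by simp
    next
      case 2
      then have "t (\<alpha> k) = \<epsilon> k + \<epsilon> i" unfolding tkk using tk[OF k(1)] vals assms n by auto
      then show ?thesis using pos_plus[of k i] k 2 assms n by simp
    next
      case 3
      then have "t (\<alpha> k) = \<epsilon> (x + i - (k + 1)) - \<epsilon> (x + i - k)"
        unfolding tkk using tk[OF k(1)] tk[OF k1] by simp
      then show ?thesis using pos_minus[of "x + i - (k + 1)" "x + i - k"] 3 assms n by auto
    next
      case 4
      have "t (\<epsilon> (k + 1)) = \<epsilon> (k + 1) \<or> t (\<epsilon> (k + 1)) = - \<epsilon> (k + 1)"
        using tk[OF k1] 4 by auto
      moreover have "t (\<epsilon> k) = \<epsilon> k" using tk[OF k(1)] 4 True by simp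
      ultimately show ?thesis
        unfolding tkk using pos_plus[of k "k + 1"] pos_minus[of k "k + 1"] k True by auto
    qed
  next
    case False
    then have kn: "k = n" using k by simp
    show ?thesis
    proof (cases "X = Type_D")
      case False
      then have "t (\<alpha> n) = \<alpha> n"
        using X_cases tk[of n] n by (auto simp: simple_last linear_cmul[OF lin])
      then show ?thesis using simple_pos[OF k(1)] kn by simp
    next
      case True
      have "i < n - 1" using assms last_index_D[OF True] by simp
      then have "t (\<epsilon> (n - 1)) = \<epsilon> (n - 1)" using tk[of "n - 1"] n by auto
      moreover have "t (\<epsilon> n) = \<epsilon> n \<or> t (\<epsilon> n) = - \<epsilon> n" using tk[of n] n by auto
      ultimately show ?thesis
        using True kn n_ge_3 pos_plus[of "n - 1" n] pos_minus[of "n - 1" n]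
        by (auto simp: simple_last linear_add[OF lin])
    qed
  qed
  have "t (\<alpha> i) = - (\<epsilon> x + \<epsilon> (i + 1))"
    using vals assms n by (simp add: simple_eq linear_diff[OF lin])
  then have "t (\<alpha> i) \<in> Neg"
    using pos_plus[of x "i + 1"] assms n unfolding neg_iff by (simp only: minus_minus)
  then have rd: "right_descents t = {i}"
    using pos pos_not_neg assms n by (auto simp: right_descents_def)
  have g: "\<alpha> i + (\<epsilon> x + \<epsilon> (i + 1)) = \<epsilon> x + \<epsilon> i" using assms n by (simp add: simple_eq)
  have "\<epsilon> x + \<epsilon> i \<in> R" using pos_plus[of x i] assms n by (simp add: pos_root)
  moreover have "t (\<epsilon> x + \<epsilon> (i + 1)) = - \<alpha> i"
    using vals assms n by (simp add: simple_eq linear_add[OF lin])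
  moreover have "\<alpha> i \<bullet> \<alpha> i = 2 * c" using assms n by (simp add: simple_eq inner_simps frame)
  moreover have "(\<epsilon> x + \<epsilon> (i + 1)) \<bullet> (\<epsilon> x + \<epsilon> (i + 1)) = 2 * c" "(\<epsilon> x + \<epsilon> i) \<bullet> (\<epsilon> x + \<epsilon> i) = 2 * c"
    using assms n by (simp_all add: inner_simps frame)
  ultimately show ?thesis
    unfolding medium_NGT_def g using t rd assms n by (simp flip: t_def)
qed

lemma telescoping_range_eq: "telescoping_range X n = {(i, j). 1 \<le> i \<and> i < j \<and> j < last_index}"
  by (simp add: telescoping_range_def last_index_def)

lemma minimal_NGT_triple_classical:
  "minimal_NGT_triple X R \<alpha> {1..n} w b g a \<longleftrightarrow>
     (\<exists>i j. (i, j) \<in> telescoping_range X n \<and> g = \<epsilon> i + \<epsilon> j \<and> a = \<epsilon> j - \<epsilon> (j + 1) \<and> g = a + b \<and>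
        w = telescope i j)"
proof
  assume "minimal_NGT_triple X R \<alpha> {1..n} w b g a"
  then obtain j j' where m: "medium_NGT w j j' b" and a: "a = \<alpha> j" "g = \<alpha> j + b"
    unfolding minimal_NGT_triple_iff_medium by blast
  obtain i where i: "1 \<le> i" "i < j" "j < last_index" "b = \<epsilon> i + \<epsilon> (j + 1)" "w = telescope i j"
    using medium_NGT_telescope[OF m] .
  moreover have "\<alpha> j = \<epsilon> j - \<epsilon> (j + 1)" using i last_index_le by (intro simple_eq) auto
  ultimately show "\<exists>i j. (i, j) \<in> telescoping_range X n \<and> g = \<epsilon> i + \<epsilon> j \<and> a = \<epsilon> j - \<epsilon> (j + 1) \<and>
      g = a + b \<and> w = telescope i j"
    unfolding telescoping_range_eq a by (intro exI[of _ i] exI[of _ j]) simp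
next
  assume "\<exists>i j. (i, j) \<in> telescoping_range X n \<and> g = \<epsilon> i + \<epsilon> j \<and> a = \<epsilon> j - \<epsilon> (j + 1) \<and>
      g = a + b \<and> w = telescope i j"
  then obtain i j where i: "1 \<le> i" "i < j" "j < last_index" and g: "g = \<epsilon> i + \<epsilon> j"
    and a: "a = \<epsilon> j - \<epsilon> (j + 1)" and b: "g = a + b" and w: "w = telescope i j"
    unfolding telescoping_range_eq by blast
  have \<alpha>: "\<alpha> j = \<epsilon> j - \<epsilon> (j + 1)" using i last_index_le by (intro simple_eq) auto
  have "b = \<epsilon> i + \<epsilon> (j + 1)"
    using b unfolding g a by (simp add: algebra_simps)
  then have "medium_NGT w j j b" using telescope_medium_NGT[OF i] w by simp
  then show "minimal_NGT_triple X R \<alpha> {1..n} w b g a"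
    unfolding minimal_NGT_triple_iff_medium using a b \<alpha> by auto
qed

lemma telescoping_properties:
  "\<forall>(i, j)\<in>telescoping_range X n.
     let rs = telescoping_roots X n \<epsilon> i j; w = reflection_product rs in
       set rs \<subseteq> R \<and> sorted_wrt orthogonal rs \<and> w \<circ> w = id \<and> \<epsilon> i + \<epsilon> j \<in> set rs"
proof -
  have "set (telescoping_roots X n \<epsilon> i j) \<subseteq> R" "sorted_wrt orthogonal (telescoping_roots X n \<epsilon> i j)"
    "telescope i j \<circ> telescope i j = id" "\<epsilon> i + \<epsilon> j \<in> set (telescoping_roots X n \<epsilon> i j)"
    if "1 \<le> i" "i < j" "j < last_index" for i j
  proof -
    show "set (telescoping_roots X n \<epsilon> i j) \<subseteq> R" using telescoping_set(1)[of i j] that by auto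
    show "sorted_wrt orthogonal (telescoping_roots X n \<epsilon> i j)" using that by (intro telescoping_orthogonal) auto
    show "telescope i j \<circ> telescope i j = id" by (rule telescope(2)[OF that])
    show "\<epsilon> i + \<epsilon> j \<in> set (telescoping_roots X n \<epsilon> i j)"
      using that by (simp add: telescoping_roots.simps[of X n \<epsilon> i j])
  qed
  then show ?thesis unfolding telescoping_range_eq Let_def by blast
qed

lemma minimal_NGTs_classical:
  "minimal_NGTs X R \<alpha> {1..n} = {telescope i j | i j. (i, j) \<in> telescoping_range X n}"
proof -
  have "\<exists>b g a. g = \<epsilon> i + \<epsilon> j \<and> a = \<epsilon> j - \<epsilon> (j + 1) \<and> g = a + b" for i j
    by (rule exI[of _ "\<epsilon> i + \<epsilon> (j + 1)"]) simp
  then show ?thesis unfolding minimal_NGTs_def minimal_NGT_triple_classical by blast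
qed

end

section \<open>Type D recovered from its simple roots, for subsystems known only through their
  diagram\<close>

locale type_D_frame = simple_system R \<alpha> "{1..n}" + orthogonal_frame n \<epsilon>
  for R :: "'a::real_inner set" and \<alpha> :: "nat \<Rightarrow> 'a" and n :: nat and \<epsilon> :: "nat \<Rightarrow> 'a" +
  assumes n_ge_2: "2 \<le> n"
    and simple_minus: "\<And>i. 1 \<le> i \<Longrightarrow> i < n \<Longrightarrow> \<alpha> i = \<epsilon> i - \<epsilon> (i + 1)"
    and simple_plus: "\<alpha> n = \<epsilon> (n - 1) + \<epsilon> n"
begin

lemma word_E: "ws \<in> lists {1..n} \<Longrightarrow> x \<in> E \<Longrightarrow> word_product \<alpha> ws x \<in> E"
proof (induction ws rule: list.induct)
  case (Cons i ws)
  have *: "s i (\<epsilon> k) \<in> E" if "k \<in> {1..n}" for k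
  proof (cases "i < n")
    case True
    then show ?thesis
      using Cons.prems that by (simp add: simple_minus reflection_minus_frame frame_in_E)
  next
    case False
    then have "i = n" using Cons.prems by simp
    then show ?thesis
      using that n_ge_2 by (auto simp: simple_plus reflection_plus_frame frame_in_E uminus_E)
  qed
  have "word_product \<alpha> ws x \<in> E" using Cons by simp
  then consider k where "k \<in> {1..n}" "word_product \<alpha> ws x = \<epsilon> k"
    | k where "k \<in> {1..n}" "word_product \<alpha> ws x = - \<epsilon> k"
    unfolding E_def by blast
  then have "s i (word_product \<alpha> ws x) \<in> E" by cases (simp_all only: reflection_minus * uminus_E)
  then show ?case by simp
qed simp

lemma ht_simple: "i \<in> {1..n} \<Longrightarrow> 0 < ht (\<alpha> i)"
  using n_ge_2 by (cases "i < n") (auto simp: simple_minus simple_plus F_add F_diff F_frame)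

lemma ht_positive: "r \<in> Pos \<Longrightarrow> 0 < ht r"
proof -
  assume r: "r \<in> Pos"
  have "ht r = ht (\<Sum>k\<in>{1..n}. coord k r *\<^sub>R \<alpha> k)"
    by (rule arg_cong[OF span_eq_sum_coord[OF pos_in_span[OF r]]])
  then have "ht r = (\<Sum>k\<in>{1..n}. coord k r * ht (\<alpha> k))" by (simp add: F_sum F_scale)
  moreover obtain i where "i \<in> {1..n}" "1 \<le> coord i r" using pos_coord_positive[OF r] by blast
  then have "0 < coord i r * ht (\<alpha> i)" using ht_simple by simp
  ultimately show ?thesis
    using \<open>i \<in> {1..n}\<close> r ht_simple
    by (auto intro!: sum_pos2[of _ i] mult_nonneg_nonneg pos_coord_nonneg simp: less_imp_le)
qed

text \<open>Every root is the image of a simple root, and each simple root is a sum of two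
  orthogonal signed frame vectors.\<close>

lemma root_cases:
  assumes "r \<in> R"
  obtains x y where "x \<in> E" "y \<in> E" "x \<bullet> y = 0" "r = x + y"
proof -
  obtain w i where w: "w \<in> W" "i \<in> {1..n}" "r = w (\<alpha> i)" using root_conjugate_simple[OF assms] by blast
  obtain ws where ws: "ws \<in> lists {1..n}" "w = word_product \<alpha> ws" using w(1) by (auto elim: weyl_groupE)
  have E: "w x \<in> E" if "x \<in> E" for x using word_E[OF ws(1) that] ws(2) by simp
  note lin = linear_add[OF weyl_group_linear[OF w(1)]] weyl_group_inner[OF w(1)]
  show thesis
  proof (cases "i < n")
    case True
    then have "r = w (\<epsilon> i) + w (- \<epsilon> (i + 1))" using w by (simp add: simple_minus flip: lin(1))
    then show ?thesis using True w(2)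
      by (intro that[of "w (\<epsilon> i)" "w (- \<epsilon> (i + 1))"] E uminus_E frame_in_E) (simp_all add: lin(2) frame)
  next
    case False
    then have "r = w (\<epsilon> (n - 1)) + w (\<epsilon> n)" using w by (simp add: simple_plus flip: lin(1))
    then show ?thesis using n_ge_2
      by (intro that[of "w (\<epsilon> (n - 1))" "w (\<epsilon> n)"] E frame_in_E) (simp_all add: lin(2) frame)
  qed
qed

lemma minus_root: "1 \<le> p \<Longrightarrow> p < q \<Longrightarrow> q \<le> n \<Longrightarrow> \<epsilon> p - \<epsilon> q \<in> R"
proof (induction q)
  case (Suc q)
  show ?case
  proof (cases "p = q")
    case True
    then show ?thesis using Suc.prems simple_minus[of q] simple_root[of q] by (simp flip: Suc_eq_plus1)
  next
    case False
    then have "\<epsilon> p - \<epsilon> q \<in> R" using Suc by simp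
    then have "s q (\<epsilon> p - \<epsilon> q) \<in> R" using Suc.prems False by (intro reflection_root simple_root) auto
    moreover have "s q (\<epsilon> p - \<epsilon> q) = \<epsilon> p - \<epsilon> (Suc q)"
      using Suc.prems False simple_minus[of q] linear_diff[OF linear_reflection, of "\<alpha> q"]
      by (simp add: reflection_minus_frame flip: Suc_eq_plus1)
    ultimately show ?thesis by simp
  qed
qed simp

text \<open>The root \<open>\<alpha> n\<close> is moved by reflections in the differences already
  known to be roots, which replace \<open>n - 1\<close> by \<open>p\<close> and then
  \<open>n\<close> by \<open>q\<close>.\<close>

lemma plus_root:
  assumes "1 \<le> p" "p < q" "q \<le> n"
  shows "\<epsilon> p + \<epsilon> q \<in> R"
proof -
  note lin = linear_add[OF linear_reflection]
  have last: "\<epsilon> p + \<epsilon> n \<in> R"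
  proof (cases "p = n - 1")
    case True
    then show ?thesis using simple_plus simple_root[of n] n_pos by simp
  next
    case False
    then have p: "p < n - 1" using assms by simp
    have "n \<noteq> n - 1" using n_pos by simp
    have "reflection (\<epsilon> p - \<epsilon> (n - 1)) (\<alpha> n) \<in> R"
      using p assms n_pos by (intro reflection_root minus_root simple_root) auto
    moreover have "reflection (\<epsilon> p - \<epsilon> (n - 1)) (\<alpha> n) = \<epsilon> p + \<epsilon> n"
      using p assms \<open>n \<noteq> n - 1\<close> unfolding simple_plus lin by (simp add: reflection_minus_frame)
    ultimately show ?thesis by simp
  qed
  show ?thesis
  proof (cases "q = n")
    case False
    then have q: "q < n" using assms by simp
    have "reflection (\<epsilon> q - \<epsilon> n) (\<epsilon> p + \<epsilon> n) \<in> R"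
      using q assms last by (intro reflection_root minus_root) auto
    moreover have "reflection (\<epsilon> q - \<epsilon> n) (\<epsilon> p + \<epsilon> n) = \<epsilon> p + \<epsilon> q"
      using q assms unfolding lin by (simp add: reflection_minus_frame)
    ultimately show ?thesis by simp
  qed (use last in simp)
qed

lemma pos_if_ht: "r \<in> R \<Longrightarrow> 0 < ht r \<Longrightarrow> r \<in> Pos"
  using pos_or_neg[of r] ht_positive[of "- r"] by (auto simp: neg_iff F_minus)

lemma type_D_coordinates: "bourbaki_coordinates Type_D n \<epsilon> R \<alpha>"
proof -
  let ?P = "{\<epsilon> i + \<epsilon> j | i j. 1 \<le> i \<and> i < j \<and> j \<le> n} \<union> {\<epsilon> i - \<epsilon> j | i j. 1 \<le> i \<and> i < j \<and> j \<le> n}"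
  have "r \<in> ?P" if r: "r \<in> Pos" for r
  proof -
    have h: "0 < ht r" by (rule ht_positive[OF r])
    obtain x y where xy: "x \<in> E" "y \<in> E" "x \<bullet> y = 0" "r = x + y"
      using root_cases[OF pos_root[OF r]] .
    have plus: "\<epsilon> p + \<epsilon> q \<in> ?P" if "p \<in> {1..n}" "q \<in> {1..n}" "p \<noteq> q" for p q
    proof (cases "p < q")
      case False
      then have "\<epsilon> p + \<epsilon> q = \<epsilon> q + \<epsilon> p" "q < p" using that by (auto simp: add.commute)
      then show ?thesis using that by (intro UnI1 CollectI exI[of _ q] exI[of _ p]) simp
    qed (use that in auto)
    have minus: "\<epsilon> p - \<epsilon> q \<in> ?P" if "p \<in> {1..n}" "q \<in> {1..n}" "0 < ht (\<epsilon> p - \<epsilon> q)" for p q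
      using that by (intro UnI2 CollectI exI[of _ p] exI[of _ q]) (simp add: F_diff F_frame)
    from xy(1,2) consider
        p q where "p \<in> {1..n}" "q \<in> {1..n}" "x = \<epsilon> p" "y = \<epsilon> q"
      | p q where "p \<in> {1..n}" "q \<in> {1..n}" "x = \<epsilon> p" "y = - \<epsilon> q"
      | p q where "p \<in> {1..n}" "q \<in> {1..n}" "x = - \<epsilon> p" "y = \<epsilon> q"
      | p q where "p \<in> {1..n}" "q \<in> {1..n}" "x = - \<epsilon> p" "y = - \<epsilon> q"
      unfolding E_def by blast
    then show ?thesis
    proof cases
      case (1 p q)
      then have "p \<noteq> q" using xy(3) c_pos by (auto simp: frame)
      then show ?thesis using plus[of p q] 1 xy(4) by simp
    next
      case (2 p q)
      then show ?thesis using minus[of p q] h xy(4) by simp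
    next
      case (3 p q)
      then have "r = \<epsilon> q - \<epsilon> p" using xy(4) by simp
      then show ?thesis using minus[of q p] h 3 by simp
    next
      case (4 p q)
      then have "ht r < 0" using xy(4) by (simp add: F_diff F_minus F_frame)
      then show ?thesis using h by simp
    qed
  qed
  moreover have "r \<in> Pos" if "r \<in> ?P" for r
    using that
  proof (elim UnE CollectE exE conjE)
    fix p q assume "r = \<epsilon> p + \<epsilon> q" "1 \<le> p" "p < q" "q \<le> n"
    then show ?thesis using plus_root[of p q] by (intro pos_if_ht) (simp_all add: F_add F_frame)
  next
    fix p q assume "r = \<epsilon> p - \<epsilon> q" "1 \<le> p" "p < q" "q \<le> n"
    then show ?thesis using minus_root[of p q] by (intro pos_if_ht) (simp_all add: F_diff F_frame)
  qed
  ultimately have "Pos = ?P" by blast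
  then show ?thesis
    using frame_axiom simple_minus simple_plus by (simp add: bourbaki_coordinates_def)
qed

end

section \<open>Enumeration of elements with a unique right descent\<close>

text \<open>A state \<open>(v, z, ws)\<close> of the enumeration describes \<open>w = word_product \<alpha> ws\<close> without right
  descents other than \<open>i\<close>: the entries of \<open>v\<close> are the \<open>i\<close>-th coordinates of the roots
  \<open>w\<^sup>-\<^sup>1 (\<alpha> m)\<close>, those of \<open>z\<close> the pairings of these roots with the coroot of \<open>\<alpha> i\<close>.
  The elements \<open>w\<close> are the nodes of a tree, in which the edge to the parent of \<open>w \<noteq> id\<close> is labelled
  by its smallest left descent.\<close>

type_synonym enum_state = "int list \<times> int list \<times> nat list"

text \<open>The change under left multiplication of \<open>w\<close> by \<open>s k\<close> of the
  values of any linear functional at the roots \<open>inv w (\<alpha> m)\<close>, where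
  \<open>c\<close> is the value at \<open>k\<close>. The same rule serves coordinates, pairings and
  heights.\<close>

definition act_row :: "int \<Rightarrow> int list \<Rightarrow> int list \<Rightarrow> int list" where
  "act_row c rw v = map2 (\<lambda>a x. x - a * c) rw v"

text \<open>Negative entries mark the left descents. Excluding those below \<open>k\<close> makes
  \<open>k\<close> the smallest one, so that every element is reached from a single parent.\<close>

definition canonical :: "nat list \<Rightarrow> nat \<Rightarrow> int list \<Rightarrow> bool" where
  "canonical J k v = list_all (\<lambda>(m, x). k \<le> m \<or> 0 \<le> x) (zip J v)"

text \<open>If the coordinate \<open>c\<close> of \<open>inv w (\<alpha> k)\<close> is positive,
  then \<open>s k \<circ> w\<close> is longer and acquires no right descent other than
  \<open>i\<close>. If it is zero, \<open>s k\<close> fixes the corresponding point of the orbit of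
  the coweight; if it is negative, it leads back.\<close>

definition child :: "nat list \<Rightarrow> enum_state \<Rightarrow> (nat \<times> int list) \<times> int \<times> int \<Rightarrow> enum_state list" where
  "child J st q = (case st of (v, z, ws) \<Rightarrow> case q of ((k, rw), c, d) \<Rightarrow>
     if 0 < c then
       let u = act_row c rw v in if canonical J k u then [(u, act_row d rw z, k # ws)] else []
     else [])"

definition children :: "nat list \<Rightarrow> (nat \<times> int list) list \<Rightarrow> enum_state \<Rightarrow> enum_state list" where
  "children J rws st = (case st of (v, z, ws) \<Rightarrow> concat (map (child J st) (zip rws (zip v z))))"

text \<open>One negative entry means one left descent \<open>m\<close>. The pairing 1 of
  \<open>inv w (\<alpha> m)\<close> is the pairing -1 of \<open>\<beta>\<close>, its negative, which
  makes \<open>\<alpha> + \<beta>\<close> a root; \<open>js\<close> holds the nodes \<open>m\<close>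
  with the length of \<open>\<alpha> i\<close>.\<close>

definition good :: "nat list \<Rightarrow> nat list \<Rightarrow> enum_state \<Rightarrow> bool" where
  "good J js st = (case st of (v, z, ws) \<Rightarrow>
     case filter (\<lambda>(m, x, y). x < 0) (zip J (zip v z)) of
       [(m, x, y)] \<Rightarrow> y = 1 \<and> m \<in> set js | _ \<Rightarrow> False)"

definition next_level :: "nat list \<Rightarrow> (nat \<times> int list) list \<Rightarrow> enum_state list \<Rightarrow> enum_state list" where
  "next_level J rws xs = concat (map (children J rws) xs)"

text \<open>The number is fuel. \<open>None\<close> signals that a level was still nonempty when it
  ran out, so a result \<open>Some\<close> is complete.\<close>

fun enumerate_from ::
  "nat list \<Rightarrow> (nat \<times> int list) list \<Rightarrow> nat list \<Rightarrow> nat \<Rightarrow> enum_state list \<Rightarrow> nat list list option" where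
  "enumerate_from J rws js 0 xs = (if xs = [] then Some [] else None)"
| "enumerate_from J rws js (Suc f) xs = (if xs = [] then Some [] else
     map_option (append (map (snd \<circ> snd) (filter (good J js) xs)))
       (enumerate_from J rws js f (next_level J rws xs)))"

definition cartan_rows :: "(nat \<Rightarrow> nat \<Rightarrow> int) \<Rightarrow> nat list \<Rightarrow> (nat \<times> int list) list" where
  "cartan_rows a J = map (\<lambda>k. (k, map (a k) J)) J"

text \<open>The levels are lengths of elements, hence bounded by the number of positive roots, 24 in
  F4 and 36 in E6; the fuel 40 exceeds both. The initial state is that of the identity.\<close>

definition unique_descent_words ::
  "(nat \<Rightarrow> nat \<Rightarrow> int) \<Rightarrow> nat list \<Rightarrow> nat list \<Rightarrow> nat \<Rightarrow> nat list list option" where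
  "unique_descent_words a J js i = enumerate_from J (cartan_rows a J) js 40
     [(map (\<lambda>m. if m = i then 1 else 0) J, map (a i) J, [])]"

text \<open>The library function \<open>fold\<close> is avoided here: the code equations turn \<open>fold f (rev xs)\<close> into a
  \<open>foldr\<close>, whose evaluation by rewriting takes exponential time.\<close>

fun run :: "(nat \<Rightarrow> 'b \<Rightarrow> 'b) \<Rightarrow> nat list \<Rightarrow> 'b \<Rightarrow> 'b" where
  "run f [] x = x"
| "run f (k # ks) x = run f ks (f k x)"

lemma run_append [simp]: "run f (ks @ ls) x = run f ls (run f ks x)"
  by (induction ks arbitrary: x) simp_all

text \<open>The heights of the roots \<open>inv w (\<alpha> m)\<close>, starting from 1 for the
  simple roots. Entries are found through \<open>map_of\<close> because \<open>J\<close> may skip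
  indices.\<close>

definition height_vector :: "(nat \<Rightarrow> nat \<Rightarrow> int) \<Rightarrow> nat list \<Rightarrow> nat list \<Rightarrow> int list" where
  "height_vector a J ws =
     run (\<lambda>k v. act_row (the (map_of (zip J v) k)) (map (a k) J) v) (rev ws) (map (\<lambda>_. 1) J)"

lemma concat_map_if_singleton:
  "concat (map (\<lambda>k. if P k then [f k] else []) xs) = map f (filter P xs)"
  by (induction xs) auto

lemma zip_map_pair: "zip xs (zip (map f xs) (map g xs)) = map (\<lambda>x. (x, f x, g x)) xs"
  by (induction xs) auto

lemma next_level_Nil: "(next_level J rws ^^ t) [] = []"
  by (induction t) (simp_all add: next_level_def)

text \<open>An empty level is followed by empty levels only, so nothing is lost by stopping
  there.\<close>

lemma enumerate_from_Some:
  "enumerate_from J rws js f xs = Some res \<Longrightarrow>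
     set res = {ws. \<exists>t v z. (v, z, ws) \<in> set ((next_level J rws ^^ t) xs) \<and> good J js (v, z, ws)}"
proof (induction f arbitrary: xs res)
  case 0
  then show ?case by (simp add: next_level_Nil split: if_splits)
next
  case (Suc f)
  show ?case
  proof (cases "xs = []")
    case True
    then show ?thesis using Suc.prems by (simp add: next_level_Nil)
  next
    case False
    then obtain res' where res': "enumerate_from J rws js f (next_level J rws xs) = Some res'"
      and res: "res = map (snd \<circ> snd) (filter (good J js) xs) @ res'"
      using Suc.prems by auto
    have "(\<exists>t v z. (v, z, ws) \<in> set ((next_level J rws ^^ t) xs) \<and> good J js (v, z, ws)) \<longleftrightarrow>
        (\<exists>v z. (v, z, ws) \<in> set xs \<and> good J js (v, z, ws)) \<or>
        (\<exists>t v z. (v, z, ws) \<in> set ((next_level J rws ^^ t) (next_level J rws xs)) \<and> good J js (v, z, ws))"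
      (is "?l \<longleftrightarrow> ?r") for ws
    proof
      assume ?l
      then obtain t v z where t: "(v, z, ws) \<in> set ((next_level J rws ^^ t) xs)" "good J js (v, z, ws)"
        by blast
      show ?r
      proof (cases t)
        case 0
        then show ?thesis using t by auto
      next
        case (Suc t')
        then show ?thesis using t by (auto simp: funpow_swap1)
      qed
    next
      assume ?r
      then show ?l
      proof
        assume "\<exists>v z. (v, z, ws) \<in> set xs \<and> good J js (v, z, ws)"
        then show ?l by (intro exI[of _ 0]) simp
      next
        assume "\<exists>t v z. (v, z, ws) \<in> set ((next_level J rws ^^ t) (next_level J rws xs)) \<and> good J js (v, z, ws)"
        then obtain t v z where "(v, z, ws) \<in> set ((next_level J rws ^^ t) (next_level J rws xs))" "good J js (v, z, ws)"
          by blast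
        then show ?l by (intro exI[of _ "Suc t"]) (auto simp: funpow_swap1)
      qed
    qed
    then show ?thesis using Suc.IH[OF res'] by (auto simp: res image_iff)
  qed
qed

section \<open>Correctness of the enumeration for a system with a given Cartan matrix\<close>

locale cartan_system = simple_system R \<alpha> I
  for R :: "'a::real_inner set" and \<alpha> :: "nat \<Rightarrow> 'a" and I :: "nat set" +
  fixes J :: "nat list" and a :: "nat \<Rightarrow> nat \<Rightarrow> int"
  assumes distinct_J: "distinct J" and set_J: "set J = I"
    and cartan_eq: "\<And>k m. k \<in> I \<Longrightarrow> m \<in> I \<Longrightarrow> cartan k m = of_int (a k m)"
begin

lemma inv_reflection_comp:
  assumes "w \<in> W" "k \<in> I"
  shows "inv (s k \<circ> w) x = inv w (s k x)"
proof -
  have "inv (s k \<circ> w) = inv w \<circ> inv (s k)"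
    using assms weyl_group_bij reflection_in_weyl_group by (intro o_inv_distrib) blast+
  moreover have "inv (s k) = s k" by (rule inv_unique_comp) simp_all
  ultimately show ?thesis by simp
qed

lemma inv_reflection_comp_simple:
  assumes "w \<in> W" "k \<in> I"
  shows "inv (s k \<circ> w) (\<alpha> m) = inv w (\<alpha> m) - cartan k m *\<^sub>R inv w (\<alpha> k)"
  unfolding inv_reflection_comp[OF assms] reflection_simple
  using weyl_group_linear[OF weyl_group_inv[OF assms(1)]] by (simp add: linear_diff linear_cmul)

text \<open>What \<open>coord i\<close>, \<open>pairing i\<close> and \<open>height\<close> have in
  common: integral values on roots, and linearity on the span in the one form in which a simple
  reflection uses it.\<close>

definition linear_on_roots :: "('a \<Rightarrow> real) \<Rightarrow> bool" where
  "linear_on_roots \<phi> \<longleftrightarrow> (\<forall>x\<in>R. \<phi> x \<in> \<int>) \<and>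
     (\<forall>x\<in>span (\<alpha> ` I). \<forall>y\<in>span (\<alpha> ` I). \<forall>d. \<phi> (x - d *\<^sub>R y) = \<phi> x - d * \<phi> y)"

definition vals :: "('a \<Rightarrow> real) \<Rightarrow> ('a \<Rightarrow> 'a) \<Rightarrow> nat \<Rightarrow> int" where
  "vals \<phi> w m = \<lfloor>\<phi> (inv w (\<alpha> m))\<rfloor>"

lemma vals_eq:
  assumes "linear_on_roots \<phi>" "w \<in> W" "m \<in> I"
  shows "of_int (vals \<phi> w m) = \<phi> (inv w (\<alpha> m))"
proof -
  have "inv w (\<alpha> m) \<in> R" using assms weyl_root[OF weyl_group_inv simple_root] by blast
  then show ?thesis using assms(1) by (auto simp: vals_def linear_on_roots_def elim!: Ints_cases)
qed

lemma vals_reflection: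
  assumes "linear_on_roots \<phi>" "w \<in> W" "k \<in> I" "m \<in> I"
  shows "vals \<phi> (s k \<circ> w) m = vals \<phi> w m - a k m * vals \<phi> w k"
proof -
  have sw: "s k \<circ> w \<in> W" using assms by (intro weyl_group_comp reflection_in_weyl_group)
  have sp: "inv w (\<alpha> l) \<in> span (\<alpha> ` I)" if "l \<in> I" for l
    using weyl_span[OF weyl_group_inv[OF assms(2)] simple_in_span[OF that]] .
  have "real_of_int (vals \<phi> (s k \<circ> w) m) = of_int (vals \<phi> w m - a k m * vals \<phi> w k)"
    using assms sp sw cartan_eq
    by (simp add: vals_eq inv_reflection_comp_simple) (simp add: linear_on_roots_def)
  then show ?thesis by (simp only: of_int_eq_iff)
qed

lemma act_row_vals:
  assumes "linear_on_roots \<phi>" "w \<in> W" "k \<in> I"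
  shows "act_row (vals \<phi> w k) (map (a k) J) (map (vals \<phi> w) J) = map (vals \<phi> (s k \<circ> w)) J"
  using vals_reflection[OF assms] set_J
  by (auto simp: act_row_def zip_map_map zip_same_conv_map)

lemma linear_coord: "i \<in> I \<Longrightarrow> linear_on_roots (coord i)"
proof -
  assume i: "i \<in> I"
  have "coord i x \<in> \<int>" if "x \<in> R" for x
  proof (cases "x \<in> Pos")
    case True
    then show ?thesis using pos_coord_nat[OF True i] by auto
  next
    case False
    then have x: "- x \<in> Pos" using that pos_or_neg neg_iff by blast
    have "coord i x = - coord i (- x)" using coord_minus[OF pos_in_span[OF x], of i] by simp
    then show ?thesis using pos_coord_nat[OF x i] by auto
  qed
  then show ?thesis by (simp add: linear_on_roots_def coord_diff coord_scale span_scale)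
qed

definition pairing :: "nat \<Rightarrow> 'a \<Rightarrow> real" where
  "pairing i x = 2 * (x \<bullet> \<alpha> i) / (\<alpha> i \<bullet> \<alpha> i)"

lemma linear_pairing: "i \<in> I \<Longrightarrow> linear_on_roots (pairing i)"
  using cartan_integer[OF simple_root]
  by (auto simp: linear_on_roots_def pairing_def inner_diff_left diff_divide_distrib right_diff_distrib)

definition height :: "'a \<Rightarrow> real" where
  "height x = (\<Sum>i\<in>I. coord i x)"

lemma linear_height: "linear_on_roots height"
  using linear_coord
  by (auto simp: linear_on_roots_def height_def sum_subtractf sum_distrib_left intro!: Ints_sum)

lemma height_vector_eq:
  assumes "ws \<in> lists I"
  shows "height_vector a J ws = map (vals height (word_product \<alpha> ws)) J"
  using assms
proof (induction ws rule: list.induct)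
  case Nil
  have "vals height id m = 1" if "m \<in> I" for m
    using that finite_I by (simp add: vals_def height_def coord_simple inv_id)
  then have "height_vector a J [] = map (vals height (word_product \<alpha> [])) J"
    using set_J by (simp add: height_vector_def)
  then show ?case .
next
  case (Cons k ws)
  then have k: "k \<in> I" "ws \<in> lists I" by auto
  have "map_of (zip J (map (vals height (word_product \<alpha> ws)) J)) k = Some (vals height (word_product \<alpha> ws) k)"
    using k set_J by (simp add: map_of_zip_map)
  then have "height_vector a J (k # ws) = map (vals height (s k \<circ> word_product \<alpha> ws)) J"
    using Cons.IH[OF k(2)] act_row_vals[OF linear_height word_product_in_weyl_group[OF k(2)] k(1)]
    by (simp add: height_vector_def)
  then show ?case unfolding word_product_Cons .
qed

text \<open>By linearity, the height of \<open>inv w' (w (\<alpha> i))\<close> equals that of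
  \<open>inv w (w (\<alpha> i))\<close>, which is 1. So the image of every simple root under
  \<open>inv w' \<circ> w\<close> is positive.\<close>

lemma eq_if_heights_eq:
  assumes "w \<in> W" "w' \<in> W" "\<And>m. m \<in> I \<Longrightarrow> height (inv w (\<alpha> m)) = height (inv w' (\<alpha> m))"
  shows "w = w'"
proof -
  have u: "inv w' \<circ> w \<in> W" using assms by (intro weyl_group_comp weyl_group_inv)
  have lin: "height (v x) = (\<Sum>m\<in>I. coord m x * height (v (\<alpha> m)))" if v: "v \<in> W" and x: "x \<in> span (\<alpha> ` I)" for v x
  proof -
    have "height (v x) = (\<Sum>i\<in>I. \<Sum>m\<in>I. coord m x * coord i (v (\<alpha> m)))"
      by (simp add: height_def coord_weyl[OF v x])
    also have "\<dots> = (\<Sum>m\<in>I. \<Sum>i\<in>I. coord m x * coord i (v (\<alpha> m)))" by (rule sum.swap)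
    finally show ?thesis by (simp add: height_def sum_distrib_left)
  qed
  have "(inv w' \<circ> w) (\<alpha> i) \<in> Pos" if i: "i \<in> I" for i
  proof -
    have sp: "w (\<alpha> i) \<in> span (\<alpha> ` I)" by (rule weyl_span[OF assms(1) simple_in_span[OF i]])
    have "height (inv w' (w (\<alpha> i))) = height (inv w (w (\<alpha> i)))"
      using assms(3) by (simp add: lin[OF weyl_group_inv[OF assms(1)] sp] lin[OF weyl_group_inv[OF assms(2)] sp])
    also have "\<dots> = 1" using i finite_I by (simp add: weyl_group_inv_apply[OF assms(1)] height_def coord_simple)
    finally have h: "height (inv w' (w (\<alpha> i))) = 1" .
    have "(inv w' \<circ> w) (\<alpha> i) \<notin> Neg"
    proof
      assume "(inv w' \<circ> w) (\<alpha> i) \<in> Neg"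
      then have "height ((inv w' \<circ> w) (\<alpha> i)) \<le> 0"
        unfolding height_def by (intro sum_nonpos neg_coord_nonpos)
      then show False using h by simp
    qed
    then show ?thesis using weyl_not_pos[OF u simple_root[OF i]] by blast
  qed
  then have id: "inv w' \<circ> w = id" by (rule weyl_eq_id[OF u])
  show ?thesis
  proof
    fix x
    have "inv w' (w x) = x" using fun_cong[OF id, of x] by simp
    then show "w x = w' x" using weyl_group_inv_apply(2)[OF assms(2), of "w x"] by simp
  qed
qed

lemma word_product_eq_iff:
  assumes "ws \<in> lists I" "vs \<in> lists I"
  shows "word_product \<alpha> ws = word_product \<alpha> vs \<longleftrightarrow> height_vector a J ws = height_vector a J vs"
proof
  assume eq: "height_vector a J ws = height_vector a J vs"
  note W = word_product_in_weyl_group[OF assms(1), of \<alpha>] word_product_in_weyl_group[OF assms(2), of \<alpha>]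
  have "vals height (word_product \<alpha> ws) m = vals height (word_product \<alpha> vs) m" if "m \<in> I" for m
    using eq that set_J unfolding height_vector_eq[OF assms(1)] height_vector_eq[OF assms(2)] by simp
  then show "word_product \<alpha> ws = word_product \<alpha> vs"
    using vals_eq[OF linear_height W(1)] vals_eq[OF linear_height W(2)]
    by (intro eq_if_heights_eq W) metis
qed (simp add: height_vector_eq assms)

definition state_of :: "nat \<Rightarrow> nat list \<Rightarrow> enum_state" where
  "state_of i ws = (map (vals (coord i) (word_product \<alpha> ws)) J, map (vals (pairing i) (word_product \<alpha> ws)) J, ws)"

definition admissible :: "nat \<Rightarrow> nat list \<Rightarrow> bool" where
  "admissible i ws \<longleftrightarrow> ws \<in> lists I \<and> right_descents (word_product \<alpha> ws) \<subseteq> {i}"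

lemma state_of_Nil:
  assumes "i \<in> I"
  shows "state_of i [] = (map (\<lambda>m. if m = i then 1 else 0) J, map (a i) J, [])"
proof -
  have "vals (coord i) id m = (if m = i then 1 else 0)" "vals (pairing i) id m = a i m" if "m \<in> I" for m
  proof -
    show "vals (coord i) id m = (if m = i then 1 else 0)"
      using that assms by (simp add: vals_def coord_simple inv_id)
    have "pairing i (\<alpha> m) = of_int (a i m)"
      using cartan_eq[OF assms that] by (simp add: pairing_def cartan_def)
    then show "vals (pairing i) id m = a i m" by (simp add: vals_def inv_id)
  qed
  then show ?thesis using set_J by (simp add: state_of_def)
qed

lemma children_state_of:
  assumes "i \<in> I" "ws \<in> lists I"
  shows "children J (cartan_rows a J) (state_of i ws) =
    map (\<lambda>k. state_of i (k # ws)) (filter (\<lambda>k. 0 < vals (coord i) (word_product \<alpha> ws) k \<and>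
      (\<forall>m\<in>I. m < k \<longrightarrow> 0 \<le> vals (coord i) (word_product \<alpha> (k # ws)) m)) J)"
proof -
  define w where "w = word_product \<alpha> ws"
  define V Z where "V = vals (coord i) w" and "Z = vals (pairing i) w"
  have w: "w \<in> W" unfolding w_def by (rule word_product_in_weyl_group[OF assms(2)])
  have step: "child J (state_of i ws) ((k, map (a k) J), V k, Z k) =
      (if 0 < V k \<and> (\<forall>m\<in>I. m < k \<longrightarrow> 0 \<le> vals (coord i) (word_product \<alpha> (k # ws)) m)
       then [state_of i (k # ws)] else [])" if k: "k \<in> I" for k
  proof -
    have "canonical J k (map (vals (coord i) (s k \<circ> w)) J) \<longleftrightarrow>
        (\<forall>m\<in>I. m < k \<longrightarrow> 0 \<le> vals (coord i) (s k \<circ> w) m)"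
      using set_J by (auto simp: canonical_def list_all_iff zip_map2 zip_same_conv_map not_le)
    then show ?thesis
      using act_row_vals[OF linear_coord[OF assms(1)] w k] act_row_vals[OF linear_pairing[OF assms(1)] w k]
      by (simp add: child_def state_of_def V_def Z_def Let_def flip: w_def)
  qed
  have "zip (cartan_rows a J) (zip (map V J) (map Z J)) = map (\<lambda>k. ((k, map (a k) J), V k, Z k)) J"
    by (simp add: cartan_rows_def zip_map_map zip_same_conv_map)
  then have "children J (cartan_rows a J) (state_of i ws) =
      concat (map (\<lambda>k. child J (state_of i ws) ((k, map (a k) J), V k, Z k)) J)"
    unfolding children_def by (simp add: state_of_def comp_def flip: w_def V_def Z_def)
  also have "\<dots> = concat (map (\<lambda>k. if 0 < V k \<and> (\<forall>m\<in>I. m < k \<longrightarrow> 0 \<le> vals (coord i) (word_product \<alpha> (k # ws)) m)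
       then [state_of i (k # ws)] else []) J)"
    by (intro arg_cong[of _ _ concat] map_cong refl step) (simp add: set_J)
  finally show ?thesis
    unfolding V_def w_def by (simp only: concat_map_if_singleton)
qed

abbreviation "level i t \<equiv> (next_level J (cartan_rows a J) ^^ t) [state_of i []]"

lemma level_Suc: "set (level i (Suc t)) = (\<Union>st\<in>set (level i t). set (children J (cartan_rows a J) st))"
  by (simp add: next_level_def)

text \<open>The only positive root that \<open>s k\<close> makes negative is
  \<open>\<alpha> k\<close>, so a new right descent \<open>m\<close> would need
  \<open>w (\<alpha> m) = \<alpha> k\<close>.\<close>

lemma right_descents_reflection:
  assumes "w \<in> W" "k \<in> I" "right_descents w \<subseteq> {i}" "\<And>m. m \<in> I \<Longrightarrow> m \<noteq> i \<Longrightarrow> inv w (\<alpha> k) \<noteq> \<alpha> m"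
  shows "right_descents (s k \<circ> w) \<subseteq> {i}"
proof
  fix m assume m: "m \<in> right_descents (s k \<circ> w)"
  then have mI: "m \<in> I" "s k (w (\<alpha> m)) \<in> Neg" by (auto simp: right_descents_def)
  show "m \<in> {i}"
  proof (rule ccontr)
    assume mi: "m \<notin> {i}"
    then have "m \<notin> right_descents w" using assms(3) by blast
    then have "w (\<alpha> m) \<in> Pos"
      using mI weyl_not_pos[OF assms(1) simple_root[OF mI(1)]] by (auto simp: right_descents_def)
    then have "w (\<alpha> m) = \<alpha> k"
      using mI(2) reflection_pos[OF assms(2)] pos_not_neg by blast
    then have "inv w (\<alpha> k) = \<alpha> m" using weyl_group_inv_apply(1)[OF assms(1), of "\<alpha> m"] by simp
    then show False using assms(4) mI mi by blast
  qed
qed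

lemma level_sound:
  assumes "i \<in> I" "st \<in> set (level i t)"
  shows "\<exists>ws. st = state_of i ws \<and> admissible i ws"
  using assms(2)
proof (induction t arbitrary: st)
  case 0
  have "right_descents id = {}" using simple_pos pos_not_neg by (auto simp: right_descents_def)
  then have "admissible i []" by (simp add: admissible_def)
  then show ?case using 0 by auto
next
  case (Suc t)
  then obtain ws where ws: "st \<in> set (children J (cartan_rows a J) (state_of i ws))" "admissible i ws"
    unfolding level_Suc by fastforce
  define w where "w = word_product \<alpha> ws"
  have I: "ws \<in> lists I" "right_descents w \<subseteq> {i}" using ws by (auto simp: admissible_def w_def)
  have w: "w \<in> W" unfolding w_def by (rule word_product_in_weyl_group[OF I(1)])
  obtain k where k: "k \<in> I" "0 < vals (coord i) w k" "st = state_of i (k # ws)"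
    using ws set_J by (auto simp: children_state_of[OF assms(1) I(1)] w_def)
  \<comment> \<open>The simple roots other than \<open>\<alpha> i\<close> have \<open>i\<close>-th
    coordinate 0 and are excluded by this.\<close>
  have "0 < coord i (inv w (\<alpha> k))"
    using k(2) vals_eq[OF linear_coord[OF assms(1)] w k(1)] by linarith
  then have "right_descents (s k \<circ> w) \<subseteq> {i}"
    using assms(1) by (intro right_descents_reflection w k I) (auto simp: coord_simple)
  then have "admissible i (k # ws)" using k I by (simp add: admissible_def w_def)
  then show ?case using k(3) by blast
qed

text \<open>Induction on the length, stripping the smallest left descent \<open>k\<close>. The root
  \<open>- inv w (\<alpha> k)\<close> is positive and \<open>w\<close> maps it to
  \<open>- \<alpha> k\<close>, so its \<open>i\<close>-th coordinate is at least 1; this is the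
  condition under which the enumeration adds \<open>k\<close> to the shorter word.\<close>

lemma level_complete:
  assumes "i \<in> I" "w \<in> W" "right_descents w \<subseteq> {i}"
  shows "\<exists>ws\<in>lists I. word_product \<alpha> ws = w \<and> state_of i ws \<in> set (level i (ell w))"
  using assms(2,3)
proof (induction "ell w" arbitrary: w)
  case 0
  then have "w = id" using minimal_word_length[OF 0(2)] by auto
  then show ?case using 0(1) by (intro bexI[of _ "[]"]) simp_all
next
  case (Suc t)
  note w = Suc.prems(1)
  note w' = weyl_group_inv[OF w]
  have "right_descents (inv w) \<noteq> {}"
  proof
    assume "right_descents (inv w) = {}"
    then have "inv w (\<alpha> m) \<in> Pos" if "m \<in> I" for m
      using that weyl_not_pos[OF w' simple_root[OF that]] by (auto simp: right_descents_def)
    then have "inv w = id" by (rule weyl_eq_id[OF w'])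
    then have "ell w = ell id" using ell_inv[OF w] by simp
    then show False using Suc.hyps(2) ell_word_le[of "[]"] by simp
  qed
  moreover have "finite (right_descents (inv w))" using finite_I by (simp add: right_descents_def)
  ultimately obtain k where k: "k \<in> right_descents (inv w)" "\<And>m. m \<in> right_descents (inv w) \<Longrightarrow> k \<le> m"
    by (metis Min_in Min_le)
  have kI: "k \<in> I" "inv w (\<alpha> k) \<in> Neg" using k by (auto simp: right_descents_def)
  define v where "v = s k \<circ> w"
  have v: "v \<in> W" using w kI by (simp add: v_def weyl_group_comp reflection_in_weyl_group)
  have sv: "s k \<circ> v = w" by (simp add: v_def fun_eq_iff)
  have rd: "right_descents v \<subseteq> {i}"
    unfolding v_def using w kI Suc.prems(2) simple_pos pos_not_neg
    by (intro right_descents_reflection) auto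
  have inv_v: "inv v = inv w \<circ> s k"
    using inv_reflection_comp[OF w kI(1)] by (simp add: v_def fun_eq_iff)
  have "Suc (ell v) = ell w"
    using ell_comp_reflection_neg[OF w' kI] ell_inv[OF v] ell_inv[OF w] inv_v by simp
  then have t: "ell v = t" using Suc.hyps(2) by simp
  obtain ws where ws: "ws \<in> lists I" "word_product \<alpha> ws = v" "state_of i ws \<in> set (level i t)"
    using Suc.hyps(1)[OF t[symmetric] v rd] t by auto
  have "inv v (\<alpha> k) = - inv w (\<alpha> k)" by (simp add: inv_v weyl_minus[OF w'])
  then have "1 \<le> coord i (inv v (\<alpha> k))"
    using kI simple_pos[OF kI(1)]
    by (simp, intro coord_ge_1_if_unique_descent[OF w assms(1) Suc.prems(2)])
      (simp_all add: neg_iff weyl_minus[OF w] weyl_group_inv_apply[OF w])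
  then have "0 < vals (coord i) v k"
    using vals_eq[OF linear_coord[OF assms(1)] v kI(1)] by linarith
  moreover have "0 \<le> vals (coord i) (word_product \<alpha> (k # ws)) m" if m: "m \<in> I" "m < k" for m
  proof -
    have "m \<notin> right_descents (inv w)" using k(2)[of m] m by auto
    then have "inv w (\<alpha> m) \<in> Pos"
      using m weyl_not_pos[OF w' simple_root[OF m(1)]] by (auto simp: right_descents_def)
    then have "0 \<le> coord i (inv w (\<alpha> m))" using assms(1) pos_coord_nonneg by blast
    then show ?thesis using ws sv by (simp add: vals_def)
  qed
  ultimately have "state_of i (k # ws) \<in> set (children J (cartan_rows a J) (state_of i ws))"
    unfolding children_state_of[OF assms(1) ws(1)] using kI set_J ws(2) by auto
  then have "state_of i (k # ws) \<in> set (level i (Suc t))"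
    unfolding level_Suc using ws(3) by blast
  moreover have "k # ws \<in> lists I" "word_product \<alpha> (k # ws) = w" using kI ws sv by simp_all
  ultimately show ?case using Suc.hyps(2) by metis
qed

text \<open>A root \<open>inv w (\<alpha> m)\<close> is negative if and only if its
  \<open>i\<close>-th coordinate is, since \<open>i\<close> is the only possible right descent of
  \<open>w\<close>.\<close>

lemma good_state_of:
  assumes "i \<in> I" "admissible i ws" "set js \<subseteq> I"
  shows "good J js (state_of i ws) \<longleftrightarrow> (\<exists>j\<in>set js. right_descents (inv (word_product \<alpha> ws)) = {j} \<and>
    pairing i (inv (word_product \<alpha> ws) (\<alpha> j)) = 1)"
proof -
  define w where "w = word_product \<alpha> ws"
  have I: "ws \<in> lists I" "right_descents w \<subseteq> {i}" using assms by (auto simp: admissible_def w_def)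
  have w: "w \<in> W" unfolding w_def by (rule word_product_in_weyl_group[OF I(1)])
  note w' = weyl_group_inv[OF w]
  define V Z where "V = vals (coord i) w" and "Z = vals (pairing i) w"
  have neg: "V m < 0 \<longleftrightarrow> m \<in> right_descents (inv w)" if m: "m \<in> I" for m
  proof -
    have V: "of_int (V m) = coord i (inv w (\<alpha> m))"
      unfolding V_def by (rule vals_eq[OF linear_coord[OF assms(1)] w m])
    show ?thesis
    proof (cases "inv w (\<alpha> m) \<in> Neg")
      case True
      then have "1 \<le> coord i (- inv w (\<alpha> m))"
        using m simple_pos by (intro coord_ge_1_if_unique_descent[OF w assms(1) I(2)])
          (simp_all add: neg_iff weyl_minus[OF w] weyl_group_inv_apply[OF w])
      then have "coord i (inv w (\<alpha> m)) < 0"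
        using True by (simp add: coord_minus root_in_span neg_root)
      then show ?thesis using True m V by (simp add: right_descents_def flip: of_int_less_0_iff[where 'a = real])
    next
      case False
      then have "0 \<le> coord i (inv w (\<alpha> m))"
        using weyl_not_pos[OF w' simple_root[OF m]] pos_coord_nonneg assms(1) by blast
      then have "0 \<le> V m" using V by linarith
      then show ?thesis using False by (simp add: right_descents_def)
    qed
  qed
  define xs where "xs = filter (\<lambda>m. V m < 0) J"
  have xs: "set xs = right_descents (inv w)" "distinct xs"
    using neg set_J distinct_J by (auto simp: xs_def right_descents_def)
  have "filter (\<lambda>(m, x, y). x < 0) (zip J (zip (map V J) (map Z J))) = map (\<lambda>m. (m, V m, Z m)) xs"
    by (simp add: zip_map_pair filter_map comp_def xs_def)
  then have good: "good J js (state_of i ws) \<longleftrightarrow>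
      (case map (\<lambda>m. (m, V m, Z m)) xs of [(m, x, y)] \<Rightarrow> y = 1 \<and> m \<in> set js | _ \<Rightarrow> False)"
    unfolding good_def state_of_def V_def Z_def w_def by simp
  have Z1: "Z j = 1 \<longleftrightarrow> pairing i (inv w (\<alpha> j)) = 1" if "j \<in> I" for j
    using vals_eq[OF linear_pairing[OF assms(1)] w that] unfolding Z_def by linarith
  show ?thesis unfolding good w_def[symmetric]
  proof (cases xs)
    case Nil
    then show "(case map (\<lambda>m. (m, V m, Z m)) xs of [(m, x, y)] \<Rightarrow> y = 1 \<and> m \<in> set js | _ \<Rightarrow> False) \<longleftrightarrow>
      (\<exists>j\<in>set js. right_descents (inv w) = {j} \<and> pairing i (inv w (\<alpha> j)) = 1)" using xs by auto
  next
    case (Cons j ys)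
    show "(case map (\<lambda>m. (m, V m, Z m)) xs of [(m, x, y)] \<Rightarrow> y = 1 \<and> m \<in> set js | _ \<Rightarrow> False) \<longleftrightarrow>
      (\<exists>j\<in>set js. right_descents (inv w) = {j} \<and> pairing i (inv w (\<alpha> j)) = 1)"
    proof (cases ys)
      case Nil
      then have "right_descents (inv w) = {j}" using xs Cons by auto
      then show ?thesis using Cons Nil Z1 assms(3) by auto
    next
      case (Cons j' zs)
      then have "j \<noteq> j'" "{j, j'} \<subseteq> right_descents (inv w)" using xs \<open>xs = j # ys\<close> by auto
      have "right_descents (inv w) \<noteq> {l}" for l
      proof
        assume "right_descents (inv w) = {l}"
        with \<open>{j, j'} \<subseteq> right_descents (inv w)\<close> \<open>j \<noteq> j'\<close> show False by simp
      qed
      then show ?thesis using Cons \<open>xs = j # ys\<close> by simp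
    qed
  qed
qed

lemma unique_descent_words_correct:
  assumes "i \<in> I" "set js \<subseteq> I" "unique_descent_words a J js i = Some res"
  shows "set res \<subseteq> lists I"
    and "word_product \<alpha> ` set res = {w \<in> W. right_descents w = {i} \<and>
      (\<exists>j\<in>set js. right_descents (inv w) = {j} \<and> pairing i (inv w (\<alpha> j)) = 1)}"
proof -
  have res: "set res = {ws. \<exists>t v z. (v, z, ws) \<in> set (level i t) \<and> good J js (v, z, ws)}"
    using enumerate_from_Some assms(3) unfolding unique_descent_words_def state_of_Nil[OF assms(1)] .
  have ws: "admissible i ws \<and> good J js (state_of i ws)" if us: "ws \<in> set res" for ws
  proof -
    obtain t v z where t: "(v, z, ws) \<in> set (level i t)" "good J js (v, z, ws)" using us res by blast
    then obtain ws' where "(v, z, ws) = state_of i ws'" "admissible i ws'" using level_sound[OF assms(1)] by blast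
    moreover then have "ws' = ws" by (simp add: state_of_def)
    ultimately show ?thesis using t by simp
  qed
  then show "set res \<subseteq> lists I" by (auto simp: admissible_def)
  show "word_product \<alpha> ` set res = {w \<in> W. right_descents w = {i} \<and>
      (\<exists>j\<in>set js. right_descents (inv w) = {j} \<and> pairing i (inv w (\<alpha> j)) = 1)}" (is "_ = ?S")
  proof (intro equalityI subsetI)
    fix w assume "w \<in> word_product \<alpha> ` set res"
    then obtain us where us: "us \<in> set res" "w = word_product \<alpha> us" by blast
    have adm: "admissible i us" "good J js (state_of i us)" using ws[OF us(1)] by auto
    have w: "w \<in> W" using adm us by (simp add: admissible_def word_product_in_weyl_group)
    obtain j where j: "j \<in> set js" "right_descents (inv w) = {j}" "pairing i (inv w (\<alpha> j)) = 1"
      using adm good_state_of[OF assms(1) adm(1) assms(2)] us(2) by auto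
    have "right_descents w \<noteq> {}"
    proof
      assume e: "right_descents w = {}"
      have "w (\<alpha> m) \<in> Pos" if "m \<in> I" for m
        using e that weyl_not_pos[OF w simple_root[OF that]] by (auto simp: right_descents_def)
      then have "w = id" by (rule weyl_eq_id[OF w])
      then have "inv w = w" by (simp add: inv_id)
      then show False using j e by simp
    qed
    then have "right_descents w = {i}" using adm us by (auto simp: admissible_def)
    then show "w \<in> ?S" using w j by blast
  next
    fix w assume "w \<in> ?S"
    then obtain j where w: "w \<in> W" "right_descents w = {i}"
      and j: "j \<in> set js" "right_descents (inv w) = {j}" "pairing i (inv w (\<alpha> j)) = 1" by blast
    obtain us where us: "us \<in> lists I" "word_product \<alpha> us = w" "state_of i us \<in> set (level i (ell w))"
      using level_complete[OF assms(1) w(1)] w(2) by auto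
    have "admissible i us" using us w by (simp add: admissible_def)
    then have "good J js (state_of i us)" using good_state_of[OF assms(1) _ assms(2)] us j by auto
    then have "us \<in> set res"
      using us(3) unfolding res by (auto simp: state_of_def)
    then show "w \<in> word_product \<alpha> ` set res" using us by blast
  qed
qed

text \<open>For equal lengths the squared length of \<open>\<alpha> i + b\<close> is
  \<open>2 + pairing i b\<close> times that of \<open>\<alpha> i\<close>. Conversely, pairing -1
  makes the sum equal to \<open>s i b\<close>.\<close>

lemma sum_root_iff_pairing:
  assumes "i \<in> I" "b \<in> R" "b \<bullet> b = \<alpha> i \<bullet> \<alpha> i"
  shows "\<alpha> i + b \<in> R \<and> (\<alpha> i + b) \<bullet> (\<alpha> i + b) = \<alpha> i \<bullet> \<alpha> i \<longleftrightarrow> pairing i b = -1"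
proof -
  have n: "0 < \<alpha> i \<bullet> \<alpha> i" by (rule root_inner_pos[OF simple_root[OF assms(1)]])
  have p: "pairing i b * (\<alpha> i \<bullet> \<alpha> i) = 2 * (b \<bullet> \<alpha> i)" using n by (simp add: pairing_def)
  have sq: "(\<alpha> i + b) \<bullet> (\<alpha> i + b) = (2 + pairing i b) * (\<alpha> i \<bullet> \<alpha> i)"
    using p assms(3) by (simp add: inner_add_left inner_add_right inner_commute algebra_simps)
  show ?thesis
  proof
    assume "\<alpha> i + b \<in> R \<and> (\<alpha> i + b) \<bullet> (\<alpha> i + b) = \<alpha> i \<bullet> \<alpha> i"
    then have "(2 + pairing i b) * (\<alpha> i \<bullet> \<alpha> i) = 1 * (\<alpha> i \<bullet> \<alpha> i)" using sq by simp
    then have "2 + pairing i b = 1" using n by (simp only: mult_cancel_right) simp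
    then show "pairing i b = -1" by simp
  next
    assume b: "pairing i b = -1"
    then have "s i b = \<alpha> i + b" by (simp add: reflection_def pairing_def)
    then have "\<alpha> i + b \<in> R" using reflection_root[OF simple_root[OF assms(1)] assms(2)] by simp
    then show "\<alpha> i + b \<in> R \<and> (\<alpha> i + b) \<bullet> (\<alpha> i + b) = \<alpha> i \<bullet> \<alpha> i" using sq b by simp
  qed
qed

text \<open>\<open>S\<close> collects the nodes of admissible length and \<open>js i\<close> those
  with the length of \<open>\<alpha> i\<close>: as \<open>\<beta>\<close> is conjugate to
  \<open>- \<alpha> j\<close>, its length is that of \<open>\<alpha> j\<close>. The ends of the
  triple are determined by \<open>w\<close>, which the last conclusion makes explicit.\<close>

lemma minimal_NGTs_eq_words:
  assumes "S \<subseteq> I"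
    and js: "\<And>i. i \<in> S \<Longrightarrow> set (js i) = {j \<in> I. \<alpha> j \<bullet> \<alpha> j = \<alpha> i \<bullet> \<alpha> i}"
    and res: "\<And>i. i \<in> S \<Longrightarrow> unique_descent_words a J (js i) i = Some (res i)"
    and lc: "\<And>i b g. i \<in> I \<Longrightarrow> b \<in> R \<Longrightarrow> g \<in> R \<Longrightarrow> length_condition X R {b, g, \<alpha> i} \<longleftrightarrow>
       i \<in> S \<and> b \<bullet> b = \<alpha> i \<bullet> \<alpha> i \<and> g \<bullet> g = \<alpha> i \<bullet> \<alpha> i"
  shows "minimal_NGTs X R \<alpha> I = word_product \<alpha> ` (\<Union>i\<in>S. set (res i))"
    and "(\<Union>i\<in>S. set (res i)) \<subseteq> lists I"
    and "\<And>w i j. i \<in> S \<Longrightarrow> w \<in> word_product \<alpha> ` set (res i) \<Longrightarrow> right_descents (inv w) = {j} \<Longrightarrow>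
      minimal_NGT_triple X R \<alpha> I w (- inv w (\<alpha> j)) (\<alpha> i - inv w (\<alpha> j)) (\<alpha> i)"
proof -
  have words: "set (res i) \<subseteq> lists I" "word_product \<alpha> ` set (res i) = {w \<in> W. right_descents w = {i} \<and>
      (\<exists>j\<in>set (js i). right_descents (inv w) = {j} \<and> pairing i (inv w (\<alpha> j)) = 1)}" if i: "i \<in> S" for i
    using i assms(1) js[OF i] by (intro unique_descent_words_correct[OF _ _ res[OF i]]; blast)+
  show "(\<Union>i\<in>S. set (res i)) \<subseteq> lists I" using words(1) by blast
  have triple: "minimal_NGT_triple X R \<alpha> I w b g a' \<longleftrightarrow> (\<exists>i\<in>S. \<exists>j\<in>set (js i). w \<in> W \<and> right_descents w = {i} \<and>
      right_descents (inv w) = {j} \<and> pairing i (inv w (\<alpha> j)) = 1 \<and> b = - inv w (\<alpha> j) \<and> a' = \<alpha> i \<and> g = \<alpha> i + b)"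
    for w b g a'
  proof -
    have key: "g = \<alpha> i + b \<and> g \<in> R \<and> length_condition X R {b, g, \<alpha> i} \<and> w b = - \<alpha> j \<longleftrightarrow>
        i \<in> S \<and> j \<in> set (js i) \<and> pairing i (inv w (\<alpha> j)) = 1 \<and> b = - inv w (\<alpha> j) \<and> g = \<alpha> i + b"
      if w: "w \<in> W" and ij: "i \<in> I" "j \<in> I" for i j
    proof -
      note w' = weyl_group_inv[OF w]
      have wb: "w b = - \<alpha> j \<longleftrightarrow> b = - inv w (\<alpha> j)"
        using weyl_group_inv_apply[OF w] weyl_minus[OF w] weyl_minus[OF w'] by metis
      show ?thesis
      proof (cases "b = - inv w (\<alpha> j) \<and> g = \<alpha> i + b")
        case True
        have bR: "b \<in> R" using True uminus_root[OF weyl_root[OF w' simple_root[OF ij(2)]]] by simp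
        have bb: "b \<bullet> b = \<alpha> j \<bullet> \<alpha> j" using True weyl_group_inner[OF w'] by simp
        have pb: "pairing i b = - pairing i (inv w (\<alpha> j))" using True by (simp add: pairing_def)
        have "g \<in> R \<and> length_condition X R {b, g, \<alpha> i} \<longleftrightarrow>
            i \<in> S \<and> \<alpha> j \<bullet> \<alpha> j = \<alpha> i \<bullet> \<alpha> i \<and> pairing i (inv w (\<alpha> j)) = 1"
          using lc[OF ij(1) bR, of g] sum_root_iff_pairing[OF ij(1) bR] True bb pb by auto
        then show ?thesis using True wb js ij by auto
      next
        case False
        then show ?thesis using wb by blast
      qed
    qed
    have jI: "j \<in> I" if "i \<in> S" "j \<in> set (js i)" for i j using js that by blast
    show ?thesis unfolding minimal_NGT_triple_iff
    proof
      assume "w \<in> W \<and> g = a' + b \<and> g \<in> R \<and> length_condition X R {b, g, a'} \<and>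
        (\<exists>i\<in>I. \<exists>j\<in>I. right_descents w = {i} \<and> right_descents (inv w) = {j} \<and> a' = \<alpha> i \<and> w b = - \<alpha> j)"
      then obtain i j where "w \<in> W" "i \<in> I" "j \<in> I" "right_descents w = {i}" "right_descents (inv w) = {j}"
        "a' = \<alpha> i" "g = \<alpha> i + b \<and> g \<in> R \<and> length_condition X R {b, g, \<alpha> i} \<and> w b = - \<alpha> j" by blast
      then show "\<exists>i\<in>S. \<exists>j\<in>set (js i). w \<in> W \<and> right_descents w = {i} \<and>
        right_descents (inv w) = {j} \<and> pairing i (inv w (\<alpha> j)) = 1 \<and> b = - inv w (\<alpha> j) \<and> a' = \<alpha> i \<and> g = \<alpha> i + b"
        using key by blast
    next
      assume "\<exists>i\<in>S. \<exists>j\<in>set (js i). w \<in> W \<and> right_descents w = {i} \<and>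
        right_descents (inv w) = {j} \<and> pairing i (inv w (\<alpha> j)) = 1 \<and> b = - inv w (\<alpha> j) \<and> a' = \<alpha> i \<and> g = \<alpha> i + b"
      then obtain i j where ij: "i \<in> S" "j \<in> set (js i)" and w: "w \<in> W" "right_descents w = {i}"
        "right_descents (inv w) = {j}" "a' = \<alpha> i"
        and p: "pairing i (inv w (\<alpha> j)) = 1 \<and> b = - inv w (\<alpha> j) \<and> g = \<alpha> i + b" by blast
      have "i \<in> I" "j \<in> I" using ij assms(1) jI by auto
      then show "w \<in> W \<and> g = a' + b \<and> g \<in> R \<and> length_condition X R {b, g, a'} \<and>
        (\<exists>i\<in>I. \<exists>j\<in>I. right_descents w = {i} \<and> right_descents (inv w) = {j} \<and> a' = \<alpha> i \<and> w b = - \<alpha> j)"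
        using key[OF w(1)] ij w p by blast
    qed
  qed
  have "w \<in> minimal_NGTs X R \<alpha> I \<longleftrightarrow> (\<exists>i\<in>S. \<exists>j\<in>set (js i). w \<in> W \<and> right_descents w = {i} \<and>
      right_descents (inv w) = {j} \<and> pairing i (inv w (\<alpha> j)) = 1)" for w
    unfolding minimal_NGTs_def triple by blast
  then show "minimal_NGTs X R \<alpha> I = word_product \<alpha> ` (\<Union>i\<in>S. set (res i))"
    unfolding image_UN using words(2) by auto
  fix w i j assume i: "i \<in> S" and w: "w \<in> word_product \<alpha> ` set (res i)" "right_descents (inv w) = {j}"
  then obtain j' where "j' \<in> set (js i)" "w \<in> W" "right_descents w = {i}" "right_descents (inv w) = {j'}"
    "pairing i (inv w (\<alpha> j')) = 1"
    using words(2)[OF i] by blast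
  moreover then have "j' = j" using w(2) by simp
  ultimately show "minimal_NGT_triple X R \<alpha> I w (- inv w (\<alpha> j)) (\<alpha> i - inv w (\<alpha> j)) (\<alpha> i)"
    unfolding triple using i by (intro bexI[of _ i] bexI[of _ j]) simp_all
qed

end

section \<open>Subsystems and relabelling\<close>

context simple_system begin

lemma span_subset_coord:
  assumes "J \<subseteq> I" "x \<in> span (\<alpha> ` J)"
  shows "x = (\<Sum>j\<in>J. coord j x *\<^sub>R \<alpha> j)" and "\<And>i. i \<in> I - J \<Longrightarrow> coord i x = 0"
proof -
  have fin: "finite J" and inj: "inj_on \<alpha> J"
    by (rule finite_subset[OF assms(1) finite_I], rule inj_on_subset[OF inj_simple assms(1)])
  obtain u where "x = (\<Sum>y\<in>\<alpha> ` J. u y *\<^sub>R y)"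
    using assms(2) fin by (auto simp: span_finite)
  then have "x = (\<Sum>j\<in>J. u (\<alpha> j) *\<^sub>R \<alpha> j)" by (simp add: sum.reindex[OF inj])
  also have "\<dots> = (\<Sum>i\<in>I. (if i \<in> J then u (\<alpha> i) else 0) *\<^sub>R \<alpha> i)"
    using assms(1) finite_I by (intro sum.mono_neutral_cong_left) auto
  finally have x: "x = (\<Sum>i\<in>I. (if i \<in> J then u (\<alpha> i) else 0) *\<^sub>R \<alpha> i)" .
  have c: "coord i x = (if i \<in> J then u (\<alpha> i) else 0)" if "i \<in> I" for i
    by (subst x) (rule coord_combination[OF that])
  then show "\<And>i. i \<in> I - J \<Longrightarrow> coord i x = 0" by simp
  have "(\<Sum>j\<in>J. u (\<alpha> j) *\<^sub>R \<alpha> j) = (\<Sum>j\<in>J. coord j x *\<^sub>R \<alpha> j)"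
    using c assms(1) by (intro sum.cong) auto
  then show "x = (\<Sum>j\<in>J. coord j x *\<^sub>R \<alpha> j)" using \<open>x = (\<Sum>j\<in>J. u (\<alpha> j) *\<^sub>R \<alpha> j)\<close> by simp
qed

text \<open>A root in the span of the chosen simple roots has no other coordinates, so its sign in
  the subsystem is its sign in \<open>R\<close>.\<close>

lemma simple_system_subsystem:
  assumes "J \<subseteq> I"
  shows "simple_system (subsystem R \<alpha> J) \<alpha> J"
proof
  let ?Q = "subsystem R \<alpha> J"
  have sub: "?Q \<subseteq> R" by (auto simp: subsystem_def)
  have refl: "reflection a x \<in> ?Q" if "a \<in> ?Q" "x \<in> ?Q" for a x
    using that reflection_root by (auto simp: subsystem_def reflection_def intro: span_diff span_scale)
  have "reflection a ` ?Q = ?Q" if "a \<in> ?Q" for a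
  proof
    show "reflection a ` ?Q \<subseteq> ?Q" using refl that by blast
    show "?Q \<subseteq> reflection a ` ?Q" using refl[OF that] by (metis image_eqI reflection_involution subsetI)
  qed
  moreover have "finite ?Q" "0 \<notin> ?Q" using sub finite_R zero_not_root finite_subset by auto
  moreover have "2 * (b \<bullet> a) / (a \<bullet> a) \<in> \<int>" if "a \<in> ?Q" "b \<in> ?Q" for a b
    using that sub by (intro cartan_integer) auto
  ultimately show "root_system ?Q" unfolding root_system_def by simp
  show "reduced_system ?Q" using reduced_system sub unfolding reduced_system_def by blast
  have pos: "x \<in> pos_roots ?Q \<alpha> J" if x: "x \<in> ?Q" "x \<in> Pos" for x
  proof -
    have "\<forall>j\<in>J. \<exists>m::nat. coord j x = real m" using pos_coord_nat[OF x(2)] assms by blast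
    then obtain f where f: "\<forall>j\<in>J. coord j x = real (f j)" by metis
    have "x = (\<Sum>j\<in>J. coord j x *\<^sub>R \<alpha> j)"
      using x by (intro span_subset_coord(1)[OF assms]) (simp add: subsystem_def)
    also have "\<dots> = (\<Sum>j\<in>J. real (f j) *\<^sub>R \<alpha> j)" using f by simp
    finally show ?thesis using x by (auto simp: pos_roots_def)
  qed
  have "?Q \<subseteq> pos_roots ?Q \<alpha> J \<union> neg_roots ?Q \<alpha> J"
  proof
    fix x assume x: "x \<in> ?Q"
    show "x \<in> pos_roots ?Q \<alpha> J \<union> neg_roots ?Q \<alpha> J"
    proof (cases "x \<in> Pos")
      case False
      then have "- x \<in> Pos" using x sub pos_or_neg neg_iff by blast
      moreover have "- x \<in> ?Q" using x uminus_root by (simp add: subsystem_def span_neg)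
      ultimately have "- x \<in> pos_roots ?Q \<alpha> J" by (rule pos[rotated])
      then show ?thesis unfolding neg_roots_def by (intro UnI2 image_eqI[of x uminus "- x"]) simp_all
    qed (use pos x in blast)
  qed
  moreover have "pos_roots ?Q \<alpha> J \<union> neg_roots ?Q \<alpha> J \<subseteq> ?Q"
    using uminus_root by (auto simp: neg_roots_def pos_roots_def subsystem_def span_neg)
  moreover have "\<alpha> ` J \<subseteq> ?Q" using assms simple_root by (auto simp: subsystem_def span_base)
  moreover have "independent (\<alpha> ` J)"
    by (rule independent_mono[OF independent_simple image_mono[OF assms]])
  moreover have "finite J" "inj_on \<alpha> J"
    by (rule finite_subset[OF assms finite_I], rule inj_on_subset[OF inj_simple assms])
  ultimately show "simple_roots ?Q \<alpha> J" unfolding simple_roots_def by blast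
qed

text \<open>Bourbaki coordinates number the simple roots of a D5 subsystem by \<open>{1..5}\<close>,
  which differs from the numbering inherited from E6. Minimal NGTs depend only on the set of simple
  roots.\<close>

lemma relabelled:
  assumes "inj_on p K" "p ` K = I"
  shows "pos_roots R (\<lambda>k. \<alpha> (p k)) K = Pos" and "simple_system R (\<lambda>k. \<alpha> (p k)) K"
    and "minimal_NGTs X R (\<lambda>k. \<alpha> (p k)) K = minimal_NGTs X R \<alpha> I"
proof -
  let ?\<alpha> = "\<lambda>k. \<alpha> (p k)"
  have sum: "(\<Sum>k\<in>K. f (p k)) = (\<Sum>i\<in>I. f i)" for f :: "nat \<Rightarrow> 'a"
    using sum.reindex[OF assms(1), of f] assms(2) by (simp add: comp_def)
  show pos: "pos_roots R ?\<alpha> K = Pos"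
  proof (intro equalityI subsetI)
    fix r assume "r \<in> pos_roots R ?\<alpha> K"
    then obtain f :: "nat \<Rightarrow> nat" where r: "r \<in> R" "r = (\<Sum>k\<in>K. real (f k) *\<^sub>R \<alpha> (p k))"
      by (auto simp: pos_roots_def)
    have "r = (\<Sum>k\<in>K. real (f (inv_into K p (p k))) *\<^sub>R \<alpha> (p k))"
      unfolding r(2) using inv_into_f_f[OF assms(1)] by (intro sum.cong) auto
    also have "\<dots> = (\<Sum>i\<in>I. real (f (inv_into K p i)) *\<^sub>R \<alpha> i)"
      by (rule sum[of "\<lambda>i. real (f (inv_into K p i)) *\<^sub>R \<alpha> i"])
    finally show "r \<in> Pos" using r(1) unfolding pos_roots_def
      by (intro CollectI conjI exI[of _ "\<lambda>i. f (inv_into K p i)"])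
  next
    fix r assume "r \<in> Pos"
    then obtain f :: "nat \<Rightarrow> nat" where r: "r \<in> R" "r = (\<Sum>i\<in>I. real (f i) *\<^sub>R \<alpha> i)"
      by (auto simp: pos_roots_def)
    have "r = (\<Sum>k\<in>K. real (f (p k)) *\<^sub>R \<alpha> (p k))"
      unfolding r(2) by (rule sum[symmetric])
    then show "r \<in> pos_roots R ?\<alpha> K" using r(1) unfolding pos_roots_def
      by (intro CollectI conjI exI[of _ "\<lambda>k. f (p k)"])
  qed
  then have neg: "neg_roots R ?\<alpha> K = Neg" by (simp add: neg_roots_def)
  have img: "?\<alpha> ` K = \<alpha> ` I" using assms(2) by (metis image_image)
  have "finite K" using assms finite_I finite_imageD by blast
  moreover have "inj_on ?\<alpha> K"
    using comp_inj_on[OF assms(1)] inj_simple assms(2) by (simp add: comp_def)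
  moreover have "R = pos_roots R ?\<alpha> K \<union> neg_roots R ?\<alpha> K" unfolding pos neg by (rule roots_eq)
  ultimately have "simple_roots R ?\<alpha> K"
    using simple_root independent_simple unfolding simple_roots_def img by blast
  then show sys: "simple_system R ?\<alpha> K" by unfold_locales (rule root_system reduced_system)+
  interpret K: simple_system R ?\<alpha> K by (rule sys)
  have word: "word_product ?\<alpha> ws = word_product \<alpha> (map p ws)" for ws
    by (simp add: word_product_def comp_def)
  have W: "weyl_group ?\<alpha> K = W"
  proof -
    have "lists I = map p ` lists K" unfolding assms(2)[symmetric] by (rule lists_image)
    then show ?thesis unfolding weyl_group_def word by (simp add: image_image)
  qed
  have rd: "K.right_descents w = {k} \<longleftrightarrow> right_descents w = {p k}" if k: "k \<in> K" for w k
  proof -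
    have "right_descents w = p ` K.right_descents w"
      using assms(2) by (auto simp: right_descents_def K.right_descents_def neg)
    moreover have "K.right_descents w \<subseteq> K" by (auto simp: K.right_descents_def)
    ultimately show ?thesis
      using inj_on_image_eq_iff[OF assms(1), of "K.right_descents w" "{k}"] k by simp
  qed
  have "minimal_NGT_triple X R ?\<alpha> K w b g a \<longleftrightarrow> minimal_NGT_triple X R \<alpha> I w b g a" for w b g a
    unfolding K.minimal_NGT_triple_iff minimal_NGT_triple_iff W using rd by (auto simp flip: assms(2))
  then show "minimal_NGTs X R ?\<alpha> K = minimal_NGTs X R \<alpha> I" by (simp add: minimal_NGTs_def)
qed

lemma root_norm_simple: "r \<in> R \<Longrightarrow> \<exists>i\<in>I. r \<bullet> r = \<alpha> i \<bullet> \<alpha> i"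
  using root_conjugate_simple weyl_group_inner by metis

end

section \<open>Coefficient lists\<close>

text \<open>A datum \<open>(cs, us, i)\<close> presents the root with coefficients \<open>cs\<close> as the image of \<open>\<alpha> i\<close> under
  the product of the word \<open>us\<close>.\<close>

type_synonym root_datum = "nat list \<times> nat list \<times> nat"

text \<open>The action of \<open>s k\<close> on coefficient lists: only the coefficient of
  \<open>\<alpha> k\<close> changes, and it stands at position \<open>k - 1\<close>.\<close>

definition coeff_step :: "(nat \<Rightarrow> nat \<Rightarrow> int) \<Rightarrow> nat \<Rightarrow> int list \<Rightarrow> int list" where
  "coeff_step a k cs =
     cs[k - 1 := cs ! (k - 1) - sum_list (map2 (*) (map (a k) [1..<Suc (length cs)]) cs)]"

definition unit_coeffs :: "nat \<Rightarrow> nat \<Rightarrow> int list" where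
  "unit_coeffs n i = map (\<lambda>m. if m = i then 1 else 0) [1..<Suc n]"

text \<open>The reflection in the image of \<open>\<alpha> i\<close> under a word is the conjugate
  of \<open>s i\<close> by that word.\<close>

definition datum_word :: "root_datum \<Rightarrow> nat list" where
  "datum_word d = (case d of (cs, us, i) \<Rightarrow> us @ [i] @ rev us)"

definition check_datum :: "(nat \<Rightarrow> nat \<Rightarrow> int) \<Rightarrow> nat \<Rightarrow> root_datum \<Rightarrow> bool" where
  "check_datum a n d = (case d of (cs, us, i) \<Rightarrow> length cs = n \<and> list_all (\<lambda>k. 1 \<le> k \<and> k \<le> n) (i # us) \<and>
     run (coeff_step a) (rev us) (unit_coeffs n i) = map int cs)"

text \<open>Two roots are orthogonal if the reflection of the first fixes the second.\<close>

definition check_orthogonal :: "(nat \<Rightarrow> nat \<Rightarrow> int) \<Rightarrow> root_datum \<Rightarrow> root_datum \<Rightarrow> bool" where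
  "check_orthogonal a d e \<longleftrightarrow> run (coeff_step a) (rev (datum_word d)) (map int (fst e)) = map int (fst e)"

definition check_product :: "(nat \<Rightarrow> nat \<Rightarrow> int) \<Rightarrow> nat \<Rightarrow> root_datum list \<Rightarrow> bool" where
  "check_product a n ds \<longleftrightarrow> list_all (check_datum a n) ds \<and> sorted_wrt (check_orthogonal a) ds"

definition product_word :: "root_datum list \<Rightarrow> nat list" where
  "product_word ds = concat (map datum_word ds)"

definition root_of_ints :: "(nat \<Rightarrow> 'a::real_inner) \<Rightarrow> int list \<Rightarrow> 'a" where
  "root_of_ints \<alpha> cs = (\<Sum>k<length cs. of_int (cs ! k) *\<^sub>R \<alpha> (k + 1))"

lemma root_of_coeffs_eq: "root_of_coeffs \<alpha> cs = root_of_ints \<alpha> (map int cs)"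
  by (simp add: root_of_coeffs_def root_of_ints_def)

lemma length_coeff_step [simp]: "length (coeff_step a k cs) = length cs"
  by (simp add: coeff_step_def)

lemma sum_list_map2: "length xs = length ys \<Longrightarrow> sum_list (map2 f xs ys) = (\<Sum>k<length ys. f (xs ! k) (ys ! k))"
  by (simp add: sum_list_sum_nth atLeast0LessThan)

section \<open>Coefficient lists as roots, and the checks on products of reflections\<close>

locale standard_cartan_system = cartan_system R \<alpha> "{1..n}" "[1..<Suc n]" a
  for R :: "'a::real_inner set" and \<alpha> :: "nat \<Rightarrow> 'a" and n :: nat and a :: "nat \<Rightarrow> nat \<Rightarrow> int"
begin

lemma reflection_root_of_ints:
  assumes "length cs = n" "k \<in> {1..n}"
  shows "s k (root_of_ints \<alpha> cs) = root_of_ints \<alpha> (coeff_step a k cs)"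
proof -
  define d where "d = sum_list (map2 (*) (map (a k) [1..<Suc (length cs)]) cs)"
  have "d = (\<Sum>m<n. a k (m + 1) * cs ! m)"
    using assms(1) unfolding d_def by (subst sum_list_map2) (auto intro!: sum.cong simp: add.commute simp del: upt_Suc)
  then have d: "of_int d = (\<Sum>m<n. of_int (cs ! m) * cartan k (m + 1))"
    using assms(2) by (simp add: cartan_eq mult.commute)
  have "s k (root_of_ints \<alpha> cs) = (\<Sum>m<n. of_int (cs ! m) *\<^sub>R s k (\<alpha> (m + 1)))"
    using assms(1) linear_reflection[of "\<alpha> k"]
    by (simp add: root_of_ints_def linear_sum linear_cmul)
  also have "\<dots> = root_of_ints \<alpha> cs - of_int d *\<^sub>R \<alpha> k"
    unfolding d root_of_ints_def using assms(1)
    by (simp add: reflection_simple scaleR_diff_right sum_subtractf scaleR_sum_left)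
  also have "root_of_ints \<alpha> (coeff_step a k cs) = root_of_ints \<alpha> cs - of_int d *\<^sub>R \<alpha> k"
  proof -
    have "root_of_ints \<alpha> (coeff_step a k cs)
        = (\<Sum>m<n. of_int (cs ! m) *\<^sub>R \<alpha> (m + 1) - (if m = k - 1 then of_int d *\<^sub>R \<alpha> k else 0))"
      using assms unfolding root_of_ints_def coeff_step_def d_def[symmetric]
      by (auto intro!: sum.cong simp: nth_list_update scaleR_diff_left)
    also have "\<dots> = root_of_ints \<alpha> cs - (\<Sum>m<n. if m = k - 1 then of_int d *\<^sub>R \<alpha> k else 0)"
      using assms by (simp add: sum_subtractf root_of_ints_def)
    also have "(\<Sum>m<n. if m = k - 1 then of_int d *\<^sub>R \<alpha> k else 0) = of_int d *\<^sub>R \<alpha> k"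
      using assms by (subst sum.delta) auto
    finally show ?thesis .
  qed
  finally show ?thesis by simp
qed

lemma word_product_root_of_ints:
  assumes "length cs = n" "us \<in> lists {1..n}"
  shows "word_product \<alpha> us (root_of_ints \<alpha> cs) = root_of_ints \<alpha> (run (coeff_step a) (rev us) cs)"
proof -
  have len: "length (run (coeff_step a) (rev vs) cs) = n" for vs
    by (induction vs) (simp_all add: assms(1))
  from assms(2) show ?thesis
    by (induction us rule: list.induct) (simp_all add: reflection_root_of_ints len)
qed

lemma root_of_ints_unit: "i \<in> {1..n} \<Longrightarrow> root_of_ints \<alpha> (unit_coeffs n i) = \<alpha> i"
proof -
  assume i: "i \<in> {1..n}"
  have "root_of_ints \<alpha> (unit_coeffs n i) = (\<Sum>m<n. if m = i - 1 then \<alpha> i else 0)"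
    unfolding root_of_ints_def
  proof (intro sum.cong)
    fix m assume "m \<in> {..<n}"
    then have "unit_coeffs n i ! m = (if m = i - 1 then 1 else 0)"
      using i by (auto simp: unit_coeffs_def simp del: upt_Suc)
    then show "of_int (unit_coeffs n i ! m) *\<^sub>R \<alpha> (m + 1) = (if m = i - 1 then \<alpha> i else 0)"
      using i by simp
  qed (simp add: unit_coeffs_def)
  then show ?thesis using i by auto
qed

lemma check_datum_root:
  assumes "check_datum a n (cs, us, i)"
  shows "i \<in> {1..n}" "us \<in> lists {1..n}" "length cs = n" "root_of_coeffs \<alpha> cs = word_product \<alpha> us (\<alpha> i)"
proof -
  show i: "i \<in> {1..n}" "us \<in> lists {1..n}" "length cs = n"
    using assms by (auto simp: check_datum_def list_all_iff)
  have "length (unit_coeffs n i) = n" by (simp add: unit_coeffs_def)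
  from word_product_root_of_ints[OF this i(2)]
  show "root_of_coeffs \<alpha> cs = word_product \<alpha> us (\<alpha> i)"
    using assms root_of_ints_unit[OF i(1)] by (simp add: root_of_coeffs_eq check_datum_def)
qed

lemma check_datum_reflection:
  assumes "check_datum a n d"
  shows "root_of_coeffs \<alpha> (fst d) \<in> R" and "datum_word d \<in> lists {1..n}"
    and "reflection (root_of_coeffs \<alpha> (fst d)) = word_product \<alpha> (datum_word d)"
proof -
  obtain cs us i where d: "d = (cs, us, i)" by (cases d)
  note c = check_datum_root[OF assms[unfolded d]]
  have us: "word_product \<alpha> us \<in> W" by (rule word_product_in_weyl_group[OF c(2)])
  show "root_of_coeffs \<alpha> (fst d) \<in> R"
    using weyl_root[OF us simple_root[OF c(1)]] c(4) by (simp add: d)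
  show "datum_word d \<in> lists {1..n}" using c by (simp add: d datum_word_def in_lists_conv_set)
  show "reflection (root_of_coeffs \<alpha> (fst d)) = word_product \<alpha> (datum_word d)"
    using c(4) reflection_conjugate[OF us]
    by (simp add: d datum_word_def word_product_append o_assoc)
qed

lemma check_orthogonal:
  assumes "check_datum a n d" "check_datum a n e" "check_orthogonal a d e"
  shows "orthogonal (root_of_coeffs \<alpha> (fst d)) (root_of_coeffs \<alpha> (fst e))"
proof -
  let ?r = "root_of_coeffs \<alpha> (fst d)" and ?q = "root_of_coeffs \<alpha> (fst e)"
  have len: "length (map int (fst e)) = n" using assms(2) by (auto simp: check_datum_def split: prod.splits)
  have "reflection ?r ?q = word_product \<alpha> (datum_word d) (root_of_ints \<alpha> (map int (fst e)))"
    by (simp only: check_datum_reflection(3)[OF assms(1)] root_of_coeffs_eq[of \<alpha> "fst e"])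
  then have "reflection ?r ?q = ?q"
    using assms(3) word_product_root_of_ints[OF len check_datum_reflection(2)[OF assms(1)]]
    by (simp add: root_of_coeffs_eq[of \<alpha> "fst e"] check_orthogonal_def)
  then have "(2 * (?q \<bullet> ?r) / (?r \<bullet> ?r)) *\<^sub>R ?r = 0" by (simp add: reflection_def)
  moreover have "0 < ?r \<bullet> ?r" by (rule root_inner_pos[OF check_datum_reflection(1)[OF assms(1)]])
  ultimately show ?thesis by (auto simp: orthogonal_def inner_commute)
qed

lemma check_product:
  assumes "check_product a n ds"
  shows "set (map (\<lambda>d. root_of_coeffs \<alpha> (fst d)) ds) \<subseteq> R"
    and "sorted_wrt orthogonal (map (\<lambda>d. root_of_coeffs \<alpha> (fst d)) ds)"
    and "reflection_product (map (\<lambda>d. root_of_coeffs \<alpha> (fst d)) ds) = word_product \<alpha> (product_word ds)"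
    and "product_word ds \<in> lists {1..n}"
proof -
  have "set (map (\<lambda>d. root_of_coeffs \<alpha> (fst d)) ds) \<subseteq> R \<and>
    sorted_wrt orthogonal (map (\<lambda>d. root_of_coeffs \<alpha> (fst d)) ds) \<and>
    reflection_product (map (\<lambda>d. root_of_coeffs \<alpha> (fst d)) ds) = word_product \<alpha> (product_word ds) \<and>
    product_word ds \<in> lists {1..n}"
    using assms
  proof (induction ds)
    case (Cons d ds)
    then have d: "check_datum a n d" and ds: "check_product a n ds"
      by (simp_all add: check_product_def)
    have "orthogonal (root_of_coeffs \<alpha> (fst d)) (root_of_coeffs \<alpha> (fst e))" if "e \<in> set ds" for e
      using Cons.prems that by (intro check_orthogonal[OF d]) (auto simp: check_product_def list_all_iff)
    moreover have "reflection_product (map (\<lambda>d. root_of_coeffs \<alpha> (fst d)) (d # ds)) = word_product \<alpha> (product_word (d # ds))"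
      using Cons.IH[OF ds] check_datum_reflection(3)[OF d] by (simp add: product_word_def word_product_append)
    moreover have "product_word (d # ds) \<in> lists {1..n}"
      using Cons.IH[OF ds] check_datum_reflection(2)[OF d] by (simp add: product_word_def)
    ultimately show ?case using Cons.IH[OF ds] check_datum_reflection(1)[OF d] by simp
  qed (simp add: product_word_def)
  then show "set (map (\<lambda>d. root_of_coeffs \<alpha> (fst d)) ds) \<subseteq> R"
    "sorted_wrt orthogonal (map (\<lambda>d. root_of_coeffs \<alpha> (fst d)) ds)"
    "reflection_product (map (\<lambda>d. root_of_coeffs \<alpha> (fst d)) ds) = word_product \<alpha> (product_word ds)"
    "product_word ds \<in> lists {1..n}" by blast+
qed

section \<open>Comparing sets of group elements through height vectors\<close>

abbreviation "hv \<equiv> height_vector a [1..<Suc n]"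

lemma hv_eq_iff:
  "ws \<in> lists {1..n} \<Longrightarrow> vs \<in> lists {1..n} \<Longrightarrow> hv ws = hv vs \<longleftrightarrow> word_product \<alpha> ws = word_product \<alpha> vs"
  by (simp only: word_product_eq_iff)

lemma words_subset:
  assumes "set xs \<subseteq> lists {1..n}" "set ys \<subseteq> lists {1..n}" "set (map hv xs) \<subseteq> set (map hv ys)"
  shows "word_product \<alpha> ` set xs \<subseteq> word_product \<alpha> ` set ys"
proof
  fix w assume "w \<in> word_product \<alpha> ` set xs"
  then obtain x where x: "x \<in> set xs" "w = word_product \<alpha> x" by blast
  then have "hv x \<in> set (map hv ys)" using assms(3) by auto
  then obtain y where y: "y \<in> set ys" "hv x = hv y" by auto
  have "x \<in> lists {1..n}" "y \<in> lists {1..n}" using x y assms by blast+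
  from hv_eq_iff[OF this] show "w \<in> word_product \<alpha> ` set ys" using x y by auto
qed

lemma words_eq:
  assumes "set xs \<subseteq> lists {1..n}" "set ys \<subseteq> lists {1..n}" "set (map hv xs) = set (map hv ys)"
  shows "word_product \<alpha> ` set xs = word_product \<alpha> ` set ys"
  using words_subset[of xs ys] words_subset[of ys xs] assms by blast

lemma words_mem:
  assumes "x \<in> lists {1..n}" "set ys \<subseteq> lists {1..n}"
  shows "hv x \<in> set (map hv ys) \<longleftrightarrow> word_product \<alpha> x \<in> word_product \<alpha> ` set ys"
proof -
  have "hv x = hv y \<longleftrightarrow> word_product \<alpha> x = word_product \<alpha> y" if "y \<in> set ys" for y
    using assms that by (intro hv_eq_iff) auto
  then show ?thesis unfolding set_map image_iff by blast
qed

lemma words_diff: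
  assumes "set xs \<subseteq> lists {1..n}" "set ys \<subseteq> lists {1..n}"
  shows "word_product \<alpha> ` set xs - word_product \<alpha> ` set ys =
    word_product \<alpha> ` set (filter (\<lambda>x. hv x \<notin> set (map hv ys)) xs)"
proof -
  have "filter (\<lambda>x. hv x \<notin> set (map hv ys)) xs =
      filter (\<lambda>x. word_product \<alpha> x \<notin> word_product \<alpha> ` set ys) xs"
    using assms words_mem[of _ ys] by (intro filter_cong refl) blast
  then have "set (filter (\<lambda>x. hv x \<notin> set (map hv ys)) xs) = {x \<in> set xs. word_product \<alpha> x \<notin> word_product \<alpha> ` set ys}"
    by (simp only: set_filter)
  moreover have "f ` A - B = f ` {x \<in> A. f x \<notin> B}" for f :: "nat list \<Rightarrow> 'a \<Rightarrow> 'a" and A B by auto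
  ultimately show ?thesis by (simp only:)
qed

lemma words_Int:
  assumes "set xs \<subseteq> lists {1..n}" "set ys \<subseteq> lists {1..n}"
  shows "word_product \<alpha> ` set xs \<inter> word_product \<alpha> ` set ys =
    word_product \<alpha> ` set (filter (\<lambda>x. hv x \<in> set (map hv ys)) xs)"
proof -
  have "filter (\<lambda>x. hv x \<in> set (map hv ys)) xs =
      filter (\<lambda>x. word_product \<alpha> x \<in> word_product \<alpha> ` set ys) xs"
    using assms words_mem[of _ ys] by (intro filter_cong refl) blast
  then have "set (filter (\<lambda>x. hv x \<in> set (map hv ys)) xs) = {x \<in> set xs. word_product \<alpha> x \<in> word_product \<alpha> ` set ys}"
    by (simp only: set_filter)
  moreover have "f ` A \<inter> B = f ` {x \<in> A. f x \<in> B}" for f :: "nat list \<Rightarrow> 'a \<Rightarrow> 'a" and A B by auto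
  ultimately show ?thesis by (simp only:)
qed

text \<open>\<open>K\<close> is the height vector as a function of the element instead of the word.
  It is injective on the elements in question, so distinct vectors may be counted instead.\<close>

lemma words_card:
  assumes "set xs \<subseteq> lists {1..n}"
  shows "card (word_product \<alpha> ` set xs) = length (remdups (map hv xs))"
proof -
  define K where "K w = map (vals height w) [1..<Suc n]" for w
  have hv: "hv x = K (word_product \<alpha> x)" if "x \<in> set xs" for x
    unfolding K_def using assms that by (intro height_vector_eq) blast
  have inj: "inj_on K (word_product \<alpha> ` set xs)"
  proof (rule inj_onI)
    fix v w assume "v \<in> word_product \<alpha> ` set xs" "w \<in> word_product \<alpha> ` set xs" "K v = K w"
    moreover then obtain x y where "x \<in> set xs" "y \<in> set xs" "v = word_product \<alpha> x" "w = word_product \<alpha> y"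
      by blast
    ultimately show "v = w" using hv_eq_iff[of x y] hv assms by auto
  qed
  have "card (word_product \<alpha> ` set xs) = card (K ` word_product \<alpha> ` set xs)" by (rule card_image[OF inj, symmetric])
  also have "K ` word_product \<alpha> ` set xs = set (map hv xs)" using hv by auto
  finally show ?thesis by (simp add: length_remdups_card_conv)
qed

end

section \<open>The type F4\<close>

text \<open>The entry -2 stands in row 3 because \<open>\<alpha> 3\<close> is short: its coroot
  pairs to -2 with the long root \<open>\<alpha> 2\<close>.\<close>

definition F4_cartan :: "nat \<Rightarrow> nat \<Rightarrow> int" where
  "F4_cartan k m = (if k = m then 2 else if k = 3 \<and> m = 2 then -2
     else if (k, m) \<in> set [(1, 2), (2, 1), (2, 3), (3, 4), (4, 3)] then -1 else 0)"

text \<open>The reduced words of the minimal NGTs with right descent \<open>i\<close>, as found by the enumeration.\<close>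

definition F4_words :: "nat \<Rightarrow> nat list list" where
  "F4_words i = (
    if i = 1 then [[1, 2, 3, 2, 1, 4, 3, 2, 1, 3, 2, 4, 3, 2, 1]] else
    if i = 2 then [[2, 1, 3, 2, 1, 3, 2],
      [2, 3, 2, 1, 4, 3, 2, 1, 3, 2, 4, 3, 2],
      [2, 1, 3, 2, 1, 3, 2, 4, 3, 2, 1, 3, 2, 4, 3, 2],
      [2, 1, 3, 2, 1, 3, 2, 4, 3, 2, 1, 3, 2, 3, 4, 3, 2, 1, 3, 2]] else
    if i = 3 then [[3, 2, 3, 4, 3, 2, 3],
      [3, 2, 1, 3, 2, 3, 4, 3, 2, 1, 3, 2, 3],
      [3, 2, 1, 3, 2, 4, 3, 2, 1, 3, 2, 3, 4, 3, 2, 3],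
      [3, 2, 1, 3, 2, 3, 4, 3, 2, 1, 3, 2, 3, 4, 3, 2, 1, 3, 2, 3]] else
    if i = 4 then [[4, 3, 2, 1, 3, 2, 3, 4, 3, 2, 1, 3, 2, 3, 4]] else
    [])"

text \<open>The eight products in the order of \<open>F4_single_roots\<close> and
  \<open>F4_root_pairs\<close>. The words attached to the coefficient lists certify that these are
  roots.\<close>

definition F4_data :: "root_datum list list" where
  "F4_data =
    [[([1, 2, 3, 1], [3, 2, 1, 3, 2, 3], 4)],
     [([1, 3, 4, 2], [2, 3, 2, 1, 4, 3], 2)],
     [([1, 2, 3, 2], [4, 3, 2, 1, 3, 2, 3], 4)],
     [([2, 3, 4, 2], [1, 2, 3, 2, 1, 4, 3], 2)],
     [([1, 3, 4, 2], [2, 3, 2, 1, 4, 3], 2), ([1, 1, 1, 0], [1, 2], 3)],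
     [([0, 1, 2, 2], [4, 3], 2), ([1, 2, 3, 1], [3, 2, 1, 3, 2, 3], 4)],
     [([1, 2, 2, 2], [2, 1, 4, 3], 2), ([1, 2, 3, 1], [3, 2, 1, 3, 2, 3], 4)],
     [([1, 3, 4, 2], [2, 3, 2, 1, 4, 3], 2), ([1, 1, 2, 1], [1, 3, 2, 3], 4)]]"

text \<open>The elements from B3 and C3 are reflections in
  \<open>\<epsilon> 1 + \<epsilon> 2\<close>, written in the Bourbaki coordinates of the respective
  subsystem.\<close>

definition F4_sub_data :: "root_datum list list" where
  "F4_sub_data =
    [[([1, 2, 2, 0], [2, 1, 3], 2)],
     [([0, 1, 2, 1], [3, 2, 3], 4)]]"

definition F4_all_words :: "nat list list" where
  "F4_all_words = concat (map F4_words [1, 2, 3, 4])"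

text \<open>In the second fact the left descent is restricted to 2 and the list remains the same, so
  all elements found for right descent 2 have left descent 2. For B3 only the long nodes 1 and 2 are
  admissible, for C3 only the short nodes 3 and 4.\<close>

lemma F4_enumeration:
  "list_all (\<lambda>(i, js). unique_descent_words F4_cartan [1..<Suc 4] js i = Some (F4_words i))
     [(1, [1, 2]), (2, [1, 2]), (3, [3, 4]), (4, [3, 4])]"
  "unique_descent_words F4_cartan [1..<Suc 4] [2] 2 = Some (F4_words 2)"
  "unique_descent_words F4_cartan [1, 2, 3] [1, 2] 1 = Some []"
  "unique_descent_words F4_cartan [1, 2, 3] [1, 2] 2 = Some [[2, 1, 3, 2, 1, 3, 2]]"
  "unique_descent_words F4_cartan [2, 3, 4] [3, 4] 3 = Some [[3, 2, 3, 4, 3, 2, 3]]"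
  "unique_descent_words F4_cartan [2, 3, 4] [3, 4] 4 = Some []"
  by code_simp+

abbreviation "F4_hv \<equiv> height_vector F4_cartan [1..<Suc 4]"

text \<open>The last two facts give different elements with the same \<open>\<beta>\<close>: running
  a word that is not reversed evaluates the inverse element on \<open>\<alpha> 2\<close>. The fact
  with \<open>5 - i\<close> is closure under duality.\<close>

lemma F4_checks:
  "list_all (check_product F4_cartan 4) (F4_data @ F4_sub_data)"
  "list_all (\<lambda>ws. list_all (\<lambda>k. 1 \<le> k \<and> k \<le> 4) ws) F4_all_words"
  "set (map F4_hv F4_all_words) = set (map (F4_hv \<circ> product_word) (F4_data @ F4_sub_data))"
  "set (map F4_hv (filter (\<lambda>x. F4_hv x \<notin> set (map F4_hv [[2, 1, 3, 2, 1, 3, 2], [3, 2, 3, 4, 3, 2, 3]])) F4_all_words)) =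
     set (map (F4_hv \<circ> product_word) F4_data)"
  "length (remdups (map (F4_hv \<circ> product_word) F4_data)) = 8"
  "length (remdups (map F4_hv [[2, 1, 3, 2, 1, 3, 2], [3, 2, 3, 4, 3, 2, 3]])) = 2"
  "set (map F4_hv [[2, 1, 3, 2, 1, 3, 2], [3, 2, 3, 4, 3, 2, 3]]) \<subseteq> set (map F4_hv F4_all_words)"
  "list_all (\<lambda>ds. F4_hv (map (\<lambda>i. 5 - i) (product_word ds)) \<in> set (map (F4_hv \<circ> product_word) F4_data)) F4_data"
  "F4_hv (F4_words 2 ! 1) \<noteq> F4_hv (F4_words 2 ! 2)"
  "run (coeff_step F4_cartan) (F4_words 2 ! 1) (unit_coeffs 4 2) =
     run (coeff_step F4_cartan) (F4_words 2 ! 2) (unit_coeffs 4 2)"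
  by code_simp+

lemma F4_data_roots:
  "map (map (\<lambda>d. root_of_coeffs \<alpha> (fst d))) F4_data = F4_single_roots \<alpha> @ F4_root_pairs \<alpha>"
  by (simp add: F4_data_def F4_single_roots_def F4_root_pairs_def)

context simple_system begin

lemma laces_0: "i \<in> I \<Longrightarrow> j \<in> I \<Longrightarrow> i \<noteq> j \<Longrightarrow> laces (\<alpha> i) (\<alpha> j) = 0 \<Longrightarrow> cartan i j = 0 \<and> cartan j i = 0"
  by (erule (2) cartan_cases) (simp_all add: laces_eq_cartan)

lemma laces_1: "i \<in> I \<Longrightarrow> j \<in> I \<Longrightarrow> i \<noteq> j \<Longrightarrow> laces (\<alpha> i) (\<alpha> j) = 1 \<Longrightarrow> cartan i j = -1 \<and> cartan j i = -1"
  by (erule (2) cartan_cases) (simp_all add: laces_eq_cartan)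

text \<open>Both Cartan integers rescale to the same inner product, so the comparison of lengths
  tells which of them is -2.\<close>

lemma laces_2:
  assumes "i \<in> I" "j \<in> I" "i \<noteq> j" "laces (\<alpha> i) (\<alpha> j) = 2" "\<alpha> j \<bullet> \<alpha> j \<le> \<alpha> i \<bullet> \<alpha> i"
  shows "cartan i j = -1 \<and> cartan j i = -2"
proof -
  have "cartan i j * (\<alpha> i \<bullet> \<alpha> i) = cartan j i * (\<alpha> j \<bullet> \<alpha> j)"
    using cartan_eq_inner[of i j] cartan_eq_inner[of j i] assms by (simp add: inner_commute)
  moreover have "0 < \<alpha> i \<bullet> \<alpha> i" using root_inner_pos simple_root assms by blast
  ultimately show ?thesis
    using assms(4,5) by (cases rule: cartan_cases[OF assms(1-3)]) (simp_all add: laces_eq_cartan)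
qed

lemma cartan_system_subsystem:
  assumes "distinct L" "set L \<subseteq> I" "\<And>k m. k \<in> I \<Longrightarrow> m \<in> I \<Longrightarrow> cartan k m = of_int (a k m)"
  shows "cartan_system (subsystem R \<alpha> (set L)) \<alpha> (set L) L a"
  using assms
  by (intro cartan_system.intro simple_system_subsystem cartan_system_axioms.intro) auto

lemma norm_eq_if_cartan:
  "i \<in> I \<Longrightarrow> j \<in> I \<Longrightarrow> cartan i j = -1 \<Longrightarrow> cartan j i = -1 \<Longrightarrow> \<alpha> i \<bullet> \<alpha> i = \<alpha> j \<bullet> \<alpha> j"
  using cartan_eq_inner[of i j] cartan_eq_inner[of j i] by (simp add: inner_commute)

end

lemma orthogonal_reflections_product_involution:
  "orthogonal_reflections_product R w \<Longrightarrow> w \<circ> w = id"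
  using orthogonal_reflection_product_involution by (auto simp: orthogonal_reflections_product_def)

lemma long_root_iff:
  assumes "m \<in> Q" "\<And>q. q \<in> Q \<Longrightarrow> q \<bullet> q \<le> m \<bullet> m"
  shows "long_root Q r \<longleftrightarrow> r \<in> Q \<and> r \<bullet> r = m \<bullet> m"
  using assms unfolding long_root_def norm_le by (metis order.antisym order.refl)

lemma short_root_iff:
  assumes "m \<in> Q" "\<And>q. q \<in> Q \<Longrightarrow> m \<bullet> m \<le> q \<bullet> q"
  shows "short_root Q r \<longleftrightarrow> r \<in> Q \<and> r \<bullet> r = m \<bullet> m"
  using assms unfolding short_root_def norm_le by (metis order.antisym order.refl)

text \<open>The reversal of the diagram exchanges roots and coroots. The factors 2 and 1 are the
  squared lengths of the simple roots relative to a short one.\<close>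

lemma F4_cartan_dual:
  "list_all (\<lambda>i. list_all (\<lambda>j. F4_cartan i j * (if i \<le> 2 then 2 else 1) =
     (if j \<le> 2 then 2 else 1) * F4_cartan (5 - i) (5 - j)) [1..<Suc 4]) [1..<Suc 4]"
  by code_simp

locale F4_system = simple_system R \<alpha> "{1..4}"
  for R :: "'a::real_inner set" and \<alpha> :: "nat \<Rightarrow> 'a" +
  assumes F4: "type_F4 R \<alpha>"
begin

lemma index_cases: "k \<in> {1..4::nat} \<longleftrightarrow> k = 1 \<or> k = 2 \<or> k = 3 \<or> k = 4"
  by auto

lemma F4_cartan_eq:
  assumes "k \<in> {1..4}" "m \<in> {1..4}"
  shows "cartan k m = of_int (F4_cartan k m)"
proof -
  note F = F4[unfolded type_F4_def]
  have "\<alpha> 3 \<bullet> \<alpha> 3 \<le> \<alpha> 2 \<bullet> \<alpha> 2"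
    using F simple_root[of 2] by (simp add: short_root_def norm_le)
  then have "cartan 2 3 = -1 \<and> cartan 3 2 = -2" using F by (intro laces_2) simp_all
  moreover have "cartan 1 2 = -1 \<and> cartan 2 1 = -1" "cartan 3 4 = -1 \<and> cartan 4 3 = -1"
    using F by (intro laces_1; simp)+
  moreover have "cartan 1 3 = 0 \<and> cartan 3 1 = 0" "cartan 1 4 = 0 \<and> cartan 4 1 = 0" "cartan 2 4 = 0 \<and> cartan 4 2 = 0"
    using F by (intro laces_0; simp)+
  moreover have "cartan 1 1 = 2" "cartan 2 2 = 2" "cartan 3 3 = 2" "cartan 4 4 = 2"
    by (simp_all add: cartan_self)
  ultimately show ?thesis
    using assms unfolding index_cases by (elim disjE) (simp_all add: F4_cartan_def)
qed

sublocale standard_cartan_system R \<alpha> 4 F4_cartan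
  by unfold_locales (use F4_cartan_eq in auto)

definition "N = \<alpha> 1 \<bullet> \<alpha> 1"
definition "M = \<alpha> 3 \<bullet> \<alpha> 3"

lemma norms: "\<alpha> 1 \<bullet> \<alpha> 1 = N" "\<alpha> 2 \<bullet> \<alpha> 2 = N" "\<alpha> 3 \<bullet> \<alpha> 3 = M" "\<alpha> 4 \<bullet> \<alpha> 4 = M" "N = 2 * M" "0 < M"
proof -
  have c: "cartan 1 2 = -1" "cartan 2 1 = -1" "cartan 2 3 = -1" "cartan 3 2 = -2" "cartan 3 4 = -1" "cartan 4 3 = -1"
    by (simp_all add: F4_cartan_eq F4_cartan_def)
  show "\<alpha> 1 \<bullet> \<alpha> 1 = N" "\<alpha> 3 \<bullet> \<alpha> 3 = M" by (simp_all add: N_def M_def)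
  show N2: "\<alpha> 2 \<bullet> \<alpha> 2 = N" "\<alpha> 4 \<bullet> \<alpha> 4 = M"
    using norm_eq_if_cartan[of 1 2] norm_eq_if_cartan[of 3 4] c by (simp_all add: N_def M_def)
  show "N = 2 * M"
    using cartan_eq_inner[of 2 3] cartan_eq_inner[of 3 2] c N2 by (simp add: M_def inner_commute)
  show "0 < M" unfolding M_def by (intro root_inner_pos simple_root) simp
qed

lemma root_norm_cases: "r \<in> R \<Longrightarrow> r \<bullet> r = N \<or> r \<bullet> r = M"
  using root_norm_simple[of r] norms unfolding Bex_def index_cases by metis

lemma same_norm:
  assumes "i \<in> {1..4}" "j \<in> {1..4}"
  shows "\<alpha> j \<bullet> \<alpha> j = \<alpha> i \<bullet> \<alpha> i \<longleftrightarrow> (i \<le> 2 \<longleftrightarrow> j \<le> 2)"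
  using assms norms unfolding index_cases by auto

lemma NGT_F4:
  "minimal_NGTs Type_F R \<alpha> {1..4} = word_product \<alpha> ` set F4_all_words" "set F4_all_words \<subseteq> lists {1..4}"
  "\<And>w i j. i \<in> {1..4} \<Longrightarrow> w \<in> word_product \<alpha> ` set (F4_words i) \<Longrightarrow> right_descents (inv w) = {j} \<Longrightarrow>
      minimal_NGT_triple Type_F R \<alpha> {1..4} w (- inv w (\<alpha> j)) (\<alpha> i - inv w (\<alpha> j)) (\<alpha> i)"
proof -
  define js :: "nat \<Rightarrow> nat list" where "js i = (if i \<le> 2 then [1, 2] else [3, 4])" for i
  have js: "set (js i) = {j \<in> {1..4}. \<alpha> j \<bullet> \<alpha> j = \<alpha> i \<bullet> \<alpha> i}" if "i \<in> {1..4}" for i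
    using same_norm[OF that] that unfolding js_def by auto
  have res: "unique_descent_words F4_cartan [1..<Suc 4] (js i) i = Some (F4_words i)" if "i \<in> {1..4}" for i
    using F4_enumeration(1) that unfolding index_cases js_def by auto
  have long: "long_root R r \<longleftrightarrow> r \<in> R \<and> r \<bullet> r = N" for r
    using long_root_iff[of "\<alpha> 1" R r] root_norm_cases norms simple_root by fastforce
  have short: "short_root R r \<longleftrightarrow> r \<in> R \<and> r \<bullet> r = M" for r
    using short_root_iff[of "\<alpha> 3" R r] root_norm_cases norms simple_root by fastforce
  have lc: "length_condition Type_F R {b, g, \<alpha> i} \<longleftrightarrow> i \<in> {1..4} \<and> b \<bullet> b = \<alpha> i \<bullet> \<alpha> i \<and> g \<bullet> g = \<alpha> i \<bullet> \<alpha> i"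
    if "i \<in> {1..4}" "b \<in> R" "g \<in> R" for i b g
    using that root_norm_cases[OF simple_root[OF that(1)]] simple_root[OF that(1)] by (auto simp: long short)
  have all: "(\<Union>i\<in>{1..4}. set (F4_words i)) = set F4_all_words"
  proof -
    have "{1..4::nat} = {1, 2, 3, 4}" by auto
    then show ?thesis unfolding F4_all_words_def by (simp del: insert_iff)
  qed
  note * = minimal_NGTs_eq_words[where S = "{1..4}" and X = Type_F and res = F4_words and js = js, OF subset_refl js res lc]
  show "minimal_NGTs Type_F R \<alpha> {1..4} = word_product \<alpha> ` set F4_all_words" "set F4_all_words \<subseteq> lists {1..4}"
    using *(1,2) unfolding all by simp_all
  show "\<And>w i j. i \<in> {1..4} \<Longrightarrow> w \<in> word_product \<alpha> ` set (F4_words i) \<Longrightarrow> right_descents (inv w) = {j} \<Longrightarrow>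
      minimal_NGT_triple Type_F R \<alpha> {1..4} w (- inv w (\<alpha> j)) (\<alpha> i - inv w (\<alpha> j)) (\<alpha> i)"
    by (rule *(3))
qed

lemma NGT_B3: "minimal_NGTs Type_B (subsystem R \<alpha> {1,2,3}) \<alpha> {1,2,3} = word_product \<alpha> ` set [[2, 1, 3, 2, 1, 3, 2]]"
proof -
  let ?Q = "subsystem R \<alpha> {1,2,3}"
  interpret B: cartan_system ?Q \<alpha> "{1,2,3}" "[1,2,3]" F4_cartan
    using cartan_system_subsystem[of "[1,2,3]" F4_cartan] F4_cartan_eq by auto
  define js :: "nat \<Rightarrow> nat list" where "js i = [1, 2]" for i
  define res :: "nat \<Rightarrow> nat list list" where "res i = (if i = 1 then [] else [[2, 1, 3, 2, 1, 3, 2]])" for i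
  have js: "set (js i) = {j \<in> {1,2,3}. \<alpha> j \<bullet> \<alpha> j = \<alpha> i \<bullet> \<alpha> i}" if "i \<in> {1,2}" for i
    using that norms unfolding js_def by auto
  have res: "unique_descent_words F4_cartan [1,2,3] (js i) i = Some (res i)" if "i \<in> {1,2}" for i
    using F4_enumeration that unfolding js_def res_def by auto
  have sub: "?Q \<subseteq> R" by (auto simp: subsystem_def)
  have long: "long_root ?Q r \<longleftrightarrow> r \<in> ?Q \<and> r \<bullet> r = N" for r
    using long_root_iff[of "\<alpha> 1" ?Q r] root_norm_cases norms B.simple_root[of 1] sub by fastforce
  have lc: "length_condition Type_B ?Q {b, g, \<alpha> i} \<longleftrightarrow> i \<in> {1,2} \<and> b \<bullet> b = \<alpha> i \<bullet> \<alpha> i \<and> g \<bullet> g = \<alpha> i \<bullet> \<alpha> i"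
    if "i \<in> {1,2,3}" "b \<in> ?Q" "g \<in> ?Q" for i b g
    using that B.simple_root[OF that(1)] norms by (auto simp: long)
  show ?thesis
    using B.minimal_NGTs_eq_words(1)[where S = "{1,2}" and X = Type_B and res = res and js = js, OF _ js res lc]
    by (simp add: res_def)
qed

lemma NGT_C3: "minimal_NGTs Type_C (subsystem R \<alpha> {2,3,4}) \<alpha> {2,3,4} = word_product \<alpha> ` set [[3, 2, 3, 4, 3, 2, 3]]"
proof -
  let ?Q = "subsystem R \<alpha> {2,3,4}"
  interpret C: cartan_system ?Q \<alpha> "{2,3,4}" "[2,3,4]" F4_cartan
    using cartan_system_subsystem[of "[2,3,4]" F4_cartan] F4_cartan_eq by auto
  define js :: "nat \<Rightarrow> nat list" where "js i = [3, 4]" for i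
  define res :: "nat \<Rightarrow> nat list list" where "res i = (if i = 4 then [] else [[3, 2, 3, 4, 3, 2, 3]])" for i
  have js: "set (js i) = {j \<in> {2,3,4}. \<alpha> j \<bullet> \<alpha> j = \<alpha> i \<bullet> \<alpha> i}" if "i \<in> {3,4}" for i
    using that norms unfolding js_def by auto
  have res: "unique_descent_words F4_cartan [2,3,4] (js i) i = Some (res i)" if "i \<in> {3,4}" for i
    using F4_enumeration that unfolding js_def res_def by auto
  have sub: "?Q \<subseteq> R" by (auto simp: subsystem_def)
  have short: "short_root ?Q r \<longleftrightarrow> r \<in> ?Q \<and> r \<bullet> r = M" for r
    using short_root_iff[of "\<alpha> 3" ?Q r] root_norm_cases norms C.simple_root[of 3] sub by fastforce
  have lc: "length_condition Type_C ?Q {b, g, \<alpha> i} \<longleftrightarrow> i \<in> {3,4} \<and> b \<bullet> b = \<alpha> i \<bullet> \<alpha> i \<and> g \<bullet> g = \<alpha> i \<bullet> \<alpha> i"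
    if "i \<in> {2,3,4}" "b \<in> ?Q" "g \<in> ?Q" for i b g
    using that C.simple_root[OF that(1)] norms by (auto simp: short)
  show ?thesis
    using C.minimal_NGTs_eq_words(1)[where S = "{3,4}" and X = Type_C and res = res and js = js, OF _ js res lc]
    by (simp add: res_def)
qed

lemma F4_products:
  assumes "ds \<in> set (F4_data @ F4_sub_data)"
  shows "check_product F4_cartan 4 ds"
  using F4_checks(1) assms by (simp only: list_all_iff)

lemma F4_product_words:
  "set (map product_word (F4_data @ F4_sub_data)) \<subseteq> lists {1..4}"
  using check_product(4)[OF F4_products] by (simp only: set_map) blast

abbreviation "roots_of ds \<equiv> map (\<lambda>d. root_of_coeffs \<alpha> (fst d)) ds"

lemma F4_L: "reflection_product ` set (F4_single_roots \<alpha> @ F4_root_pairs \<alpha>) = word_product \<alpha> ` set (map product_word F4_data)"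
proof -
  have "reflection_product (roots_of ds) = word_product \<alpha> (product_word ds)" if "ds \<in> set F4_data" for ds
    using that by (intro check_product(3)[OF F4_products]) simp
  then show ?thesis unfolding F4_data_roots[symmetric] by (simp add: image_image)
qed

lemma F4_root_lists:
  "\<forall>rs\<in>set (F4_single_roots \<alpha> @ F4_root_pairs \<alpha>). set rs \<subseteq> R \<and> sorted_wrt orthogonal rs"
proof -
  have "set (roots_of ds) \<subseteq> R \<and> sorted_wrt orthogonal (roots_of ds)" if "ds \<in> set F4_data" for ds
    using that by (intro conjI check_product(1,2)[OF F4_products]) simp_all
  then show ?thesis unfolding F4_data_roots[symmetric] by (simp only: set_map ball_simps) blast
qed

lemma F4_data_words_subset: "set (map product_word F4_data) \<subseteq> lists {1..4}"
  using F4_product_words by simp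

lemma F4_involutions: "\<forall>w\<in>minimal_NGTs Type_F R \<alpha> {1..4}. orthogonal_reflections_product R w"
proof -
  have "word_product \<alpha> ` set F4_all_words = word_product \<alpha> ` set (map product_word (F4_data @ F4_sub_data))"
    using NGT_F4(2) F4_product_words F4_checks(3) by (intro words_eq) (simp_all only: map_map)
  moreover have "orthogonal_reflections_product R (word_product \<alpha> (product_word ds))"
    if "ds \<in> set (F4_data @ F4_sub_data)" for ds
    using check_product[OF F4_products[OF that]] unfolding orthogonal_reflections_product_def by metis
  ultimately show ?thesis unfolding NGT_F4 by (simp only: set_map) blast
qed

lemma F4_sets:
  defines "NB \<equiv> minimal_NGTs Type_B (subsystem R \<alpha> {1,2,3}) \<alpha> {1,2,3}"
    and "NC \<equiv> minimal_NGTs Type_C (subsystem R \<alpha> {2,3,4}) \<alpha> {2,3,4}"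
    and "L \<equiv> reflection_product ` set (F4_single_roots \<alpha> @ F4_root_pairs \<alpha>)"
  shows "NB \<union> NC \<subseteq> minimal_NGTs Type_F R \<alpha> {1..4}" "card NB = 1" "card NC = 1" "card (NB \<union> NC) = 2"
    "minimal_NGTs Type_F R \<alpha> {1..4} - (NB \<union> NC) = L" "card L = 8"
proof -
  let ?bc = "[[2, 1, 3, 2, 1, 3, 2], [3, 2, 3, 4, 3, 2, 3]] :: nat list list"
  have bc: "NB \<union> NC = word_product \<alpha> ` set ?bc" unfolding NB_def NC_def NGT_B3 NGT_C3 by auto
  have l: "set ?bc \<subseteq> lists {1..4}" by simp
  show "card NB = 1" "card NC = 1" unfolding NB_def NC_def NGT_B3 NGT_C3 by simp_all
  show "NB \<union> NC \<subseteq> minimal_NGTs Type_F R \<alpha> {1..4}"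
    unfolding bc NGT_F4 by (rule words_subset[OF l NGT_F4(2) F4_checks(7)])
  show "card (NB \<union> NC) = 2" unfolding bc words_card[OF l] by (rule F4_checks(6))
  show "card L = 8"
    unfolding L_def F4_L words_card[OF F4_data_words_subset] using F4_checks(5) by (simp only: map_map)
  show "minimal_NGTs Type_F R \<alpha> {1..4} - (NB \<union> NC) = L"
    unfolding bc NGT_F4 L_def F4_L words_diff[OF NGT_F4(2) l]
    using NGT_F4(2) F4_checks(4) by (intro words_eq F4_data_words_subset) (auto simp only: map_map set_filter)
qed

text \<open>The witnesses are \<open>s\<^bsub>1342\<^esub>\<close> and its product with \<open>s\<^bsub>1110\<^esub>\<close>.\<close>

lemma F4_not_unique:
  "\<exists>w w' b g a. w \<noteq> w' \<and> minimal_NGT_triple Type_F R \<alpha> {1..4} w b g a \<and>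
     minimal_NGT_triple Type_F R \<alpha> {1..4} w' b g a"
proof -
  define x y where "x = F4_words 2 ! 1" and "y = F4_words 2 ! 2"
  have xy: "x \<in> set (F4_words 2)" "y \<in> set (F4_words 2)"
    unfolding x_def y_def by (intro nth_mem; simp add: F4_words_def)+
  note c = unique_descent_words_correct[OF _ _ F4_enumeration(2), simplified]
  have l: "x \<in> lists {1..4}" "y \<in> lists {1..4}" using c(1) xy by blast+
  have d: "right_descents (inv (word_product \<alpha> z)) = {2}" if "z \<in> set (F4_words 2)" for z
    using c(2) that by blast
  have inv: "inv (word_product \<alpha> z) (\<alpha> 2) = root_of_ints \<alpha> (run (coeff_step F4_cartan) z (unit_coeffs 4 2))"
    if "z \<in> lists {1..4}" for z
  proof -
    have "length (unit_coeffs 4 2) = 4" by (simp add: unit_coeffs_def)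
    from word_product_root_of_ints[OF this, of "rev z"] show ?thesis
      using that root_of_ints_unit[of 2] by (simp add: in_lists_conv_set)
  qed
  have eq: "inv (word_product \<alpha> x) (\<alpha> 2) = inv (word_product \<alpha> y) (\<alpha> 2)"
    unfolding inv[OF l(1)] inv[OF l(2)] using F4_checks(10) by (simp only: x_def y_def)
  have "word_product \<alpha> x \<noteq> word_product \<alpha> y"
    using hv_eq_iff[OF l] F4_checks(9) by (simp only: x_def y_def) simp
  moreover have "minimal_NGT_triple Type_F R \<alpha> {1..4} (word_product \<alpha> x)
      (- inv (word_product \<alpha> x) (\<alpha> 2)) (\<alpha> 2 - inv (word_product \<alpha> x) (\<alpha> 2)) (\<alpha> 2)"
    by (rule NGT_F4(3)) (use xy d in auto)
  moreover have "minimal_NGT_triple Type_F R \<alpha> {1..4} (word_product \<alpha> y)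
      (- inv (word_product \<alpha> x) (\<alpha> 2)) (\<alpha> 2 - inv (word_product \<alpha> x) (\<alpha> 2)) (\<alpha> 2)"
    unfolding eq by (rule NGT_F4(3)) (use xy d in auto)
  ultimately show ?thesis by blast
qed

text \<open>The duality of \<open>F4\<close> is induced by the similarity \<open>T\<close> that exchanges the simple roots up to
  a factor, which need not be a multiple of an isometry outside the span of the roots.\<close>

definition T :: "'a \<Rightarrow> 'a" where
  "T x = (\<Sum>j\<in>{1..4}. (coord j x * (if j \<le> 2 then 2 else 1)) *\<^sub>R \<alpha> (5 - j))"

lemma T_diff_scale:
  assumes "x \<in> span (\<alpha> ` {1..4})" "y \<in> span (\<alpha> ` {1..4})"
  shows "T (x - d *\<^sub>R y) = T x - d *\<^sub>R T y"
  using assms by (simp add: T_def coord_diff coord_scale span_scale scaleR_sum_right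
      left_diff_distrib scaleR_diff_left sum_subtractf mult.assoc)

lemma T_simple:
  assumes "i \<in> {1..4}"
  shows "T (\<alpha> i) = (if i \<le> 2 then 2 else 1) *\<^sub>R \<alpha> (5 - i)"
proof -
  have "T (\<alpha> i) = (\<Sum>j\<in>{1..4}. if j = i then (if i \<le> 2 then 2 else 1) *\<^sub>R \<alpha> (5 - i) else 0)"
    unfolding T_def using assms by (intro sum.cong) (auto simp: coord_simple)
  then show ?thesis using assms by simp
qed

lemma pairing_sum:
  assumes "x \<in> span (\<alpha> ` {1..4})"
  shows "2 * (x \<bullet> \<alpha> i) / (\<alpha> i \<bullet> \<alpha> i) = (\<Sum>j\<in>{1..4}. coord j x * cartan i j)"
proof -
  have "x \<bullet> \<alpha> i = (\<Sum>j\<in>{1..4}. coord j x *\<^sub>R \<alpha> j) \<bullet> \<alpha> i"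
    by (rule arg_cong[OF span_eq_sum_coord[OF assms]])
  then show ?thesis
    by (simp add: inner_sum_left cartan_def sum_distrib_left sum_divide_distrib mult_ac)
qed

lemma T_reflection:
  assumes "i \<in> {1..4}" "x \<in> span (\<alpha> ` {1..4})"
  shows "T (s i x) = s (5 - i) (T x)"
proof -
  let ?t = "\<lambda>j. if j \<le> 2 then 2 else (1::real)"
  have sym: "cartan i j * ?t i = ?t j * cartan (5 - i) (5 - j)" if "j \<in> {1..4}" for j
  proof -
    have "5 - i \<in> {1..4}" "5 - j \<in> {1..4}" using assms that by auto
    note c = F4_cartan_eq[OF assms(1) that] F4_cartan_eq[OF this]
    have "F4_cartan i j * (if i \<le> 2 then 2 else 1) = (if j \<le> 2 then 2 else 1) * F4_cartan (5 - i) (5 - j)"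
      using F4_cartan_dual assms(1) that by (simp only: list_all_iff set_upt) auto
    from arg_cong[OF this, of real_of_int] show ?thesis
      unfolding c by (auto split: if_splits)
  qed
  have "T (s i x) = T x - (\<Sum>j\<in>{1..4}. coord j x * cartan i j) *\<^sub>R T (\<alpha> i)"
    unfolding reflection_def pairing_sum[OF assms(2)]
    using assms by (intro T_diff_scale simple_in_span)
  also have "\<dots> = T x - (\<Sum>j\<in>{1..4}. coord j x * (cartan i j * ?t i)) *\<^sub>R \<alpha> (5 - i)"
    unfolding T_simple[OF assms(1)] by (simp add: sum_distrib_right sum_distrib_left mult_ac)
  also have "(\<Sum>j\<in>{1..4}. coord j x * (cartan i j * ?t i)) = (\<Sum>j\<in>{1..4}. coord j x * (?t j * cartan (5 - i) (5 - j)))"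
    using sym by (intro sum.cong) auto
  also have "(\<Sum>j\<in>{1..4}. coord j x * (?t j * cartan (5 - i) (5 - j))) =
      2 * (T x \<bullet> \<alpha> (5 - i)) / (\<alpha> (5 - i) \<bullet> \<alpha> (5 - i))"
    by (simp add: T_def inner_sum_left cartan_def sum_distrib_left sum_divide_distrib mult_ac)
  finally show ?thesis by (simp add: reflection_def)
qed

abbreviation "dual_word \<equiv> map (\<lambda>i. 5 - i)"

lemma dual_word_lists: "ws \<in> lists {1..4} \<Longrightarrow> dual_word ws \<in> lists {1..4::nat}"
  by (auto simp: in_lists_conv_set)

lemma dual_word_dual_word: "ws \<in> lists {1..4} \<Longrightarrow> dual_word (dual_word ws) = (ws :: nat list)"
  by (auto simp: in_lists_conv_set intro!: map_idI)

lemma T_word: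
  assumes "ws \<in> lists {1..4}" "x \<in> span (\<alpha> ` {1..4})"
  shows "T (word_product \<alpha> ws x) = word_product \<alpha> (dual_word ws) (T x)"
  using assms(1)
proof (induction ws rule: list.induct)
  case (Cons i ws)
  then have "word_product \<alpha> ws x \<in> span (\<alpha> ` {1..4})"
    using weyl_span[OF word_product_in_weyl_group assms(2)] by simp
  then show ?case using Cons T_reflection[of i "word_product \<alpha> ws x"] by simp
qed simp

text \<open>Both dual products agree on the vectors \<open>T (\<alpha> k)\<close>, because
  \<open>T\<close> intertwines a word with its dual. These are nonzero multiples of all simple
  roots, and agreement on the simple roots suffices.\<close>

lemma dual_word_cong:
  assumes "ws \<in> lists {1..4}" "vs \<in> lists {1..4}" "word_product \<alpha> ws = word_product \<alpha> vs"
  shows "word_product \<alpha> (dual_word ws) = word_product \<alpha> (dual_word vs)"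
proof -
  define u v where "u = word_product \<alpha> (dual_word ws)" and "v = word_product \<alpha> (dual_word vs)"
  have uv: "u \<in> W" "v \<in> W"
    unfolding u_def v_def using assms by (auto intro!: word_product_in_weyl_group dual_word_lists simp del: in_lists_conv_set)
  have "u (\<alpha> k) = v (\<alpha> k)" if k: "k \<in> {1..4}" for k
  proof -
    have k': "5 - k \<in> {1..4}" "5 - (5 - k) = k" using k by auto
    have "u (T (\<alpha> (5 - k))) = v (T (\<alpha> (5 - k)))"
      unfolding u_def v_def T_word[OF assms(1) simple_in_span[OF k'(1)], symmetric]
        T_word[OF assms(2) simple_in_span[OF k'(1)], symmetric] assms(3) ..
    then show ?thesis
      unfolding T_simple[OF k'(1)] k'(2)
      by (simp add: linear_cmul[OF weyl_group_linear[OF uv(1)]] linear_cmul[OF weyl_group_linear[OF uv(2)]] split: if_splits)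
  qed
  then have "(inv v \<circ> u) (\<alpha> k) \<in> Pos" if "k \<in> {1..4}" for k
    using that simple_pos[OF that] by (simp add: weyl_group_inv_apply[OF uv(2)])
  then have id: "inv v \<circ> u = id" using uv by (intro weyl_eq_id weyl_group_comp weyl_group_inv)
  have "u x = v x" for x
    using weyl_group_inv_apply(2)[OF uv(2), of "u x"] fun_cong[OF id, of x] by simp
  then show ?thesis unfolding u_def v_def by blast
qed

text \<open>Conjugation by \<open>T\<close> would not do on the whole space, since \<open>T\<close>
  vanishes outside the span of the roots. An arbitrary word is chosen instead, and
  \<open>dual_word_cong\<close> makes the choice immaterial.\<close>

definition dual :: "('a \<Rightarrow> 'a) \<Rightarrow> 'a \<Rightarrow> 'a" where
  "dual w = word_product \<alpha> (dual_word (SOME ws. ws \<in> lists {1..4} \<and> word_product \<alpha> ws = w))"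

lemma dual_word_product:
  assumes "ws \<in> lists {1..4}"
  shows "dual (word_product \<alpha> ws) = word_product \<alpha> (dual_word ws)"
proof -
  let ?P = "\<lambda>vs. vs \<in> lists {1..4} \<and> word_product \<alpha> vs = word_product \<alpha> ws"
  have "?P (SOME vs. ?P vs)" by (rule someI[of ?P ws]) (use assms in simp)
  then show ?thesis unfolding dual_def using assms by (intro dual_word_cong) blast+
qed

lemma F4_dual:
  defines "L \<equiv> reflection_product ` set (F4_single_roots \<alpha> @ F4_root_pairs \<alpha>)"
  shows "bij_betw dual W W" "\<forall>u\<in>W. \<forall>v\<in>W. dual (u \<circ> v) = dual u \<circ> dual v"
    "\<forall>i\<in>{1..4}. dual (reflection (\<alpha> i)) = reflection (\<alpha> (5 - i))" "\<forall>w\<in>L. dual w \<in> L"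
proof -
  have dW: "dual w \<in> W" and dd: "dual (dual w) = w" if wW: "w \<in> W" for w
  proof -
    obtain ws where ws: "ws \<in> lists {1..4}" "w = word_product \<alpha> ws"
      using wW by (auto elim: weyl_groupE)
    note ws' = dual_word_lists[OF ws(1)]
    show "dual w \<in> W" unfolding ws(2) dual_word_product[OF ws(1)] by (rule word_product_in_weyl_group[OF ws'])
    show "dual (dual w) = w"
      unfolding ws(2) dual_word_product[OF ws(1)] dual_word_product[OF ws'] dual_word_dual_word[OF ws(1)] ..
  qed
  then show "bij_betw dual W W" by (intro bij_betw_byWitness[where f' = dual]) auto
  show "\<forall>u\<in>W. \<forall>v\<in>W. dual (u \<circ> v) = dual u \<circ> dual v"
  proof (intro ballI)
    fix u v assume "u \<in> W" "v \<in> W"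
    then obtain ws vs where w: "ws \<in> lists {1..4}" "u = word_product \<alpha> ws" "vs \<in> lists {1..4}" "v = word_product \<alpha> vs"
      by (metis weyl_groupE)
    have "ws @ vs \<in> lists {1..4}" using w by simp
    then show "dual (u \<circ> v) = dual u \<circ> dual v"
      unfolding w(2,4) dual_word_product[OF w(1)] dual_word_product[OF w(3)]
      using dual_word_product[of "ws @ vs"] by (simp add: word_product_append)
  qed
  show "\<forall>i\<in>{1..4}. dual (reflection (\<alpha> i)) = reflection (\<alpha> (5 - i))"
  proof
    fix i :: nat assume "i \<in> {1..4}"
    then show "dual (reflection (\<alpha> i)) = reflection (\<alpha> (5 - i))"
      using dual_word_product[of "[i]"] by simp
  qed
  show "\<forall>w\<in>L. dual w \<in> L"
  proof
    fix w assume "w \<in> L"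
    then obtain ds where ds: "ds \<in> set F4_data" "w = word_product \<alpha> (product_word ds)"
      unfolding L_def F4_L by auto
    then have l: "product_word ds \<in> lists {1..4}" using F4_data_words_subset by auto
    have "F4_hv (dual_word (product_word ds)) \<in> set (map F4_hv (map product_word F4_data))"
      using F4_checks(8) ds(1) by (simp only: list_all_iff map_map)
    then show "dual w \<in> L"
      unfolding ds(2) dual_word_product[OF l] L_def F4_L
      using words_mem[OF dual_word_lists[OF l] F4_data_words_subset] by blast
  qed
qed

end

section \<open>The type E6\<close>

definition E6_cartan :: "nat \<Rightarrow> nat \<Rightarrow> int" where
  "E6_cartan k m = (if k = m then 2
     else if (k, m) \<in> set [(1, 2), (2, 1), (2, 3), (3, 2), (3, 4), (4, 3), (4, 5), (5, 4), (3, 6), (6, 3)]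
     then -1 else 0)"

text \<open>The outcome of the enumeration: 15 elements, of which 5 belong to the two D5 subsystems;
  the nodes 1 and 5 contribute none.\<close>

definition E6_words_by_descent :: "nat \<Rightarrow> nat list list" where
  "E6_words_by_descent i = (
    if i = 2 then [[2, 1, 3, 2, 4, 3, 6, 3, 2, 1, 4, 3, 2],
      [3, 2, 1, 4, 3, 2, 6, 3, 2, 1, 4, 3, 2, 5, 4, 3, 6, 3, 2, 1, 4, 3, 2],
      [4, 3, 2, 1, 5, 4, 3, 2, 6, 3, 2, 1, 4, 3, 2, 5, 4, 3, 6, 3, 2, 1, 4, 3, 2]] else
    if i = 3 then [[3, 2, 4, 3, 6, 3, 2, 4, 3],
      [3, 2, 1, 4, 3, 2, 6, 3, 2, 1, 4, 3, 2, 6, 3],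
      [3, 2, 4, 3, 5, 4, 6, 3, 2, 4, 3, 5, 4, 6, 3],
      [3, 2, 1, 4, 3, 2, 5, 4, 3, 6, 3, 2, 1, 4, 3, 2, 5, 4, 3],
      [4, 3, 2, 1, 5, 4, 3, 2, 6, 3, 2, 1, 4, 3, 2, 5, 4, 3, 6, 3, 2, 4, 3],
      [3, 2, 1, 4, 3, 2, 5, 4, 6, 3, 2, 1, 4, 3, 2, 5, 4, 3, 6, 3, 2, 4, 3],
      [2, 1, 3, 2, 4, 3, 5, 4, 6, 3, 2, 1, 4, 3, 2, 5, 4, 3, 6, 3, 2, 4, 3],
      [3, 2, 1, 4, 3, 2, 5, 4, 3, 6, 3, 2, 1, 4, 3, 2, 5, 4, 3, 6, 3, 2, 1, 4, 3, 2, 5, 4, 3]] else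
    if i = 4 then [[4, 3, 2, 5, 4, 3, 6, 3, 2, 4, 3, 5, 4],
      [3, 2, 4, 3, 5, 4, 6, 3, 2, 1, 4, 3, 2, 5, 4, 3, 6, 3, 2, 4, 3, 5, 4],
      [2, 1, 3, 2, 4, 3, 5, 4, 6, 3, 2, 1, 4, 3, 2, 5, 4, 3, 6, 3, 2, 4, 3, 5, 4]] else
    if i = 6 then [[6, 3, 2, 1, 4, 3, 2, 5, 4, 3, 6, 3, 2, 1, 4, 3, 2, 5, 4, 3, 6]] else
    [])"

definition E6_data :: "root_datum list list" where
  "E6_data =
    [[([1, 2, 3, 2, 1, 1], [3, 2, 1, 4, 3, 2, 5, 4, 3], 6)],
     [([1, 2, 3, 2, 1, 2], [6, 3, 2, 1, 4, 3, 2, 5, 4, 3], 6)],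
     [([1, 2, 3, 2, 1, 1], [3, 2, 1, 4, 3, 2, 5, 4, 3], 6), ([0, 1, 1, 0, 0, 1], [2, 3], 6), ([0, 0, 1, 1, 0, 1], [4, 3], 6)],
     [([0, 1, 2, 2, 1, 1], [4, 3, 2, 5, 4, 3], 6), ([1, 2, 2, 1, 0, 1], [2, 1, 3, 2, 4, 3], 6), ([1, 1, 2, 1, 1, 1], [1, 3, 2, 5, 4, 3], 6)]]"

text \<open>The elements of a subsystem are picked out as the words with letters in
  \<open>J\<close>; that this is its complete list is confirmed by separate enumerations.\<close>

definition E6_sub_words :: "nat list \<Rightarrow> nat \<Rightarrow> nat list list" where
  "E6_sub_words J i = filter (list_all (List.member J)) (E6_words_by_descent i)"

definition E6_NGT_words :: "nat list \<Rightarrow> nat list list" where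
  "E6_NGT_words J = concat (map (E6_sub_words J) J)"

lemma E6_enumeration:
  "list_all (\<lambda>i. unique_descent_words E6_cartan [1..<Suc 6] [1..<Suc 6] i = Some (E6_sub_words [1..<Suc 6] i)) [1..<Suc 6]"
  "list_all (\<lambda>J. list_all (\<lambda>i. unique_descent_words E6_cartan J J i = Some (E6_sub_words J i)) J)
     [[1, 2, 3, 4, 6], [2, 3, 4, 5, 6], [2, 3, 4, 6]]"
  by code_simp+

abbreviation "E6_hv \<equiv> height_vector E6_cartan [1..<Suc 6]"

text \<open>The last fact says that none of the six words in \<open>E6_words\<close> represents an
  involution.\<close>

lemma E6_checks:
  "list_all (check_product E6_cartan 6) E6_data"
  "list_all (list_all (\<lambda>k. 1 \<le> k \<and> k \<le> 6)) E6_words"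
  "set (map E6_hv (E6_NGT_words [1, 2, 3, 4, 6] @ E6_NGT_words [2, 3, 4, 5, 6])) \<subseteq>
     set (map E6_hv (E6_NGT_words [1..<Suc 6]))"
  "length (remdups (map E6_hv (E6_NGT_words [1, 2, 3, 4, 6]))) = 3"
  "length (remdups (map E6_hv (E6_NGT_words [2, 3, 4, 5, 6]))) = 3"
  "length (remdups (map E6_hv (E6_NGT_words [2, 3, 4, 6]))) = 1"
  "length (remdups (map E6_hv (E6_NGT_words [1, 2, 3, 4, 6] @ E6_NGT_words [2, 3, 4, 5, 6]))) = 5"
  "set (map E6_hv (filter (\<lambda>x. E6_hv x \<in> set (map E6_hv (E6_NGT_words [2, 3, 4, 5, 6]))) (E6_NGT_words [1, 2, 3, 4, 6]))) =
     set (map E6_hv (E6_NGT_words [2, 3, 4, 6]))"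
  "length (remdups (map E6_hv (map product_word E6_data @ E6_words))) = 10"
  "list_all (\<lambda>ws. E6_hv (ws @ ws) \<noteq> E6_hv []) E6_words"
  by code_simp+

lemma E6_check_difference:
  "set (map E6_hv (filter (\<lambda>x. E6_hv x \<notin>
       set (map E6_hv (E6_NGT_words [1, 2, 3, 4, 6] @ E6_NGT_words [2, 3, 4, 5, 6]))) (E6_NGT_words [1..<Suc 6]))) =
     set (map E6_hv (map product_word E6_data @ E6_words))"
  by code_simp

lemma E6_data_roots:
  "map (map (\<lambda>d. root_of_coeffs \<alpha> (fst d))) E6_data = E6_single_roots \<alpha> @ E6_root_triples \<alpha>"
  by (simp add: E6_data_def E6_single_roots_def E6_root_triples_def)

lemma E6_cartan_eq_adjacent:
  "E6_cartan k m = (if k = m then 2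
     else if (k, m) \<in> {(1, 2), (2, 3), (3, 4), (4, 5), (3, 6)} \<or> (m, k) \<in> {(1, 2), (2, 3), (3, 4), (4, 5), (3, 6)}
     then -1 else 0)"
  by (auto simp: E6_cartan_def)

text \<open>The two fork roots are solved for the last two frame vectors, and each earlier one is
  obtained by adding a chain root. As \<open>v i\<close> is a sum or difference of two orthogonal
  vectors of equal length, their squared length is \<open>N / 2\<close>.\<close>

lemma D5_frame:
  fixes v :: "nat \<Rightarrow> 'a::real_inner"
  assumes "0 < N" "\<And>i. i \<in> {1, 2, 3, 4, 5} \<Longrightarrow> v i \<bullet> v i = N"
    and "v 1 \<bullet> v 2 = - N / 2" "v 2 \<bullet> v 3 = - N / 2" "v 3 \<bullet> v 4 = - N / 2" "v 3 \<bullet> v 5 = - N / 2"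
    and "v 1 \<bullet> v 3 = 0" "v 1 \<bullet> v 4 = 0" "v 1 \<bullet> v 5 = 0" "v 2 \<bullet> v 4 = 0" "v 2 \<bullet> v 5 = 0" "v 4 \<bullet> v 5 = 0"
  obtains \<epsilon> where "coordinate_frame 5 \<epsilon>" "\<And>i. 1 \<le> i \<Longrightarrow> i < 5 \<Longrightarrow> v i = \<epsilon> i - \<epsilon> (i + 1)" "v 5 = \<epsilon> 4 + \<epsilon> 5"
proof -
  define e5 where "e5 = (1/2) *\<^sub>R (v 5 - v 4)"
  define e4 where "e4 = (1/2) *\<^sub>R (v 4 + v 5)"
  define e3 where "e3 = v 3 + e4"
  define e2 where "e2 = v 2 + e3"
  define e1 where "e1 = v 1 + e2"
  note sq = assms(2)[of 1, simplified] assms(2)[of 2, simplified] assms(2)[of 3, simplified]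
    assms(2)[of 4, simplified] assms(2)[of 5, simplified]
  have sym: "v j \<bullet> v i = v i \<bullet> v j" for i j by (rule inner_commute)
  note g = sq assms(3-12) sym[of 2 1] sym[of 3 2] sym[of 4 3] sym[of 5 3] sym[of 3 1] sym[of 4 1] sym[of 5 1]
    sym[of 4 2] sym[of 5 2] sym[of 5 4]
  have i4: "e5 \<bullet> e5 = N / 2" "e4 \<bullet> e4 = N / 2" "e4 \<bullet> e5 = 0" "v 3 \<bullet> e4 = - N / 2" "v 3 \<bullet> e5 = 0"
    "v 2 \<bullet> e4 = 0" "v 2 \<bullet> e5 = 0" "v 1 \<bullet> e4 = 0" "v 1 \<bullet> e5 = 0"
    by (simp_all add: e4_def e5_def inner_simps g)
  have i3: "e3 \<bullet> e3 = N / 2" "e3 \<bullet> e4 = 0" "e3 \<bullet> e5 = 0" "v 2 \<bullet> e3 = - N / 2" "v 1 \<bullet> e3 = 0"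
    by (simp_all add: e3_def inner_simps g i4 inner_commute[of e4 "v 3"])
  have i2: "e2 \<bullet> e2 = N / 2" "e2 \<bullet> e3 = 0" "e2 \<bullet> e4 = 0" "e2 \<bullet> e5 = 0" "v 1 \<bullet> e2 = - N / 2"
    by (simp_all add: e2_def inner_simps g i3 i4 inner_commute[of e3 "v 2"])
  have i1: "e1 \<bullet> e1 = N / 2" "e1 \<bullet> e2 = 0" "e1 \<bullet> e3 = 0" "e1 \<bullet> e4 = 0" "e1 \<bullet> e5 = 0"
    by (simp_all add: e1_def inner_simps g i2 i3 i4 inner_commute[of e2 "v 1"])
  note comm = inner_commute[of e4 e3] inner_commute[of e4 e2] inner_commute[of e4 e1]
    inner_commute[of e3 e2] inner_commute[of e3 e1] inner_commute[of e2 e1]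
  define \<epsilon> where "\<epsilon> k = [e1, e2, e3, e4, e5] ! (k - 1)" for k
  have \<epsilon>: "\<epsilon> 1 = e1" "\<epsilon> 2 = e2" "\<epsilon> 3 = e3" "\<epsilon> 4 = e4" "\<epsilon> 5 = e5"
    by (simp_all add: \<epsilon>_def)
  have five: "i \<in> {1..5::nat} \<longleftrightarrow> i = 1 \<or> i = 2 \<or> i = 3 \<or> i = 4 \<or> i = 5" for i by auto
  have "\<epsilon> i \<bullet> \<epsilon> j = (if i = j then N / 2 else 0)" if "i \<in> {1..5}" "j \<in> {1..5}" for i j
    using that unfolding five by (elim disjE) (simp_all add: \<epsilon> i1 i2 i3 i4 inner_commute[of e5 e4] inner_commute[of e5 e3]
        inner_commute[of e5 e2] inner_commute[of e5 e1] comm)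
  then have "coordinate_frame 5 \<epsilon>"
    using assms(1) unfolding coordinate_frame_def by (intro exI[of _ "N / 2"]) simp
  moreover have "v i = \<epsilon> i - \<epsilon> (i + 1)" if "1 \<le> i" "i < 5" for i
  proof -
    have "v 4 = e4 - e5" by (simp add: e4_def e5_def scaleR_add_right scaleR_diff_right flip: scaleR_add_left)
    moreover have "i = 1 \<or> i = 2 \<or> i = 3 \<or> i = 4" using that by auto
    ultimately show ?thesis by (elim disjE) (simp_all add: \<epsilon>, simp_all add: e1_def e2_def e3_def)
  qed
  moreover have "v 5 = \<epsilon> 4 + \<epsilon> 5"
    by (simp add: \<epsilon> e4_def e5_def scaleR_add_right scaleR_diff_right flip: scaleR_add_left)
  ultimately show thesis by (rule that)
qed

locale E6_system = simple_system R \<alpha> "{1..6}"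
  for R :: "'a::real_inner set" and \<alpha> :: "nat \<Rightarrow> 'a" +
  assumes E6: "type_E6 \<alpha>"
begin

lemma E6_cartan_eq:
  assumes "k \<in> {1..6}" "m \<in> {1..6}"
  shows "cartan k m = of_int (E6_cartan k m)"
proof -
  let ?S = "{(1, 2), (2, 3), (3, 4), (4, 5), (3, 6)} :: (nat \<times> nat) set"
  have less: "cartan i j = (if (i, j) \<in> ?S then -1 else 0) \<and> cartan j i = (if (i, j) \<in> ?S then -1 else 0)"
    if ij: "i \<in> {1..6}" "j \<in> {1..6}" "i < j" for i j
  proof -
    have l: "laces (\<alpha> i) (\<alpha> j) = (if (i, j) \<in> ?S then 1 else 0)"
      using E6 ij unfolding type_E6_def by blast
    show ?thesis
    proof (cases "(i, j) \<in> ?S")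
      case True
      then have "laces (\<alpha> i) (\<alpha> j) = 1" using l by (simp only: if_True)
      then have "cartan i j = -1 \<and> cartan j i = -1" using laces_1[OF ij(1,2)] ij(3) by blast
      then show ?thesis using True by (simp only: if_True)
    next
      case False
      then have "laces (\<alpha> i) (\<alpha> j) = 0" using l by (simp only: if_False)
      then have "cartan i j = 0 \<and> cartan j i = 0" using laces_0[OF ij(1,2)] ij(3) by blast
      then show ?thesis using False by (simp only: if_False)
    qed
  qed
  have asym: "(j, i) \<notin> ?S" if "i < j" for i j :: nat using that by auto
  consider "k = m" | "k < m" | "m < k" by linarith
  then show ?thesis
  proof cases
    case 1
    then show ?thesis using assms by (simp add: cartan_self E6_cartan_eq_adjacent)
  next
    case 2
    then show ?thesis using less[OF assms 2] asym[OF 2] unfolding E6_cartan_eq_adjacent by (simp only: if_False) auto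
  next
    case 3
    then show ?thesis using less[OF assms(2,1) 3] asym[OF 3] unfolding E6_cartan_eq_adjacent by (simp only: if_False) auto
  qed
qed

sublocale standard_cartan_system R \<alpha> 6 E6_cartan
  by unfold_locales (use E6_cartan_eq in auto)

definition "N = \<alpha> 1 \<bullet> \<alpha> 1"

lemma N_pos: "0 < N"
  unfolding N_def by (intro root_inner_pos simple_root) simp

lemma simple_norm: "i \<in> {1..6} \<Longrightarrow> \<alpha> i \<bullet> \<alpha> i = N"
proof -
  assume i: "i \<in> {1..6}"
  have adj: "\<alpha> k \<bullet> \<alpha> k = \<alpha> m \<bullet> \<alpha> m" if "(k, m) \<in> {(1, 2), (2, 3), (3, 4), (4, 5), (3, 6)}" for k m
    using that by (intro norm_eq_if_cartan) (auto simp: E6_cartan_eq E6_cartan_def)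
  have "i = 1 \<or> i = 2 \<or> i = 3 \<or> i = 4 \<or> i = 5 \<or> i = 6" using i by auto
  then show ?thesis
    using adj[of 1 2] adj[of 2 3] adj[of 3 4] adj[of 4 5] adj[of 3 6] unfolding N_def by (elim disjE) simp_all
qed

lemma root_norm_N: "r \<in> R \<Longrightarrow> r \<bullet> r = N"
  using root_norm_simple[of r] simple_norm by metis

lemma simple_inner:
  assumes "i \<in> {1..6}" "j \<in> {1..6}"
  shows "\<alpha> i \<bullet> \<alpha> j = N / 2 * of_int (E6_cartan i j)"
  using cartan_eq_inner[OF assms(1), of j] simple_norm[OF assms(1)] E6_cartan_eq[OF assms]
  by (simp add: mult.commute)

text \<open>All roots have the squared length \<open>N\<close>, so the length condition is vacuous
  and every node is admissible. The same argument serves E6 and its subsystems of type D.\<close>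

lemma NGT_sub:
  assumes "distinct J" "set J \<subseteq> {1..6}" "X = Type_D \<or> X = Type_E"
    and enum: "list_all (\<lambda>i. unique_descent_words E6_cartan J J i = Some (E6_sub_words J i)) J"
  shows "minimal_NGTs X (subsystem R \<alpha> (set J)) \<alpha> (set J) = word_product \<alpha> ` set (E6_NGT_words J)"
    and "set (E6_NGT_words J) \<subseteq> lists {1..6}"
proof -
  let ?Q = "subsystem R \<alpha> (set J)"
  interpret Q: cartan_system ?Q \<alpha> "set J" J E6_cartan
    by (rule cartan_system_subsystem[OF assms(1,2) E6_cartan_eq])
  have sub: "?Q \<subseteq> R" by (auto simp: subsystem_def)
  have js: "set J = {j \<in> set J. \<alpha> j \<bullet> \<alpha> j = \<alpha> i \<bullet> \<alpha> i}" if "i \<in> set J" for i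
  proof -
    have "\<alpha> j \<bullet> \<alpha> j = N" if "j \<in> set J" for j using simple_norm assms(2) that by blast
    then show ?thesis using that by auto
  qed
  have res: "unique_descent_words E6_cartan J J i = Some (E6_sub_words J i)" if "i \<in> set J" for i
    using enum that by (simp only: list_all_iff)
  have lc: "length_condition X ?Q {b, g, \<alpha> i} \<longleftrightarrow> i \<in> set J \<and> b \<bullet> b = \<alpha> i \<bullet> \<alpha> i \<and> g \<bullet> g = \<alpha> i \<bullet> \<alpha> i"
    if "i \<in> set J" "b \<in> ?Q" "g \<in> ?Q" for i b g
  proof -
    have "\<alpha> i \<bullet> \<alpha> i = N" using simple_norm assms(2) that(1) by blast
    moreover have "b \<bullet> b = N" "g \<bullet> g = N" using root_norm_N sub that(2,3) by blast+
    ultimately show ?thesis using that(1) assms(3) by auto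
  qed
  have all: "(\<Union>i\<in>set J. set (E6_sub_words J i)) = set (E6_NGT_words J)"
    by (simp add: E6_NGT_words_def)
  note * = Q.minimal_NGTs_eq_words[where S = "set J" and X = X and res = "E6_sub_words J" and js = "\<lambda>_. J",
      OF subset_refl js res lc, unfolded all]
  show "minimal_NGTs X ?Q \<alpha> (set J) = word_product \<alpha> ` set (E6_NGT_words J)" by (rule *(1))
  show "set (E6_NGT_words J) \<subseteq> lists {1..6}" using *(2) lists_mono[OF assms(2)] by blast
qed

lemma subsystem_all: "subsystem R \<alpha> {1..6} = R"
  using root_in_span by (auto simp: subsystem_def)

lemma NGT_E6:
  "minimal_NGTs Type_E R \<alpha> {1..6} = word_product \<alpha> ` set (E6_NGT_words [1..<Suc 6])"
  "set (E6_NGT_words [1..<Suc 6]) \<subseteq> lists {1..6}"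
proof -
  have J: "distinct [1..<Suc 6]" "set [1..<Suc 6] \<subseteq> {1..6}" by auto
  note * = NGT_sub[OF J disjI2[OF refl] E6_enumeration(1)]
  have "set [1..<Suc 6] = {1..6::nat}" by auto
  then show "minimal_NGTs Type_E R \<alpha> {1..6} = word_product \<alpha> ` set (E6_NGT_words [1..<Suc 6])"
    "set (E6_NGT_words [1..<Suc 6]) \<subseteq> lists {1..6}"
    using * subsystem_all by simp_all
qed

lemma NGT_D:
  assumes "J \<in> {[1, 2, 3, 4, 6], [2, 3, 4, 5, 6], [2, 3, 4, 6]}"
  shows "minimal_NGTs Type_D (subsystem R \<alpha> (set J)) \<alpha> (set J) = word_product \<alpha> ` set (E6_NGT_words J)"
    and "set (E6_NGT_words J) \<subseteq> lists {1..6}"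
proof -
  have e: "list_all (\<lambda>i. unique_descent_words E6_cartan J J i = Some (E6_sub_words J i)) J"
    using bspec[OF E6_enumeration(2)[unfolded list_all_iff], of J] assms unfolding list_all_iff by simp
  have J: "distinct J" "set J \<subseteq> {1..6}" using assms by auto
  show "minimal_NGTs Type_D (subsystem R \<alpha> (set J)) \<alpha> (set J) = word_product \<alpha> ` set (E6_NGT_words J)"
    "set (E6_NGT_words J) \<subseteq> lists {1..6}"
    using NGT_sub[OF J disjI1[OF refl] e] by simp_all
qed

text \<open>In both lists the third node is the branch node, the first two lead to it from the free
  end, and the last two are the fork.\<close>

lemma D5_coordinates:
  assumes L: "L = [1, 2, 3, 4, 6] \<or> L = [5, 4, 3, 2, 6]"
  shows "\<exists>\<epsilon>. bourbaki_coordinates Type_D 5 \<epsilon> (subsystem R \<alpha> (set L)) (\<lambda>k. \<alpha> (L ! (k - 1))) \<and>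
    minimal_NGTs Type_D (subsystem R \<alpha> (set L)) \<alpha> (set L) =
      {reflection_product (telescoping_roots Type_D 5 \<epsilon> i j) | i j. (i, j) \<in> telescoping_range Type_D 5}"
proof -
  let ?Q = "subsystem R \<alpha> (set L)" and ?v = "\<lambda>k. \<alpha> (L ! (k - 1))"
  have "set L \<subseteq> {1..6}" using L by auto
  then interpret Q: simple_system ?Q \<alpha> "set L" by (rule simple_system_subsystem)
  have five: "{1..5::nat} = {1, 2, 3, 4, 5}" by auto
  have p: "inj_on (\<lambda>k. L ! (k - 1)) {1..5}" "(\<lambda>k. L ! (k - 1)) ` {1..5} = set L"
    unfolding five using L by (elim disjE; force simp: inj_on_def)+
  interpret V: simple_system ?Q ?v "{1..5}" by (rule Q.relabelled(2)[OF p])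
  have inn: "?v 1 \<bullet> ?v 2 = - N / 2" "?v 2 \<bullet> ?v 3 = - N / 2" "?v 3 \<bullet> ?v 4 = - N / 2" "?v 3 \<bullet> ?v 5 = - N / 2"
    "?v 1 \<bullet> ?v 3 = 0" "?v 1 \<bullet> ?v 4 = 0" "?v 1 \<bullet> ?v 5 = 0" "?v 2 \<bullet> ?v 4 = 0" "?v 2 \<bullet> ?v 5 = 0" "?v 4 \<bullet> ?v 5 = 0"
    using L by (elim disjE; simp add: simple_inner E6_cartan_def)+
  have sq: "?v i \<bullet> ?v i = N" if "i \<in> {1, 2, 3, 4, 5}" for i
    using L that by (elim disjE) (auto simp: simple_norm)
  obtain \<epsilon> where \<epsilon>: "coordinate_frame 5 \<epsilon>" "\<And>i. 1 \<le> i \<Longrightarrow> i < 5 \<Longrightarrow> ?v i = \<epsilon> i - \<epsilon> (i + 1)" "?v 5 = \<epsilon> 4 + \<epsilon> 5"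
    using D5_frame[of N ?v, OF N_pos sq inn] by blast
  interpret D: type_D_frame ?Q ?v 5 \<epsilon>
    by unfold_locales (use \<epsilon> in simp_all)
  interpret C: classical_system ?Q ?v 5 Type_D \<epsilon>
    by unfold_locales (use D.type_D_coordinates in simp_all)
  show ?thesis
    using D.type_D_coordinates C.minimal_NGTs_classical Q.relabelled(3)[OF p, of Type_D]
    by (intro exI[of _ \<epsilon>] conjI) simp_all
qed

lemma E6_products: "ds \<in> set E6_data \<Longrightarrow> check_product E6_cartan 6 ds"
  using E6_checks(1) by (simp only: list_all_iff)

abbreviation "roots_of ds \<equiv> map (\<lambda>d. root_of_coeffs \<alpha> (fst d)) ds"

lemma E6_data_words_subset: "set (map product_word E6_data) \<subseteq> lists {1..6}"
  using check_product(4)[OF E6_products] by (simp only: set_map) blast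

lemma E6_words_subset: "set E6_words \<subseteq> lists {1..6}"
  using E6_checks(2) by (auto simp: list_all_iff in_lists_conv_set)

lemma E6_L1: "reflection_product ` set (E6_single_roots \<alpha> @ E6_root_triples \<alpha>) = word_product \<alpha> ` set (map product_word E6_data)"
proof -
  have "reflection_product (roots_of ds) = word_product \<alpha> (product_word ds)" if "ds \<in> set E6_data" for ds
    by (rule check_product(3)[OF E6_products[OF that]])
  then show ?thesis unfolding E6_data_roots[symmetric] by (simp add: image_image)
qed

lemma E6_root_lists:
  "\<forall>rs\<in>set (E6_single_roots \<alpha> @ E6_root_triples \<alpha>). set rs \<subseteq> R \<and> sorted_wrt orthogonal rs"
proof -
  have "set (roots_of ds) \<subseteq> R \<and> sorted_wrt orthogonal (roots_of ds)" if "ds \<in> set E6_data" for ds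
    by (intro conjI check_product(1,2)[OF E6_products[OF that]])
  then show ?thesis unfolding E6_data_roots[symmetric] by (simp only: set_map ball_simps) blast
qed

text \<open>A product of reflections in pairwise orthogonal roots is an involution, and the height
  vectors show that these elements are not.\<close>

lemma E6_not_orthogonal:
  assumes "w \<in> word_product \<alpha> ` set E6_words"
  shows "\<not> orthogonal_reflections_product R w"
proof
  assume "orthogonal_reflections_product R w"
  then have "w \<circ> w = id" by (rule orthogonal_reflections_product_involution)
  obtain ws where ws: "ws \<in> set E6_words" "w = word_product \<alpha> ws" using assms by blast
  then have l: "ws @ ws \<in> lists {1..6}" "[] \<in> lists {1..6}" using E6_words_subset by auto
  have "word_product \<alpha> (ws @ ws) = word_product \<alpha> []"
    using \<open>w \<circ> w = id\<close> ws(2) by (simp add: word_product_append)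
  then have "E6_hv (ws @ ws) = E6_hv []" using hv_eq_iff[OF l] by blast
  moreover have "E6_hv (ws @ ws) \<noteq> E6_hv []" using E6_checks(10) ws(1) by (simp only: list_all_iff) blast
  ultimately show False by simp
qed

lemma E6_sets:
  defines "N1 \<equiv> minimal_NGTs Type_D (subsystem R \<alpha> {1,2,3,4,6}) \<alpha> {1,2,3,4,6}"
    and "N2 \<equiv> minimal_NGTs Type_D (subsystem R \<alpha> {2,3,4,5,6}) \<alpha> {2,3,4,5,6}"
    and "N4 \<equiv> minimal_NGTs Type_D (subsystem R \<alpha> {2,3,4,6}) \<alpha> {2,3,4,6}"
    and "L1 \<equiv> reflection_product ` set (E6_single_roots \<alpha> @ E6_root_triples \<alpha>)"
    and "L2 \<equiv> word_product \<alpha> ` set E6_words"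
  shows "N1 \<union> N2 \<subseteq> minimal_NGTs Type_E R \<alpha> {1..6}" "card N1 = 3" "card N2 = 3" "N1 \<inter> N2 = N4"
    "card N4 = 1" "card (N1 \<union> N2) = 5" "minimal_NGTs Type_E R \<alpha> {1..6} - (N1 \<union> N2) = L1 \<union> L2"
    "card (L1 \<union> L2) = 10"
proof -
  let ?w1 = "E6_NGT_words [1, 2, 3, 4, 6]" and ?w2 = "E6_NGT_words [2, 3, 4, 5, 6]" and ?w4 = "E6_NGT_words [2, 3, 4, 6]"
  have n: "N1 = word_product \<alpha> ` set ?w1" "N2 = word_product \<alpha> ` set ?w2" "N4 = word_product \<alpha> ` set ?w4"
    unfolding N1_def N2_def N4_def
    using NGT_D(1)[of "[1, 2, 3, 4, 6]"] NGT_D(1)[of "[2, 3, 4, 5, 6]"] NGT_D(1)[of "[2, 3, 4, 6]"] by simp_all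
  have l: "set ?w1 \<subseteq> lists {1..6}" "set ?w2 \<subseteq> lists {1..6}" "set ?w4 \<subseteq> lists {1..6}"
    using NGT_D(2) by simp_all
  have l12: "set (?w1 @ ?w2) \<subseteq> lists {1..6}" using l by simp
  have n12: "N1 \<union> N2 = word_product \<alpha> ` set (?w1 @ ?w2)" unfolding n by (simp add: image_Un)
  have lL: "set (map product_word E6_data @ E6_words) \<subseteq> lists {1..6}"
    using E6_data_words_subset E6_words_subset by simp
  have L12: "L1 \<union> L2 = word_product \<alpha> ` set (map product_word E6_data @ E6_words)"
    unfolding L1_def L2_def E6_L1 by (simp add: image_Un)
  show "N1 \<union> N2 \<subseteq> minimal_NGTs Type_E R \<alpha> {1..6}"
    unfolding n12 NGT_E6 by (rule words_subset[OF l12 NGT_E6(2) E6_checks(3)])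
  show "card N1 = 3" "card N2 = 3" "card N4 = 1" "card (N1 \<union> N2) = 5"
    unfolding n12 unfolding n words_card[OF l(1)] words_card[OF l(2)] words_card[OF l(3)] words_card[OF l12]
    by (rule E6_checks)+
  show "N1 \<inter> N2 = N4"
    unfolding n words_Int[OF l(1,2)] using l E6_checks(8) by (intro words_eq) auto
  show "minimal_NGTs Type_E R \<alpha> {1..6} - (N1 \<union> N2) = L1 \<union> L2"
    unfolding n12 NGT_E6 L12 words_diff[OF NGT_E6(2) l12]
    by (intro words_eq[OF _ lL E6_check_difference]) (use NGT_E6(2) in \<open>simp only: set_filter\<close>, blast)
  show "card (L1 \<union> L2) = 10" unfolding L12 words_card[OF lL] by (rule E6_checks(9))
qed

end

section \<open>The classification\<close>

theorem theorem2:
  fixes R :: "'a::real_inner set" and \<alpha> :: "nat \<Rightarrow> 'a" and n :: nat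
  assumes "root_system R" and "reduced_system R" and "irreducible_system R"
    and "simple_roots R \<alpha> {1..n}"
  shows
    \<comment> \<open>types B, C, D\<close>
    "(\<forall>X \<epsilon>. bourbaki_coordinates X n \<epsilon> R \<alpha> \<and> n \<ge> (if X = Type_D then 4 else 3) \<longrightarrow>
       minimal_NGTs X R \<alpha> {1..n} =
         {reflection_product (telescoping_roots X n \<epsilon> i j) | i j. (i, j) \<in> telescoping_range X n} \<and>
       (\<forall>w b g a. minimal_NGT_triple X R \<alpha> {1..n} w b g a \<longleftrightarrow>
          (\<exists>i j. (i, j) \<in> telescoping_range X n \<and>
             g = \<epsilon> i + \<epsilon> j \<and> a = \<epsilon> j - \<epsilon> (j + 1) \<and> g = a + b \<and>
             w = reflection_product (telescoping_roots X n \<epsilon> i j))) \<and>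
       (\<forall>(i, j) \<in> telescoping_range X n.
          let rs = telescoping_roots X n \<epsilon> i j; w = reflection_product rs in
            set rs \<subseteq> R \<and> sorted_wrt orthogonal rs \<and> w \<circ> w = id \<and> \<epsilon> i + \<epsilon> j \<in> set rs)) \<and>
    \<comment> \<open>type F4\<close>
    (n = 4 \<and> type_F4 R \<alpha> \<longrightarrow>
       (let NGT = minimal_NGTs Type_F R \<alpha> {1..4};
            NGT_B3 = minimal_NGTs Type_B (subsystem R \<alpha> {1,2,3}) \<alpha> {1,2,3};
            NGT_C3 = minimal_NGTs Type_C (subsystem R \<alpha> {2,3,4}) \<alpha> {2,3,4};
            rss = F4_single_roots \<alpha> @ F4_root_pairs \<alpha>;
            L = reflection_product ` set rss;
            W = weyl_group \<alpha> {1..4}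
        in
          (\<forall>w\<in>NGT. orthogonal_reflections_product R w) \<and>
          (\<exists>w w' b g a. w \<noteq> w' \<and> minimal_NGT_triple Type_F R \<alpha> {1..4} w b g a \<and>
             minimal_NGT_triple Type_F R \<alpha> {1..4} w' b g a) \<and>
          NGT_B3 \<union> NGT_C3 \<subseteq> NGT \<and>
          card NGT_B3 = 1 \<and> card NGT_C3 = 1 \<and> card (NGT_B3 \<union> NGT_C3) = 2 \<and>
          NGT - (NGT_B3 \<union> NGT_C3) = L \<and> card L = 8 \<and>
          (\<forall>rs\<in>set rss. set rs \<subseteq> R \<and> sorted_wrt orthogonal rs) \<and>
          (\<exists>dual. bij_betw dual W W \<and>
             (\<forall>u\<in>W. \<forall>v\<in>W. dual (u \<circ> v) = dual u \<circ> dual v) \<and>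
             (\<forall>i\<in>{1..4}. dual (reflection (\<alpha> i)) = reflection (\<alpha> (5 - i))) \<and>
             (\<forall>w\<in>L. dual w \<in> L)))) \<and>
    \<comment> \<open>type E6\<close>
    (n = 6 \<and> type_E6 \<alpha> \<longrightarrow>
       (let NGT = minimal_NGTs Type_E R \<alpha> {1..6};
            R1 = subsystem R \<alpha> {1,2,3,4,6};
            R2 = subsystem R \<alpha> {2,3,4,5,6};
            NGT_D5_1 = minimal_NGTs Type_D R1 \<alpha> {1,2,3,4,6};
            NGT_D5_2 = minimal_NGTs Type_D R2 \<alpha> {2,3,4,5,6};
            NGT_D4 = minimal_NGTs Type_D (subsystem R \<alpha> {2,3,4,6}) \<alpha> {2,3,4,6};
            rss = E6_single_roots \<alpha> @ E6_root_triples \<alpha>;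
            L1 = reflection_product ` set rss;
            L2 = word_product \<alpha> ` set E6_words
        in
          NGT_D5_1 \<union> NGT_D5_2 \<subseteq> NGT \<and>
          card NGT_D5_1 = 3 \<and> card NGT_D5_2 = 3 \<and>
          NGT_D5_1 \<inter> NGT_D5_2 = NGT_D4 \<and> card NGT_D4 = 1 \<and>
          card (NGT_D5_1 \<union> NGT_D5_2) = 5 \<and>
          (\<exists>\<epsilon>. bourbaki_coordinates Type_D 5 \<epsilon> R1 (\<lambda>k. \<alpha> ([1,2,3,4,6] ! (k - 1))) \<and>
             NGT_D5_1 = {reflection_product (telescoping_roots Type_D 5 \<epsilon> i j) | i j.
                           (i, j) \<in> telescoping_range Type_D 5}) \<and>
          (\<exists>\<epsilon>. bourbaki_coordinates Type_D 5 \<epsilon> R2 (\<lambda>k. \<alpha> ([5,4,3,2,6] ! (k - 1))) \<and>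
             NGT_D5_2 = {reflection_product (telescoping_roots Type_D 5 \<epsilon> i j) | i j.
                           (i, j) \<in> telescoping_range Type_D 5}) \<and>
          NGT - (NGT_D5_1 \<union> NGT_D5_2) = L1 \<union> L2 \<and> card (L1 \<union> L2) = 10 \<and>
          (\<forall>rs\<in>set rss. set rs \<subseteq> R \<and> sorted_wrt orthogonal rs) \<and>
          (\<forall>w\<in>L2. \<not> orthogonal_reflections_product R w)))"
proof (intro conjI, goal_cases)
  case 1
  show ?case
  proof (intro allI impI, goal_cases)
    case (1 X \<epsilon>)
    then interpret C: classical_system R \<alpha> n X \<epsilon>
      by unfold_locales (use assms in auto)
    show ?case
      by (intro conjI allI)
        (rule C.minimal_NGTs_classical C.minimal_NGT_triple_classical C.telescoping_properties)+
  qed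
next
  case 2
  show ?case
  proof (rule impI, goal_cases)
    case 1
    then interpret F: F4_system R \<alpha>
      by unfold_locales (use assms in auto)
    have dual: "\<exists>dual. bij_betw dual F.W F.W \<and> (\<forall>u\<in>F.W. \<forall>v\<in>F.W. dual (u \<circ> v) = dual u \<circ> dual v) \<and>
        (\<forall>i\<in>{1..4}. dual (reflection (\<alpha> i)) = reflection (\<alpha> (5 - i))) \<and>
        (\<forall>w\<in>reflection_product ` set (F4_single_roots \<alpha> @ F4_root_pairs \<alpha>).
          dual w \<in> reflection_product ` set (F4_single_roots \<alpha> @ F4_root_pairs \<alpha>))"
      by (intro exI[of _ F.dual] conjI) (rule F.F4_dual)+
    show ?case
      unfolding Let_def
      by (intro conjI) (rule F.F4_involutions F.F4_not_unique F.F4_sets F.F4_root_lists dual)+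
  qed
next
  case 3
  show ?case
  proof (rule impI, goal_cases)
    case 1
    then interpret E: E6_system R \<alpha>
      by unfold_locales (use assms in auto)
    have 5: "set [1,2,3,4,6] = {1,2,3,4,6::nat}" "set [5,4,3,2,6] = {2,3,4,5,6::nat}" by auto
    note D5 = E.D5_coordinates[OF disjI1[OF refl], unfolded 5] E.D5_coordinates[OF disjI2[OF refl], unfolded 5]
    have not_orthogonal: "\<forall>w\<in>word_product \<alpha> ` set E6_words. \<not> orthogonal_reflections_product R w"
      using E.E6_not_orthogonal by blast
    show ?case
      unfolding Let_def
      by (intro conjI) (rule E.E6_sets D5 E.E6_root_lists not_orthogonal)+
  qed
qed

end
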